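(* Fix a difference equation $\hat{\boldsymbol\omega}=(1/\hat f,\hat q,\hat w)\in\Omega_N^{\mathbb{R},+}$. Then $(\hat{\boldsymbol\omega},\mathbf{C})$ has exactly $N-2$ eigenvalues; for each $\mathbf{A}\in\mathcal{B}_{2,3}\setminus\{\mathbf{C}\}$, $(\hat{\boldsymbol\omega},\mathbf{A})$ has exactly $N-1$ eigenvalues; and for each $\mathbf{A}\in\mathcal{O}_{2,3}^{\mathbb{C}}\setminus\mathcal{B}_{2,3}$, $(\hat{\boldsymbol\omega},\mathbf{A})$ has exactly $N$ eigenvalues $\lambda_n(\mathbf{A}):=\lambda_n(\hat{\boldsymbol\omega},\mathbf{A})$, $0\le n\le N-1$, which satisfy that: (i) the $\lambda_n(\mathbf{A})$ are continuous in $\mathcal{O}_{2,3}^{\mathbb{C}}\setminus\mathcal{B}_{2,3}$; (ii) the $\lambda_n(\mathbf{A})$ restricted in $\mathcal{B}_{2,3}^-$, $\mathcal{B}_{2,3r}^+$ and $\mathcal{B}_{2,3l}^+$ are non-decreasing in the $a_{11}$-direction and in the $b_{22}$-direction; (iii) the $\lambda_n(\mathbf{A})$, $0\le n\le N-1$, are not continuous at each point of $\mathcal{B}_{2,3}$ and furthermore: (iiia) they have the following asymptotic behaviors near any given $\mathbf{A}_0\in\mathcal{B}_{2,3r}$: $$\lim_{\mathcal{B}_{2,3}^-\cup\mathcal{B}_{2,3r}\ni\mathbf{A}\to\mathbf{A}_0}\lambda_n(\mathbf{A})=\lambda_n(\mathbf{A}_0),\ 0\le n\le N-2,\quad \lim_{\mathcal{B}_{2,3}^-\ni\mathbf{A}\to\mathbf{A}_0}\lambda_{N-1}(\mathbf{A})=+\infty,$$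 $$\lim_{\mathcal{B}_{2,3r}^+\ni\mathbf{A}\to\mathbf{A}_0}\lambda_0(\mathbf{A})=-\infty,\quad \lim_{\mathcal{B}_{2,3r}^+\ni\mathbf{A}\to\mathbf{A}_0}\lambda_n(\mathbf{A})=\lambda_{n-1}(\mathbf{A}_0),\ 1\le n\le N-1;$$ (iiib) they have the following asymptotic behaviors near any given $\mathbf{A}_0\in\mathcal{B}_{2,3l}$: $$\lim_{\mathcal{B}_{2,3}^-\ni\mathbf{A}\to\mathbf{A}_0}\lambda_0(\mathbf{A})=-\infty,\quad \lim_{\mathcal{B}_{2,3}^-\ni\mathbf{A}\to\mathbf{A}_0}\lambda_n(\mathbf{A})=\lambda_{n-1}(\mathbf{A}_0),\ 1\le n\le N-1,$$ $$\lim_{\mathcal{B}_{2,3l}^+\cup\mathcal{B}_{2,3l}\ni\mathbf{A}\to\mathbf{A}_0}\lambda_n(\mathbf{A})=\lambda_n(\mathbf{A}_0),\ 0\le n\le N-2,\quad \lim_{\mathcal{B}_{2,3l}^+\ni\mathbf{A}\to\mathbf{A}_0}\lambda_{N-1}(\mathbf{A})=+\infty;$$ (iiic) they have the following asymptotic behaviors near $\mathbf{C}$: $$\lim_{\mathcal{B}_{2,3r}^+\cup\mathcal{B}_{2,3r}\cup\mathcal{B}_{2,3}^-\ni\mathbf{A}\to\mathbf{C}}\lambda_0(\mathbf{A})=-\infty,\quad \lim_{\mathcal{B}_{2,3r}^+\ni\mathbf{A}\to\mathbf{C}}\lambda_1(\mathbf{A})=-\infty,$$ $$\lim_{\mathcal{B}_{2,3l}^+\cup\mathcal{B}_{2,3l}\ni\mathbf{A}\to\mathbf{C}}\lambda_n(\mathbf{A})=\lambda_n(\mathbf{C}),\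 0\le n\le N-3,$$ $$\lim_{\mathcal{B}_{2,3r}\cup\mathcal{B}_{2,3}^-\ni\mathbf{A}\to\mathbf{C}}\lambda_n(\mathbf{A})=\lambda_{n-1}(\mathbf{C}),\ 1\le n\le N-2,$$ $$\lim_{\mathcal{B}_{2,3r}^+\ni\mathbf{A}\to\mathbf{C}}\lambda_n(\mathbf{A})=\lambda_{n-2}(\mathbf{C}),\ 2\le n\le N-1,$$ $$\lim_{\mathcal{B}_{2,3l}^+\cup\mathcal{B}_{2,3l}\ni\mathbf{A}\to\mathbf{C}}\lambda_{N-2}(\mathbf{A})=+\infty,\quad \lim_{\mathcal{B}_{2,3l}^+\cup\mathcal{B}_{2,3}^-\ni\mathbf{A}\to\mathbf{C}}\lambda_{N-1}(\mathbf{A})=+\infty.$$ Consequently, $\lambda_n(\mathbf{A})$ restricted in $\mathcal{B}_{2,3}^-\cup\mathcal{B}_{2,3r}$ and in $\mathcal{B}_{2,3l}^+\cup\mathcal{B}_{2,3l}\cup\{\mathbf{C}\}$ is continuous for each $0\le n\le N-3$, and $\lambda_{N-2}(\mathbf{A})$ restricted in $\mathcal{B}_{2,3}^-\cup\mathcal{B}_{2,3r}$ and in $\mathcal{B}_{2,3l}^+\cup\mathcal{B}_{2,3l}$ is continuous.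
   Context: Fix an integer $N\ge 2$. A self-adjoint discrete Sturm–Liouville problem is a pair $(\boldsymbol\omega,\mathbf{A})$. Here $\boldsymbol\omega=(1/f,q,w)$ with real sequences $f=\{f_n\}_{n=0}^N$, $q=\{q_n\}_{n=1}^N$, $w=\{w_n\}_{n=1}^N$, $f_n\ne0$, $w_n>0$, encodes the equation $-\nabla(f_n\Delta y_n)+q_ny_n=\lambda w_ny_n$, $1\le n\le N$, for $y=(y_0,\dots,y_{N+1})$, with $\Delta y_n=y_{n+1}-y_n$, $\nabla y_n=y_n-y_{n-1}$; $\Omega_N^{\mathbb{R},+}\subset\mathbb{R}^{3N+1}$ is the set of all such $(1/f,q,w)$. $\mathbf{A}=[A\,|\,B]$ encodes the boundary condition $A\begin{pmatrix}y_0\\ f_0\Delta y_0\end{pmatrix}+B\begin{pmatrix}y_N\\ f_N\Delta y_N\end{pmatrix}=0$, where $A,B$ are complex $2\times2$ matrices with $\mathrm{rank}(A,B)=2$ and $AJA^*=BJB^*$, $J=\begin{pmatrix}0&1\\-1&0\end{pmatrix}$; $[A\,|\,B]$ is the class of the $2\times4$ matrix $(A,B)$ modulo left multiplication by $GL(2,\mathbb{C})$, and $\mathcal{B}^{\mathbb{C}}$ is the set of all such classes, topologized as a subspace of the quotient of the rank-2 complex $2\times4$ matrices by $GL(2,\mathbb{C})$. An eigenvalue of $(\boldsymbol\omega,\mathbf{A})$ is a $\lambda$ for which a nonzero $y$ solves the equation and the boundary condition. Eigenvalues are real and finite in number; they are counted with multiplicity (the dimension of the solution space) and listed as $\lambda_0\le\lambda_1\le\cdots$;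 $\lambda_n$ is defined at a problem only if it has more than $n$ eigenvalues, and $\lambda_n$ is regarded as not continuous at a point where it is not defined. Assertions over empty ranges of $n$ are vacuous. $\mathcal{O}_{2,3}^{\mathbb{C}}=\left\{\left[\begin{array}{cccc}a_{11}&-1&0&\bar z\\ z&0&-1&b_{22}\end{array}\right]:a_{11},b_{22}\in\mathbb{R},\ z\in\mathbb{C}\right\}$, an open subset of $\mathcal{B}^{\mathbb{C}}$ with coordinates $(a_{11},\mathrm{Re}\,z,\mathrm{Im}\,z,b_{22})$ identifying it with $\mathbb{R}^4$. For the fixed $\hat{\boldsymbol\omega}$ put $\mathbf{C}=\left[\begin{array}{cccc}1&1/\hat f_0&0&0\\0&0&1&0\end{array}\right]$ (the point $a_{11}=-\hat f_0$, $z=0$, $b_{22}=0$ of $\mathcal{O}_{2,3}^{\mathbb{C}}$) and, for $\mathbf{A}\in\mathcal{O}_{2,3}^{\mathbb{C}}$, $d(\mathbf{A})=(a_{11}+\hat f_0)b_{22}-|z|^2$. Then $\mathcal{B}_{2,3}=\{\mathbf{A}\in\mathcal{O}_{2,3}^{\mathbb{C}}:d(\mathbf{A})=0\}$; $\mathcal{B}_{2,3}^-=\{d(\mathbf{A})<0\}$; $\mathcal{B}_{2,3r}=\{\mathbf{A}\in\mathcal{B}_{2,3}:a_{11}+\hat f_0\ge0,\ b_{22}\ge0\}\setminus\{\mathbf{C}\}$; $\mathcal{B}_{2,3l}=\{\mathbf{A}\in\mathcal{B}_{2,3}:a_{11}+\hat f_0\le0,\ b_{22}\le0\}\setminus\{\mathbf{C}\}$;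 $\mathcal{B}_{2,3r}^+=\{d(\mathbf{A})>0,\ a_{11}+\hat f_0\ge0,\ b_{22}\ge0\}$; $\mathcal{B}_{2,3l}^+=\{d(\mathbf{A})>0,\ a_{11}+\hat f_0\le0,\ b_{22}\le0\}$. Monotone in a coordinate direction means with the other coordinates fixed.
   Formalization: In (iii), discontinuity of each λ_n at A_0 in B_{2,3} is claimed except when n≥1, λ_n(A_0) is defined and λ_{n-1}(A_0)=λ_n(A_0), where λ_n is in fact continuous (e.g. N=3, f=w=1, q=0, a11=-2, z=1, b22=-1, n=1); also, at no such point are all λ_n continuous. *)

theory Defs
  imports "HOL-Analysis.Analysis" "HOL-Library.Function_Algebras"
begin

text \<open>
  The coefficients \<open>f\<close>, \<open>q\<close>, \<open>w\<close> and the sequences \<open>y\<close> are total functions on \<open>nat\<close>;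
  only \<open>f 0, \<dots>, f N\<close>, \<open>q 1, \<dots>, q N\<close>, \<open>w 1, \<dots>, w N\<close> and \<open>y 0, \<dots>, y (N + 1)\<close> matter.
\<close>

definition in_Omega :: "nat \<Rightarrow> (nat \<Rightarrow> real) \<Rightarrow> (nat \<Rightarrow> real) \<Rightarrow> (nat \<Rightarrow> real) \<Rightarrow> bool" where
  "in_Omega N f q w \<longleftrightarrow> (\<forall>n\<le>N. f n \<noteq> 0) \<and> (\<forall>n\<in>{1..N}. w n > 0)"

definition fdiff :: "(nat \<Rightarrow> complex) \<Rightarrow> nat \<Rightarrow> complex" where
  "fdiff y n = y (n + 1) - y n"

definition bdiff :: "(nat \<Rightarrow> complex) \<Rightarrow> nat \<Rightarrow> complex" where
  "bdiff y n = y n - y (n - 1)"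

definition solves_equation ::
  "nat \<Rightarrow> (nat \<Rightarrow> real) \<Rightarrow> (nat \<Rightarrow> real) \<Rightarrow> (nat \<Rightarrow> real) \<Rightarrow> complex \<Rightarrow> (nat \<Rightarrow> complex) \<Rightarrow> bool" where
  "solves_equation N f q w lam y \<longleftrightarrow>
     (\<forall>n\<in>{1..N}. - bdiff (\<lambda>m. of_real (f m) * fdiff y m) n + of_real (q n) * y n
                  = lam * of_real (w n) * y n)"

text \<open>A matrix of type \<^typ>\<open>complex^4^2\<close> has 2 rows and 4 columns.\<close>

definition lblock :: "complex^4^2 \<Rightarrow> complex^2^2" where
  "lblock X = (\<chi> i j. if j = 1 then X $ i $ 1 else X $ i $ 2)"

definition rblock :: "complex^4^2 \<Rightarrow> complex^2^2" where
  "rblock X = (\<chi> i j. if j = 1 then X $ i $ 3 else X $ i $ 4)"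

definition cadjoint :: "complex^2^2 \<Rightarrow> complex^2^2" where
  "cadjoint A = map_matrix cnj (transpose A)"

definition Jmat :: "complex^2^2" where
  "Jmat = vector [vector [0, 1], vector [-1, 0]]"

definition full_rank :: "(complex^4^2) set" where
  "full_rank = {X. rank X = 2}"

definition GL_class :: "complex^4^2 \<Rightarrow> (complex^4^2) set" where
  "GL_class X = {T ** X |T :: complex^2^2. invertible T}"

definition BC :: "(complex^4^2) set set" where
  "BC = GL_class ` {X \<in> full_rank.
          lblock X ** Jmat ** cadjoint (lblock X) = rblock X ** Jmat ** cadjoint (rblock X)}"

definition quotient_top :: "(complex^4^2) set topology" where
  "quotient_top = topology (\<lambda>U. U \<subseteq> GL_class ` full_rank \<and>
     openin (top_of_set full_rank) {X \<in> full_rank. GL_class X \<in> U})"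

lemma openin_quotient_top:
  "openin quotient_top U \<longleftrightarrow> U \<subseteq> GL_class ` full_rank \<and>
     openin (top_of_set full_rank) {X \<in> full_rank. GL_class X \<in> U}"
proof -
  have 1: "{X \<in> full_rank. GL_class X \<in> S \<inter> T} =
      {X \<in> full_rank. GL_class X \<in> S} \<inter> {X \<in> full_rank. GL_class X \<in> T}" for S T
    by blast
  have 2: "{X \<in> full_rank. GL_class X \<in> \<Union>K} = (\<Union>S\<in>K. {X \<in> full_rank. GL_class X \<in> S})" for K
    by blast
  have "istopology (\<lambda>U. U \<subseteq> GL_class ` full_rank \<and>
     openin (top_of_set full_rank) {X \<in> full_rank. GL_class X \<in> U})"
    unfolding istopology_def 1 2
    by (intro conjI allI impI openin_Int openin_Union) auto
  then show ?thesis
    by (simp add: quotient_top_def topology_inverse')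
qed

definition BC_top :: "(complex^4^2) set topology" where
  "BC_top = subtopology quotient_top BC"

text \<open>The condition does not depend on the representative of the class.\<close>

definition satisfies_bc ::
  "nat \<Rightarrow> (nat \<Rightarrow> real) \<Rightarrow> (complex^4^2) set \<Rightarrow> (nat \<Rightarrow> complex) \<Rightarrow> bool" where
  "satisfies_bc N f \<A> y \<longleftrightarrow>
     (\<forall>X\<in>\<A>. lblock X *v vector [y 0, of_real (f 0) * fdiff y 0]
            + rblock X *v vector [y N, of_real (f N) * fdiff y N] = 0)"

interpretation seq: vector_space "\<lambda>(c::complex) (y :: nat \<Rightarrow> complex) n. c * y n"
  by unfold_locales (auto simp: fun_eq_iff algebra_simps)

text \<open>Sequences \<open>(y\<^sub>0, \<dots>, y\<^bsub>N+1\<^esub>)\<close> are represented by functions vanishing beyond \<open>N + 1\<close>.\<close>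

definition solution_space ::
  "nat \<Rightarrow> (nat \<Rightarrow> real) \<Rightarrow> (nat \<Rightarrow> real) \<Rightarrow> (nat \<Rightarrow> real) \<Rightarrow> (complex^4^2) set \<Rightarrow> complex
     \<Rightarrow> (nat \<Rightarrow> complex) set" where
  "solution_space N f q w \<A> lam =
     {y. (\<forall>n>N+1. y n = 0) \<and> solves_equation N f q w lam y \<and> satisfies_bc N f \<A> y}"

definition eigenvalues ::
  "nat \<Rightarrow> (nat \<Rightarrow> real) \<Rightarrow> (nat \<Rightarrow> real) \<Rightarrow> (nat \<Rightarrow> real) \<Rightarrow> (complex^4^2) set \<Rightarrow> complex set" where
  "eigenvalues N f q w \<A> = {lam. \<exists>y \<in> solution_space N f q w \<A> lam. y \<noteq> 0}"

definition multiplicity_of ::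
  "nat \<Rightarrow> (nat \<Rightarrow> real) \<Rightarrow> (nat \<Rightarrow> real) \<Rightarrow> (nat \<Rightarrow> real) \<Rightarrow> (complex^4^2) set \<Rightarrow> complex \<Rightarrow> nat" where
  "multiplicity_of N f q w \<A> lam = seq.dim (solution_space N f q w \<A> lam)"

definition exactly_eigenvalues ::
  "nat \<Rightarrow> (nat \<Rightarrow> real) \<Rightarrow> (nat \<Rightarrow> real) \<Rightarrow> (nat \<Rightarrow> real) \<Rightarrow> (complex^4^2) set \<Rightarrow> nat \<Rightarrow> bool" where
  "exactly_eigenvalues N f q w \<A> k \<longleftrightarrow>
     eigenvalues N f q w \<A> \<subseteq> \<real> \<and> finite (eigenvalues N f q w \<A>) \<and>
     (\<Sum>lam\<in>eigenvalues N f q w \<A>. multiplicity_of N f q w \<A> lam) = k"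

definition eigenvalue_list ::
  "nat \<Rightarrow> (nat \<Rightarrow> real) \<Rightarrow> (nat \<Rightarrow> real) \<Rightarrow> (nat \<Rightarrow> real) \<Rightarrow> (complex^4^2) set \<Rightarrow> real list" where
  "eigenvalue_list N f q w \<A> =
     concat (map (\<lambda>x. replicate (multiplicity_of N f q w \<A> (of_real x)) x)
       (sorted_list_of_set {x. of_real x \<in> eigenvalues N f q w \<A>}))"

text \<open>
  \<open>eig N f q w n \<A>\<close> is the eigenvalue \<open>\<lambda>\<^sub>n\<close> of the problem; it is a meaningful value only if
  \<open>eig_defined N f q w n \<A>\<close> holds.
\<close>

definition eig_defined ::
  "nat \<Rightarrow> (nat \<Rightarrow> real) \<Rightarrow> (nat \<Rightarrow> real) \<Rightarrow> (nat \<Rightarrow> real) \<Rightarrow> nat \<Rightarrow> (complex^4^2) set \<Rightarrow> bool" where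
  "eig_defined N f q w n \<A> \<longleftrightarrow> n < length (eigenvalue_list N f q w \<A>)"

definition eig ::
  "nat \<Rightarrow> (nat \<Rightarrow> real) \<Rightarrow> (nat \<Rightarrow> real) \<Rightarrow> (nat \<Rightarrow> real) \<Rightarrow> nat \<Rightarrow> (complex^4^2) set \<Rightarrow> real" where
  "eig N f q w n \<A> = eigenvalue_list N f q w \<A> ! n"

definition pt23 :: "real \<Rightarrow> complex \<Rightarrow> real \<Rightarrow> (complex^4^2) set" where
  "pt23 a z b = GL_class (vector [vector [of_real a, -1, 0, cnj z],
                                  vector [z, 0, -1, of_real b]])"

definition O23 :: "(complex^4^2) set set" where
  "O23 = {pt23 a z b |a z b. True}"

definition Cpt :: "real \<Rightarrow> (complex^4^2) set" where
  "Cpt f0 = GL_class (vector [vector [1, 1 / of_real f0, 0, 0], vector [0, 0, 1, 0]])"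

definition d23 :: "real \<Rightarrow> real \<Rightarrow> complex \<Rightarrow> real \<Rightarrow> real" where
  "d23 f0 a z b = (a + f0) * b - (cmod z)\<^sup>2"

definition B23 :: "real \<Rightarrow> (complex^4^2) set set" where
  "B23 f0 = {pt23 a z b |a z b. d23 f0 a z b = 0}"

definition B23_neg :: "real \<Rightarrow> (complex^4^2) set set" where
  "B23_neg f0 = {pt23 a z b |a z b. d23 f0 a z b < 0}"

definition B23r :: "real \<Rightarrow> (complex^4^2) set set" where
  "B23r f0 = {pt23 a z b |a z b. d23 f0 a z b = 0 \<and> a + f0 \<ge> 0 \<and> b \<ge> 0} - {Cpt f0}"

definition B23l :: "real \<Rightarrow> (complex^4^2) set set" where
  "B23l f0 = {pt23 a z b |a z b. d23 f0 a z b = 0 \<and> a + f0 \<le> 0 \<and> b \<le> 0} - {Cpt f0}"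

definition B23r_pos :: "real \<Rightarrow> (complex^4^2) set set" where
  "B23r_pos f0 = {pt23 a z b |a z b. d23 f0 a z b > 0 \<and> a + f0 \<ge> 0 \<and> b \<ge> 0}"

definition B23l_pos :: "real \<Rightarrow> (complex^4^2) set set" where
  "B23l_pos f0 = {pt23 a z b |a z b. d23 f0 a z b > 0 \<and> a + f0 \<le> 0 \<and> b \<le> 0}"

definition approach :: "(complex^4^2) set \<Rightarrow> (complex^4^2) set set \<Rightarrow> (complex^4^2) set filter" where
  "approach \<A> S = atin_within BC_top \<A> S"

text \<open>\<open>\<lambda>\<^sub>n\<close> counts as not continuous at a point where it is not defined.\<close>

definition eig_continuous_at ::
  "nat \<Rightarrow> (nat \<Rightarrow> real) \<Rightarrow> (nat \<Rightarrow> real) \<Rightarrow> (nat \<Rightarrow> real) \<Rightarrow> nat \<Rightarrow> (complex^4^2) set \<Rightarrow> bool" where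
  "eig_continuous_at N f q w n \<A> \<longleftrightarrow>
     eig_defined N f q w n \<A> \<and>
     topcontinuous_at (subtopology BC_top O23) euclideanreal (eig N f q w n) \<A>"

definition eig_continuous_on ::
  "nat \<Rightarrow> (nat \<Rightarrow> real) \<Rightarrow> (nat \<Rightarrow> real) \<Rightarrow> (nat \<Rightarrow> real) \<Rightarrow> nat \<Rightarrow> (complex^4^2) set set \<Rightarrow> bool" where
  "eig_continuous_on N f q w n S \<longleftrightarrow>
     (\<forall>\<A>\<in>S. eig_defined N f q w n \<A>) \<and>
     continuous_map (subtopology BC_top S) euclideanreal (eig N f q w n)"

end

(*
  With p(y) = f_N (y_{N+1} - y_N), the boundary condition of [a, -1, 0, cnj z; z, 0, -1, b] says that
  (f_0 y_1, y_N) = K (y_0, p(y)) for the Hermitian matrix K = [a + f_0, cnj z; z, b], and d(A) = det K.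
  Testing the equation with y_1, ..., y_N and the boundary condition with y_0 and p(y) gives a Hermitian
  form H_t = H_0 - t M on C^{N+2} whose radical is the solution space for the parameter t, with M >= 0.
  As t increases, the negative index of H_t is nondecreasing and jumps at each eigenvalue by its
  multiplicity. It equals the number nu(K) of nonpositive eigenvalues of K for t near -infinity, and N
  plus the number of negative ones for t near +infinity. Hence there are N - dim ker K eigenvalues, and
  lambda_n < t holds iff n + nu(K) < neg_index H_t. Since the negative index is lower semicontinuous
  in (K, t) and antitone in K, crossing the cone det K = 0 only shifts the numbering by the jump of
  nu(K), which yields all limits, discontinuities and monotonicities.
*)

theory Submission
  imports Defs
begin

section \<open>Inertia of Hermitian forms\<close>

text \<open>The mass form does not see \<open>y 0\<close> and the flux, so for large |t| the sign of
  H_t in these two directions is not settled by -t M. It is settled by K, except on the kernel of K,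
  where the boundary form vanishes. There the coupling with the neighbouring values decides: tilting
  a kernel vector by a small amount e into the interior adds a term of order e whose sign can be
  chosen, while all interior terms are of order e^2. So a kernel direction of K yields a negative
  direction for every t, and by the opposite tilt a positive one; this is why nu(K) counts
  nonpositive eigenvalues. The end at +infinity is the same statement for -H_t, converted by
  Sylvester's law of inertia.

  Eigenvalue functions that jump or escape to infinity are awkward to follow one by one. The index
  is instead compared at a fixed t, where the form depends continuously on K. Semicontinuity for H_t
  and for -H_t bounds the index from both sides up to the dimension of the radical at t, and a
  slightly larger t absorbs this gap. Multiple eigenvalues need no separate treatment.\<close>

locale complex_vector_space = vector_space scale
  for scale :: "complex \<Rightarrow> 'v::ab_group_add \<Rightarrow> 'v" (infixr \<open>\<odot>\<close> 75) +
  fixes S :: "'v set"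
  assumes subspace_S: "subspace S"
    and finite_span_S: "\<exists>B. finite B \<and> S \<subseteq> span B"
begin

text \<open>Only \<open>S\<close> is known to be finite-dimensional. The ambient space will be all
  complex sequences, so every dimension bound has to go through the finite set whose span contains
  \<open>S\<close>.\<close>

lemma independent_finite: "B \<subseteq> S \<Longrightarrow> independent B \<Longrightarrow> finite B"
  using finite_span_S independent_span_bound by (meson order_trans)

lemma obtain_basis:
  assumes "subspace V" "V \<subseteq> S"
  obtains B where "B \<subseteq> V" "finite B" "independent B" "span B = V" "card B = dim V"
proof -
  obtain B where B: "B \<subseteq> V" "independent B" "V \<subseteq> span B" "card B = dim V"
    using basis_exists by blast
  have "span B = V"
    using B assms by (simp add: span_minimal subset_antisym)
  moreover have "finite B"
    by (rule independent_finite) (use B assms in auto)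
  ultimately show ?thesis
    using that B by metis
qed

lemma dim_mono:
  assumes "V \<subseteq> W" "subspace W" "W \<subseteq> S"
  shows "dim V \<le> dim W"
proof -
  obtain B where "finite B" "span B = W" "card B = dim W"
    using obtain_basis assms by metis
  then show ?thesis
    using dim_le_card assms by metis
qed

lemma dim_eq_0_iff:
  assumes "subspace V" "V \<subseteq> S"
  shows "dim V = 0 \<longleftrightarrow> V = {0}"
proof -
  obtain B where B: "finite B" "span B = V" "card B = dim V" "independent B"
    using obtain_basis assms by metis
  show ?thesis
  proof
    assume "dim V = 0"
    then have "B = {}" using B by simp
    then show "V = {0}" using B by auto
  next
    assume "V = {0}"
    then have "B \<subseteq> {0}" using B span_superset by blast
    then have "B = {}" using B(4) dependent_zero by blast
    then show "dim V = 0" using B by simp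
  qed
qed

lemma independent_Un_disjoint:
  assumes "finite B" "independent B" "independent C" "span B \<inter> span C = {0}"
  shows "independent (B \<union> C)" "B \<inter> C = {}"
proof -
  show dis: "B \<inter> C = {}"
  proof (rule ccontr)
    assume "B \<inter> C \<noteq> {}"
    then obtain x where x: "x \<in> B" "x \<in> C" by blast
    then have "x \<in> span B \<inter> span C" by (simp add: span_base)
    then have "x = 0" unfolding assms(4) by simp
    then show False using dependent_zero[of B] x(1) assms(2) by metis
  qed
  show "independent (B \<union> C)"
    using assms(1,2,4) dis
  proof (induction B)
    case empty
    then show ?case using assms by simp
  next
    case (insert b B)
    have iB: "independent B"
      using insert.prems independent_mono by blast
    have sB: "span B \<inter> span C = {0}"
    proof -
      have "span B \<subseteq> span (insert b B)" by (rule span_mono) auto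
      then show ?thesis using insert.prems(2) span_zero[of B] span_zero[of C] by auto
    qed
    have ind: "independent (B \<union> C)"
      by (rule insert.IH[OF iB sB]) (use insert.prems in auto)
    have "b \<notin> span (B \<union> C)"
    proof
      assume "b \<in> span (B \<union> C)"
      then obtain x y where xy: "x \<in> span B" "y \<in> span C" "b = x + y"
        unfolding span_Un by blast
      have "y = b - x" using xy by simp
      moreover have "b - x \<in> span (insert b B)"
        by (rule span_diff[OF span_base]) (use xy(1) span_mono[of B "insert b B"] in auto)
      ultimately have "y \<in> span (insert b B) \<inter> span C" using xy(2) by simp
      then have "y = 0" unfolding insert.prems(2) by simp
      then have "b \<in> span B" using xy by simp
      then show False
        using insert.prems(1) insert.hyps(2) by (simp add: independent_insert)
    qed
    then show ?case
      using ind by (simp add: independent_insertI)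
  qed
qed

lemma dim_add_le:
  assumes "subspace V" "V \<subseteq> S" "subspace W" "W \<subseteq> S" "V \<inter> W = {0}"
    and "subspace U" "V \<subseteq> U" "W \<subseteq> U" "U \<subseteq> S"
  shows "dim V + dim W \<le> dim U"
proof -
  obtain B where B: "B \<subseteq> V" "finite B" "independent B" "span B = V" "card B = dim V"
    using obtain_basis assms(1,2) by blast
  obtain C where C: "C \<subseteq> W" "finite C" "independent C" "span C = W" "card C = dim W"
    using obtain_basis assms(3,4) by blast
  obtain D where D: "D \<subseteq> U" "finite D" "independent D" "span D = U" "card D = dim U"
    using obtain_basis assms(6,9) by blast
  have ind: "independent (B \<union> C)" and dis: "B \<inter> C = {}"
    using independent_Un_disjoint[of B C] B C assms(5) by auto
  have "card (B \<union> C) \<le> card D"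
    using independent_span_bound[of D "B \<union> C"] ind B C D assms by blast
  then show ?thesis
    using B C D dis by (simp add: card_Un_disjoint)
qed

text \<open>If \<open>l\<close> does not vanish on \<open>V\<close>, one vector outside the kernel
  together with a basis of the kernel spans \<open>V\<close>.\<close>

lemma dim_le_dim_kernel:
  assumes V: "subspace V" "V \<subseteq> S"
    and l: "\<And>x y. l (x + y) = l x + l y" "\<And>c x. l (c \<odot> x) = c * (l x :: complex)"
  shows "dim V \<le> dim {v \<in> V. l v = 0} + 1"
proof -
  let ?K = "{v \<in> V. l v = 0}"
  have l0: "l 0 = 0" using l(2)[of 0 0] by simp
  have K: "subspace ?K" "?K \<subseteq> S"
    using V l l0 by (auto simp: subspace_def)
  obtain B where B: "B \<subseteq> ?K" "finite B" "independent B" "span B = ?K" "card B = dim ?K"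
    using obtain_basis[OF K] by blast
  show ?thesis
  proof (cases "\<exists>x\<in>V. l x \<noteq> 0")
    case False
    then have "?K = V" by auto
    then show ?thesis by simp
  next
    case True
    then obtain x where x: "x \<in> V" "l x \<noteq> 0" by blast
    have "V \<subseteq> span (insert x B)"
    proof
      fix v assume v: "v \<in> V"
      have "l (v + (- (l v / l x)) \<odot> x) = 0"
        using x by (simp only: l) simp
      moreover have "v + (- (l v / l x)) \<odot> x \<in> V"
        using V(1) x v by (meson subspace_def)
      ultimately have "v - (l v / l x) \<odot> x \<in> span B"
        using B by (simp add: scale_minus_left)
      then show "v \<in> span (insert x B)"
        unfolding span_insert by blast
    qed
    then have "dim V \<le> card (insert x B)"
      using dim_le_card B(2) by blast
    also have "\<dots> \<le> card B + 1"
      using B(2) by (simp add: card_insert_if)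
    finally show ?thesis using B by simp
  qed
qed

section \<open>Hermitian forms, their radical and their negative index\<close>

definition hermitian :: "('v \<Rightarrow> 'v \<Rightarrow> complex) \<Rightarrow> bool" where
  "hermitian h \<longleftrightarrow> (\<forall>x y z. h x (y + z) = h x y + h x z) \<and>
     (\<forall>x c y. h x (c \<odot> y) = c * h x y) \<and> (\<forall>x y. h x y = cnj (h y x))"

text \<open>Linearity in the second argument and symmetry already give conjugate-linearity in the
  first, so the definition asks for no more.\<close>

lemma hermitianD:
  assumes "hermitian h"
  shows "h x (y + z) = h x y + h x z" "h (x + y) z = h x z + h y z"
    "h x (c \<odot> y) = c * h x y" "h (c \<odot> x) y = cnj c * h x y"
    "cnj (h y x) = h x y" "h x 0 = 0" "h 0 x = 0"
    "h x (y - z) = h x y - h x z" "h (x - y) z = h x z - h y z"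
proof -
  note a = assms[unfolded hermitian_def]
  have r: "h x (y + z) = h x y + h x z" for x y z using a by blast
  have c: "cnj (h y x) = h x y" for x y using a by metis
  have s: "h x (c \<odot> y) = c * h x y" for x c y using a by blast
  have l: "h (x + y) z = h x z + h y z" for x y z
    using c[of "x + y" z] r[of z x y] by (metis c complex_cnj_add)
  have sl: "h (c \<odot> x) y = cnj c * h x y" for x c y
    by (metis c s complex_cnj_mult)
  show "h x (y + z) = h x y + h x z" "h (x + y) z = h x z + h y z"
    "h x (c \<odot> y) = c * h x y" "h (c \<odot> x) y = cnj c * h x y"
    "cnj (h y x) = h x y"
    by (rule r l s sl c)+
  show "h x 0 = 0" "h 0 x = 0"
    using s[of x 0 0] sl[of 0 0 x] by simp_all
  show "h x (y - z) = h x y - h x z"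
    by (metis add_diff_cancel_right' diff_add_cancel r)
  show "h (x - y) z = h x z - h y z"
    by (metis add_diff_cancel_right' diff_add_cancel l)
qed

lemma hermitian_diag_real: "hermitian h \<Longrightarrow> h x x = of_real (Re (h x x))"
  by (metis Reals_cnj_iff hermitianD(5) of_real_Re)

lemma hermitian_sum:
  assumes "hermitian h"
  shows "h x (\<Sum>b\<in>B. f b) = (\<Sum>b\<in>B. h x (f b))" "h (\<Sum>b\<in>B. f b) x = (\<Sum>b\<in>B. h (f b) x)"
  by (induction B rule: infinite_finite_induct) (auto simp: hermitianD[OF assms])

lemma hermitian_span_sum:
  assumes "hermitian h"
  shows "h (\<Sum>b\<in>B. c b \<odot> b) (\<Sum>b\<in>B. c b \<odot> b) = (\<Sum>b\<in>B. \<Sum>b'\<in>B. cnj (c b) * c b' * h b b')"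
  by (subst sum.swap) (simp add: hermitian_sum[OF assms] hermitianD[OF assms] sum_distrib_left ac_simps)

text \<open>Vectors and test vectors both range over \<open>S\<close>; with this choice the radical
  of the Sturm-Liouville pencil is literally the solution space.\<close>

definition rad :: "('v \<Rightarrow> 'v \<Rightarrow> complex) \<Rightarrow> 'v set" where
  "rad h = {v \<in> S. \<forall>u\<in>S. h u v = 0}"

lemma subspace_rad: "hermitian h \<Longrightarrow> subspace (rad h)"
  using subspace_S by (auto simp: subspace_def rad_def hermitianD)

lemma rad_subset: "rad h \<subseteq> S"
  by (auto simp: rad_def)

definition negative_on :: "('v \<Rightarrow> 'v \<Rightarrow> complex) \<Rightarrow> 'v set \<Rightarrow> bool" where
  "negative_on h V \<longleftrightarrow> (\<forall>v\<in>V. v \<noteq> 0 \<longrightarrow> Re (h v v) < 0)"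

text \<open>The variational form of the index. A lower bound needs one trial subspace, an upper
  bound a dimension count against a complementary one, so comparison and limit arguments need no
  diagonalisation that varies with the form.\<close>

definition neg_index :: "('v \<Rightarrow> 'v \<Rightarrow> complex) \<Rightarrow> nat" where
  "neg_index h = Max (dim ` {V. subspace V \<and> V \<subseteq> S \<and> negative_on h V})"

lemma dims_finite: "finite (dim ` {V. subspace V \<and> V \<subseteq> S \<and> P V})"
  by (rule finite_subset[of _ "{..dim S}"]) (auto intro: dim_mono subspace_S)

lemma neg_index_ge: "subspace V \<Longrightarrow> V \<subseteq> S \<Longrightarrow> negative_on h V \<Longrightarrow> dim V \<le> neg_index h"
  unfolding neg_index_def by (rule Max_ge[OF dims_finite]) auto

lemma neg_index_attained:
  obtains V where "subspace V" "V \<subseteq> S" "negative_on h V" "dim V = neg_index h"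
proof -
  have "{0} \<in> {V. subspace V \<and> V \<subseteq> S \<and> negative_on h V}"
    using subspace_0[OF subspace_S] by (simp add: negative_on_def subspace_single_0)
  then have "neg_index h \<in> dim ` {V. subspace V \<and> V \<subseteq> S \<and> negative_on h V}"
    unfolding neg_index_def by (intro Max_in dims_finite) blast
  then show ?thesis using that by auto
qed

lemma neg_index_le_dim: "neg_index h \<le> dim S"
  by (metis neg_index_attained dim_mono subspace_S order_refl)

lemma neg_index_antimono:
  assumes "\<And>v. v \<in> S \<Longrightarrow> Re (h v v) \<le> Re (h' v v)"
  shows "neg_index h' \<le> neg_index h"
proof -
  obtain V where V: "subspace V" "V \<subseteq> S" "negative_on h' V" "dim V = neg_index h'"
    by (rule neg_index_attained)
  then have "negative_on h V"
    using assms by (fastforce simp: negative_on_def)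
  then show ?thesis using V neg_index_ge by metis
qed

lemma subspace_sum_dim:
  assumes "subspace V" "V \<subseteq> S" "subspace W" "W \<subseteq> S" "V \<inter> W = {0}"
  shows "subspace {x + y |x y. x \<in> V \<and> y \<in> W}" "{x + y |x y. x \<in> V \<and> y \<in> W} \<subseteq> S"
    "dim V + dim W \<le> dim {x + y |x y. x \<in> V \<and> y \<in> W}"
proof -
  let ?U = "{x + y |x y. x \<in> V \<and> y \<in> W}"
  show sub: "subspace ?U" by (rule subspace_sums[OF assms(1,3)])
  show S: "?U \<subseteq> S" using assms subspace_S by (auto intro: subspace_add)
  have "V \<subseteq> ?U" using subspace_0[OF assms(3)] by force
  moreover have "W \<subseteq> ?U" using subspace_0[OF assms(1)] by force
  ultimately show "dim V + dim W \<le> dim ?U"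
    by (intro dim_add_le assms sub S)
qed

text \<open>Either all vectors of \<open>V\<close> are isotropic, and then polarisation makes
  \<open>h\<close> vanish on \<open>V\<close> and any basis works, or a vector with
  \<open>h x x\<close> nonzero splits off and leaves an orthogonal complement of smaller dimension.
  Degenerate forms are covered.\<close>

lemma exists_orthogonal_basis:
  assumes h: "hermitian h" and "subspace V" "V \<subseteq> S"
  shows "\<exists>B. finite B \<and> independent B \<and> span B = V \<and> (\<forall>b\<in>B. \<forall>b'\<in>B. b \<noteq> b' \<longrightarrow> h b b' = 0)"
  using assms(2,3)
proof (induction "dim V" arbitrary: V rule: less_induct)
  case less
  note V = less.prems
  show ?case
  proof (cases "\<exists>x\<in>V. h x x \<noteq> 0")
    case False
    have "h x y = 0" if "x \<in> V" "y \<in> V" for x y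
    proof -
      have *: "h z z = 0" if "z \<in> V" for z using False that by blast
      \<comment> \<open>With the coefficient \<open>h y x\<close> both cross terms equal the squared
        modulus of \<open>h x y\<close>, so one test vector handles the complex
        polarisation.\<close>
      have "x + h y x \<odot> y \<in> V" using that V by (meson subspace_add subspace_scale)
      from *[OF this] have "cnj (h y x) * h y x + h y x * h x y = 0"
        using *[OF that(1)] *[OF that(2)] by (simp add: hermitianD[OF h] algebra_simps)
      then have "h x y * cnj (h x y) = 0"
        unfolding hermitianD(5)[OF h] by simp
      then show ?thesis by simp
    qed
    then show ?thesis
      using obtain_basis[OF V] by (metis span_superset subset_iff)
  next
    case True
    then obtain x where x: "x \<in> V" "h x x \<noteq> 0" by blast
    define W where "W = {v \<in> V. h x v = 0}"
    have W: "subspace W" "W \<subseteq> S"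
      using V by (auto simp: W_def subspace_def hermitianD[OF h])
    have x0: "x \<noteq> 0" using x hermitianD[OF h] by force
    have "span {x} \<inter> W = {0}"
    proof -
      have "v = 0" if "v \<in> span {x}" "v \<in> W" for v
        using that x by (auto simp: W_def span_singleton hermitianD[OF h])
      then show ?thesis using span_zero subspace_0[OF W(1)] by blast
    qed
    moreover have "span {x} \<subseteq> V" using x V by (simp add: span_minimal)
    ultimately have "dim (span {x}) + dim W \<le> dim V"
      using dim_add_le[of "span {x}" W V] V W by (auto simp: W_def)
    moreover have "dim (span {x}) = 1"
      using dim_span_eq_card_independent[of "{x}"] x0 by simp
    ultimately have "dim W < dim V" by simp
    from less.hyps[OF this W] obtain B where
      B: "finite B" "independent B" "span B = W" "\<forall>b\<in>B. \<forall>b'\<in>B. b \<noteq> b' \<longrightarrow> h b b' = 0"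
      by blast
    have "x \<notin> span B" using B x by (simp add: W_def)
    then have "independent (insert x B)" using B by (simp add: independent_insertI)
    moreover have "span (insert x B) = V"
    proof
      show "span (insert x B) \<subseteq> V"
        using B x V span_superset[of B] by (intro span_minimal) (auto simp: W_def)
      show "V \<subseteq> span (insert x B)"
      proof
        fix v assume v: "v \<in> V"
        have "v - (h x v / h x x) \<odot> x \<in> V"
          using v x V by (meson subspace_diff subspace_scale)
        moreover have "h x (v - (h x v / h x x) \<odot> x) = 0"
          using x by (simp add: hermitianD[OF h])
        ultimately have "v - (h x v / h x x) \<odot> x \<in> span B"
          using B by (simp add: W_def)
        then show "v \<in> span (insert x B)"
          unfolding span_insert by blast
      qed
    qed
    moreover have "h x b = 0" "h b x = 0" if "b \<in> B" for b
    proof -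
      show *: "h x b = 0" using that B span_base[of b B] by (auto simp: W_def)
      show "h b x = 0" using hermitianD(5)[OF h, of b x] * by (metis complex_cnj_zero_iff)
    qed
    ultimately show ?thesis
      using B by (intro exI[of _ "insert x B"]) auto
  qed
qed

lemma hermitian_basis_diag:
  assumes h: "hermitian h" and B: "finite B" "\<forall>b\<in>B. \<forall>b'\<in>B. b \<noteq> b' \<longrightarrow> h b b' = 0"
  shows "Re (h (\<Sum>b\<in>B. c b \<odot> b) (\<Sum>b\<in>B. c b \<odot> b)) = (\<Sum>b\<in>B. (cmod (c b))\<^sup>2 * Re (h b b))"
proof -
  have "h (\<Sum>b\<in>B. c b \<odot> b) (\<Sum>b\<in>B. c b \<odot> b) = (\<Sum>b\<in>B. cnj (c b) * c b * h b b)"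
    unfolding hermitian_span_sum[OF h]
  proof (rule sum.cong)
    fix b assume b: "b \<in> B"
    have "(\<Sum>b'\<in>B. cnj (c b) * c b' * h b b') = (\<Sum>b'\<in>{b}. cnj (c b) * c b' * h b b')"
      by (rule sum.mono_neutral_right) (use B b in auto)
    then show "(\<Sum>b'\<in>B. cnj (c b) * c b' * h b b') = cnj (c b) * c b * h b b" by simp
  qed simp
  also have "\<dots> = of_real (\<Sum>b\<in>B. (cmod (c b))\<^sup>2 * Re (h b b))"
    unfolding of_real_sum
  proof (rule sum.cong)
    fix b
    have "cnj (c b) * c b * of_real (Re (h b b)) = of_real ((cmod (c b))\<^sup>2 * Re (h b b))"
      by (simp add: mult.commute[of "cnj (c b)"] flip: complex_norm_square)
    then show "cnj (c b) * c b * h b b = of_real ((cmod (c b))\<^sup>2 * Re (h b b))"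
      by (simp only: hermitian_diag_real[OF h, symmetric])
  qed simp
  finally show ?thesis by simp
qed

lemma inertia_basis:
  assumes h: "hermitian h"
  obtains P Z M where "finite P" "finite Z" "finite M"
    "\<forall>b\<in>P. Re (h b b) > 0" "\<forall>b\<in>Z. h b b = 0" "\<forall>b\<in>M. Re (h b b) < 0"
    "P \<inter> Z = {}" "P \<inter> M = {}" "Z \<inter> M = {}"
    "independent (P \<union> Z \<union> M)" "span (P \<union> Z \<union> M) = S"
    "\<forall>b\<in>P \<union> Z \<union> M. \<forall>b'\<in>P \<union> Z \<union> M. b \<noteq> b' \<longrightarrow> h b b' = 0"
    "card P + card Z + card M = dim S"
proof -
  obtain B where B: "finite B" "independent B" "span B = S"
      "\<forall>b\<in>B. \<forall>b'\<in>B. b \<noteq> b' \<longrightarrow> h b b' = 0"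
    using exists_orthogonal_basis[OF h subspace_S order_refl] by blast
  define P where "P = {b\<in>B. Re (h b b) > 0}"
  define M where "M = {b\<in>B. Re (h b b) < 0}"
  define Z where "Z = {b\<in>B. Re (h b b) = 0}"
  have U: "P \<union> Z \<union> M = B" by (auto simp: P_def M_def Z_def)
  have dis: "P \<inter> Z = {}" "P \<inter> M = {}" "Z \<inter> M = {}"
    by (auto simp: P_def M_def Z_def)
  have fin: "finite P" "finite Z" "finite M"
    using B(1) by (auto simp: P_def M_def Z_def)
  have "card P + card Z + card M = card B"
    unfolding U[symmetric] using fin dis by (subst card_Un_disjoint, auto)+
  also have "\<dots> = dim S"
    using dim_span_eq_card_independent[OF B(2)] B(3) by simp
  finally have card: "card P + card Z + card M = dim S" .
  have z: "\<forall>b\<in>Z. h b b = 0"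
    using hermitian_diag_real[OF h] by (auto simp: Z_def) (metis of_real_0)
  show ?thesis
    by (rule that[of P Z M]) (use fin dis card z B in \<open>simp_all add: U\<close>, auto simp: P_def M_def)
qed

lemma negative_on_span:
  assumes h: "hermitian h" and M: "finite M" "\<forall>b\<in>M. Re (h b b) < 0"
    and orth: "\<forall>b\<in>M. \<forall>b'\<in>M. b \<noteq> b' \<longrightarrow> h b b' = 0"
  shows "negative_on h (span M)"
  unfolding negative_on_def
proof safe
  fix v assume "v \<in> span M" "v \<noteq> 0"
  then obtain c where c: "v = (\<Sum>b\<in>M. c b \<odot> b)"
    unfolding span_finite[OF M(1)] by blast
  then have "\<exists>b\<in>M. c b \<noteq> 0"
    using \<open>v \<noteq> 0\<close> by (metis (mono_tags, lifting) scale_zero_left sum.neutral)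
  then obtain b where b: "b \<in> M" "c b \<noteq> 0" by blast
  have "0 < (\<Sum>b\<in>M. - ((cmod (c b))\<^sup>2 * Re (h b b)))"
    by (rule sum_pos2[of _ b]) (use M b in \<open>auto simp: mult_le_0_iff mult_less_0_iff intro: less_imp_le\<close>)
  then show "Re (h v v) < 0"
    unfolding c hermitian_basis_diag[OF h M(1) orth] by (simp add: sum_negf)
qed

text \<open>Take a maximal negative subspace plus the radical: adding a radical vector does not
  change \<open>h v v\<close>, and the two meet only in zero, so the dimensions add.\<close>

lemma negative_or_rad_subspace:
  assumes h: "hermitian h"
  obtains U where "subspace U" "U \<subseteq> S" "\<forall>v\<in>U. v \<in> rad h \<or> Re (h v v) < 0"
    "neg_index h + dim (rad h) \<le> dim U"
proof -
  obtain V where V: "subspace V" "V \<subseteq> S" "negative_on h V" "dim V = neg_index h"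
    by (rule neg_index_attained)
  have r: "h x v = 0" "h v x = 0" if "v \<in> rad h" "x \<in> S" for v x
    using that h by (auto simp: rad_def) (metis complex_cnj_zero_iff hermitianD(5))
  have "v = 0" if "v \<in> V" "v \<in> rad h" for v
    using that r V by (force simp: negative_on_def)
  then have "V \<inter> rad h = {0}"
    using subspace_0[OF V(1)] subspace_0[OF subspace_rad[OF h]] by blast
  note sum = subspace_sum_dim[OF V(1,2) subspace_rad[OF h] rad_subset this]
  let ?U = "{x + y |x y. x \<in> V \<and> y \<in> rad h}"
  have "v \<in> rad h \<or> Re (h v v) < 0" if vU: "v \<in> ?U" for v
  proof -
    obtain x y where v: "v = x + y" and xy: "x \<in> V" "y \<in> rad h" using vU by blast
    have S: "x \<in> S" "y \<in> S" using xy V rad_subset by auto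
    have "Re (h v v) = Re (h x x)"
      using r[OF xy(2)] S by (simp add: v hermitianD[OF h])
    then show ?thesis
      using V(3) xy v by (cases "x = 0") (auto simp: negative_on_def)
  qed
  then show ?thesis
    by (intro that[OF sum(1,2)]) (use sum(3) V(4) in auto)
qed

text \<open>The larger form \<open>h\<close> is negative on the chosen subspace off its radical, and
  so is \<open>h'\<close> by comparison; on the radical \<open>h'\<close> is negative by assumption.
  The whole radical is thereby gained.\<close>

lemma neg_index_strict_mono:
  assumes h: "hermitian h"
    and le: "\<And>v. v \<in> S \<Longrightarrow> Re (h' v v) \<le> Re (h v v)"
    and neg: "\<And>v. v \<in> rad h \<Longrightarrow> v \<noteq> 0 \<Longrightarrow> Re (h' v v) < 0"
  shows "neg_index h + dim (rad h) \<le> neg_index h'"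
proof -
  obtain U where U: "subspace U" "U \<subseteq> S" "\<forall>v\<in>U. v \<in> rad h \<or> Re (h v v) < 0"
    "neg_index h + dim (rad h) \<le> dim U"
    by (rule negative_or_rad_subspace[OF h])
  have "negative_on h' U"
    unfolding negative_on_def using U(2,3) neg le by (meson le_less_trans subset_iff)
  then show ?thesis
    using neg_index_ge[OF U(1,2)] U(4) order_trans by blast
qed

lemma nonpositive_subspace:
  assumes h: "hermitian h"
  obtains U where "subspace U" "U \<subseteq> S" "\<forall>v\<in>U. Re (h v v) \<le> 0"
    "neg_index h + dim (rad h) \<le> dim U"
proof -
  obtain U where U: "subspace U" "U \<subseteq> S" "\<forall>v\<in>U. v \<in> rad h \<or> Re (h v v) < 0"
    "neg_index h + dim (rad h) \<le> dim U"
    by (rule negative_or_rad_subspace[OF h])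
  have "Re (h v v) \<le> 0" if "v \<in> U" for v
    using U(2,3) that by (force simp: rad_def)
  then show ?thesis
    using that U by blast
qed

lemma hermitian_uminus: "hermitian h \<Longrightarrow> hermitian (\<lambda>x y. - h x y)"
  unfolding hermitian_def by (metis add_uminus_conv_diff complex_cnj_minus minus_add_distrib mult_minus_right)

lemma rad_uminus [simp]: "rad (\<lambda>x y. - h x y) = rad h"
  by (simp add: rad_def)

lemma dim_le_dim_common_kernel:
  assumes V: "subspace V" "V \<subseteq> S" and "finite I"
    and lin: "\<And>i x y. i \<in> I \<Longrightarrow> l i (x + y) = l i x + l i y"
      "\<And>i c x. i \<in> I \<Longrightarrow> l i (c \<odot> x) = c * (l i x :: complex)"
  shows "dim V \<le> dim {v \<in> V. \<forall>i\<in>I. l i v = 0} + card I"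
  using \<open>finite I\<close> lin
proof (induction I)
  case empty
  then show ?case by simp
next
  case (insert i I)
  let ?W = "{v \<in> V. \<forall>i\<in>I. l i v = 0}"
  have add: "l j (x + y) = l j x + l j y" if "j \<in> insert i I" for j x y
    by (rule insert.prems(1)[OF that])
  have scl: "l j (c \<odot> x) = c * l j x" if "j \<in> insert i I" for j c x
    by (rule insert.prems(2)[OF that])
  have l0: "l j 0 = 0" if "j \<in> I" for j
    using scl[OF insertI2[OF that], of 0 0] by simp
  have W: "subspace ?W" "?W \<subseteq> S"
  proof (rule subspaceI)
    show "0 \<in> ?W" using l0 subspace_0[OF V(1)] by simp
    show "x + y \<in> ?W" if "x \<in> ?W" "y \<in> ?W" for x y
      using that subspace_add[OF V(1)] add by simp
    show "c \<odot> x \<in> ?W" if "x \<in> ?W" for c x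
      using that subspace_scale[OF V(1)] scl by simp
  qed (use V(2) in blast)
  have "dim V \<le> dim ?W + card I"
    by (rule insert.IH) (simp_all add: add scl)
  also have "dim ?W \<le> dim {v \<in> ?W. l i v = 0} + 1"
    by (rule dim_le_dim_kernel[OF W]) (simp_all add: add scl)
  also have "{v \<in> ?W. l i v = 0} = {v \<in> V. \<forall>j\<in>insert i I. l j v = 0}" by auto
  finally show ?case using insert.hyps by simp
qed

text \<open>A subspace on which \<open>h\<close> is nonpositive meets the common kernel only in
  zero, so the functionals are jointly injective on it.\<close>

lemma neg_index_add_rad_le_codim:
  assumes h: "hermitian h" and I: "finite I"
    and lin: "\<And>i x y. i \<in> I \<Longrightarrow> l i (x + y) = l i x + l i y"
      "\<And>i c x. i \<in> I \<Longrightarrow> l i (c \<odot> x) = c * (l i x :: complex)"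
    and pos: "\<And>v. v \<in> S \<Longrightarrow> v \<noteq> 0 \<Longrightarrow> \<forall>i\<in>I. l i v = 0 \<Longrightarrow> Re (h v v) > 0"
  shows "neg_index h + dim (rad h) \<le> card I"
proof -
  obtain U where U: "subspace U" "U \<subseteq> S" "\<forall>v\<in>U. Re (h v v) \<le> 0"
    "neg_index h + dim (rad h) \<le> dim U"
    by (rule nonpositive_subspace[OF h])
  let ?K = "{v \<in> U. \<forall>i\<in>I. l i v = 0}"
  have "?K \<subseteq> span {}"
  proof
    fix v assume v: "v \<in> ?K"
    then have "v \<in> S" "Re (h v v) \<le> 0" "\<forall>i\<in>I. l i v = 0" using U(2,3) by auto
    then have "v = 0" using pos[of v] by (meson not_less)
    then show "v \<in> span {}" by simp
  qed
  then have "dim ?K \<le> card ({} :: 'v set)"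
    by (rule dim_le_card) simp
  then have "dim ?K = 0" by simp
  moreover have "dim U \<le> dim ?K + card I"
    by (rule dim_le_dim_common_kernel[OF U(1,2) I]) (rule lin; assumption)+
  ultimately show ?thesis
    using U(4) by linarith
qed

text \<open>Sylvester's law. One inequality holds because a nonpositive subspace meets a positive
  one only in zero; for the other, an orthogonal basis is sorted by the sign of its diagonal
  entries.\<close>

lemma inertia_sum:
  assumes h: "hermitian h"
  shows "neg_index h + neg_index (\<lambda>x y. - h x y) + dim (rad h) = dim S"
proof (rule antisym)
  obtain U where U: "subspace U" "U \<subseteq> S" "\<forall>v\<in>U. Re (h v v) \<le> 0"
    "neg_index h + dim (rad h) \<le> dim U"
    by (rule nonpositive_subspace[OF h])
  obtain W where W: "subspace W" "W \<subseteq> S" "negative_on (\<lambda>x y. - h x y) W"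
    "dim W = neg_index (\<lambda>x y. - h x y)"
    by (rule neg_index_attained)
  have "v = 0" if "v \<in> U" "v \<in> W" for v
    using U(3) W(3) that by (force simp: negative_on_def)
  then have "U \<inter> W = {0}"
    using subspace_0 U(1) W(1) by blast
  then have "dim U + dim W \<le> dim S"
    using dim_add_le U(1,2) W(1,2) subspace_S by simp
  then show "neg_index h + neg_index (\<lambda>x y. - h x y) + dim (rad h) \<le> dim S"
    using U(4) W(4) by simp
next
  obtain P Z M where B: "finite P" "finite Z" "finite M"
    "\<forall>b\<in>P. Re (h b b) > 0" "\<forall>b\<in>Z. h b b = 0" "\<forall>b\<in>M. Re (h b b) < 0"
    "P \<inter> Z = {}" "P \<inter> M = {}" "Z \<inter> M = {}"
    "independent (P \<union> Z \<union> M)" "span (P \<union> Z \<union> M) = S"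
    and orth: "\<forall>b\<in>P \<union> Z \<union> M. \<forall>b'\<in>P \<union> Z \<union> M. b \<noteq> b' \<longrightarrow> h b b' = 0"
    and card: "card P + card Z + card M = dim S"
    by (rule inertia_basis[OF h])
  have sub: "span P \<subseteq> S" "span Z \<subseteq> S" "span M \<subseteq> S"
    unfolding B(11)[symmetric] by (rule span_mono; auto)+
  have ind: "independent P" "independent Z" "independent M"
    by (rule independent_mono[OF B(10)]; blast)+
  have "negative_on h (span M)"
    by (rule negative_on_span[OF h]) (use B orth in auto)
  from neg_index_ge[OF _ sub(3) this] have "card M \<le> neg_index h"
    using dim_span_eq_card_independent[OF ind(3)] by simp
  moreover have "negative_on (\<lambda>x y. - h x y) (span P)"
    by (rule negative_on_span[OF hermitian_uminus[OF h]]) (use B orth in auto)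
  from neg_index_ge[OF _ sub(1) this] have "card P \<le> neg_index (\<lambda>x y. - h x y)"
    using dim_span_eq_card_independent[OF ind(1)] by simp
  moreover have "Z \<subseteq> rad h"
  proof
    fix z assume z: "z \<in> Z"
    have "h u z = 0" if u: "u \<in> S" for u
    proof -
      obtain c where "u = (\<Sum>b\<in>P \<union> Z \<union> M. c b \<odot> b)"
        using u unfolding B(11)[symmetric] span_finite[OF finite_UnI[OF finite_UnI[OF B(1,2)] B(3)]] by blast
      then have "h u z = (\<Sum>b\<in>P \<union> Z \<union> M. cnj (c b) * h b z)"
        by (simp add: hermitian_sum[OF h] hermitianD[OF h])
      also have "\<dots> = 0"
        by (rule sum.neutral) (use orth z B(5) in \<open>metis UnI1 UnI2 mult_zero_right\<close>)
      finally show ?thesis .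
    qed
    moreover have "z \<in> S" using z sub(2) span_superset by blast
    ultimately show "z \<in> rad h" by (simp add: rad_def)
  qed
  then have "span Z \<subseteq> rad h"
    by (simp add: span_minimal subspace_rad[OF h])
  then have "card Z \<le> dim (rad h)"
    using dim_mono[OF _ subspace_rad[OF h] rad_subset] dim_span_eq_card_independent[OF ind(2)] by metis
  ultimately show "dim S \<le> neg_index h + neg_index (\<lambda>x y. - h x y) + dim (rad h)"
    using card by simp
qed

text \<open>In the coefficients of an orthogonal basis \<open>h\<close> is at most -d times the sum
  of squares, while by Cauchy-Schwarz the perturbation is at most \<open>e * card M\<close> times
  it.\<close>

lemma hermitian_perturb_bound:
  assumes h: "hermitian h" "hermitian h'" and M: "finite M"
    and orth: "\<forall>b\<in>M. \<forall>b'\<in>M. b \<noteq> b' \<longrightarrow> h b b' = 0"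
    and d: "\<And>b. b \<in> M \<Longrightarrow> Re (h b b) \<le> - d" 
    and e: "\<And>b b'. b \<in> M \<Longrightarrow> b' \<in> M \<Longrightarrow> cmod (h' b b' - h b b') \<le> e" "e * card M < d"
  shows "negative_on h' (span M)"
  unfolding negative_on_def
proof safe
  fix v assume "v \<in> span M" "v \<noteq> 0"
  then obtain c where c: "v = (\<Sum>b\<in>M. c b \<odot> b)"
    unfolding span_finite[OF M] by blast
  then have "\<exists>b\<in>M. c b \<noteq> 0"
    using \<open>v \<noteq> 0\<close> by (metis (mono_tags, lifting) scale_zero_left sum.neutral)
  then obtain b where b: "b \<in> M" "c b \<noteq> 0" by blast
  define Q where "Q = (\<Sum>b\<in>M. (cmod (c b))\<^sup>2)"
  have Q: "Q > 0" unfolding Q_def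
    by (rule sum_pos2[of _ b]) (use M b in auto)
  have e0: "e \<ge> 0" using e(1)[OF b(1) b(1)] norm_ge_zero order_trans by blast
  have "Re (h' v v) = Re (h v v) + Re (h' v v - h v v)" by simp
  also have "h' v v - h v v = (\<Sum>b\<in>M. \<Sum>b'\<in>M. cnj (c b) * c b' * (h' b b' - h b b'))"
    unfolding c hermitian_span_sum[OF h(1)] hermitian_span_sum[OF h(2)]
    by (simp add: sum_subtractf right_diff_distrib)
  also have "Re (h v v) = (\<Sum>b\<in>M. (cmod (c b))\<^sup>2 * Re (h b b))"
    unfolding c by (rule hermitian_basis_diag[OF h(1) M orth])
  also have "\<dots> \<le> (\<Sum>b\<in>M. (cmod (c b))\<^sup>2 * (- d))"
    by (intro sum_mono mult_left_mono d) auto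
  also have "\<dots> = - d * Q" by (simp add: Q_def sum_distrib_left mult.commute)
  also have "Re (\<Sum>b\<in>M. \<Sum>b'\<in>M. cnj (c b) * c b' * (h' b b' - h b b')) \<le>
      (\<Sum>b\<in>M. \<Sum>b'\<in>M. cmod (c b) * cmod (c b') * e)"
  proof -
    have "Re (\<Sum>b\<in>M. \<Sum>b'\<in>M. cnj (c b) * c b' * (h' b b' - h b b'))
        \<le> cmod (\<Sum>b\<in>M. \<Sum>b'\<in>M. cnj (c b) * c b' * (h' b b' - h b b'))"
      by (rule complex_Re_le_cmod)
    also have "\<dots> \<le> (\<Sum>b\<in>M. \<Sum>b'\<in>M. cmod (c b) * cmod (c b') * e)"
      by (intro sum_norm_le) (auto simp: norm_mult intro!: mult_left_mono e(1))
    finally show ?thesis .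
  qed
  also have "(\<Sum>b\<in>M. \<Sum>b'\<in>M. cmod (c b) * cmod (c b') * e) = e * (\<Sum>b\<in>M. cmod (c b))\<^sup>2"
    by (simp add: power2_eq_square sum_product sum_distrib_left mult_ac)
  also have "\<dots> \<le> e * (Q * card M)"
    unfolding Q_def using e0 by (intro mult_left_mono sum_squared_le_sum_of_squares)
  finally have "Re (h' v v) \<le> - d * Q + e * (Q * card M)" by simp
  also have "\<dots> = (e * card M - d) * Q" by (simp add: algebra_simps)
  also have "\<dots> < 0" using Q e(2) by (simp add: mult_less_0_iff)
  finally show "Re (h' v v) < 0" .
qed

lemma neg_index_lower_semicontinuous:
  assumes h: "hermitian h" "\<And>t. hermitian (h' t)"
    and lim: "\<And>x y. x \<in> S \<Longrightarrow> y \<in> S \<Longrightarrow> ((\<lambda>t. h' t x y) \<longlongrightarrow> h x y) F"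
  shows "\<forall>\<^sub>F t in F. neg_index h \<le> neg_index (h' t)"
proof -
  obtain V where V: "subspace V" "V \<subseteq> S" "negative_on h V" "dim V = neg_index h"
    by (rule neg_index_attained)
  obtain M where M: "finite M" "independent M" "span M = V"
      and orth: "\<forall>b\<in>M. \<forall>b'\<in>M. b \<noteq> b' \<longrightarrow> h b b' = 0"
    using exists_orthogonal_basis[OF h(1) V(1,2)] by blast
  have MV: "M \<subseteq> V" using M span_superset by blast
  have neg: "Re (h b b) < 0" if "b \<in> M" for b
  proof -
    have "b \<noteq> 0" using M(2) that dependent_zero by blast
    then show ?thesis using V(3) that MV by (auto simp: negative_on_def)
  qed
  \<comment> \<open>The inserted 1 keeps the minimum defined when \<open>M\<close> is empty.\<close>
  define d where "d = Min (insert 1 ((\<lambda>b. - Re (h b b)) ` M))"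
  have d0: "d > 0" unfolding d_def using M(1) neg by (subst Min_gr_iff) auto
  have d: "Re (h b b) \<le> - d" if "b \<in> M" for b
  proof -
    have "d \<le> - Re (h b b)" unfolding d_def using M(1) that by (intro Min_le) auto
    then show ?thesis by simp
  qed
  \<comment> \<open>Dividing by \<open>card M + 1\<close> gives the strict bound
    \<open>e * card M < d\<close> also for empty \<open>M\<close>.\<close>
  define e where "e = d / (real (card M) + 1)"
  have e0: "e > 0" using d0 by (simp add: e_def add_nonneg_pos)
  have e: "e * card M < d" using d0 by (simp add: e_def field_simps add_nonneg_pos)
  have "\<forall>\<^sub>F t in F. \<forall>b\<in>M. \<forall>b'\<in>M. cmod (h' t b b' - h b b') < e"
  proof (intro eventually_ball_finite M(1) ballI)
    fix b b' assume "b \<in> M" "b' \<in> M"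
    then have "((\<lambda>t. h' t b b') \<longlongrightarrow> h b b') F" using lim MV V(2) by blast
    then show "\<forall>\<^sub>F t in F. cmod (h' t b b' - h b b') < e"
      using e0 unfolding tendsto_iff dist_norm by blast
  qed
  then show ?thesis
  proof eventually_elim
    case (elim t)
    have "negative_on (h' t) (span M)"
      by (rule hermitian_perturb_bound[OF h M(1) orth d _ e]) (use elim in \<open>auto intro: less_imp_le\<close>)
    then have "dim V \<le> neg_index (h' t)" using neg_index_ge V M(3) by metis
    then show ?case using V(4) by simp
  qed
qed


section \<open>Pencils h - t g with positive semidefinite g\<close>

definition pencil :: "('v \<Rightarrow> 'v \<Rightarrow> complex) \<Rightarrow> ('v \<Rightarrow> 'v \<Rightarrow> complex) \<Rightarrow> real \<Rightarrow> 'v \<Rightarrow> 'v \<Rightarrow> complex" where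
  "pencil h g t = (\<lambda>x y. h x y - of_real t * g x y)"

lemma hermitian_pencil:
  assumes "hermitian h" "hermitian g"
  shows "hermitian (pencil h g t)"
  unfolding hermitian_def pencil_def
  by (simp add: hermitianD[OF assms(1)] hermitianD[OF assms(2)] algebra_simps)

context
  fixes h g :: "'v \<Rightarrow> 'v \<Rightarrow> complex"
  assumes h: "hermitian h" and g: "hermitian g"
    and nonneg: "\<And>v. v \<in> S \<Longrightarrow> Re (g v v) \<ge> 0"
    and regular: "\<And>t v. v \<in> rad (pencil h g t) \<Longrightarrow> Re (g v v) = 0 \<Longrightarrow> v = 0"
begin

text \<open>On the radical at s the form at t reduces to (s - t) g(v, v). Regularity excludes g(v,
  v) = 0, so the radical turns negative as soon as t exceeds s.\<close>

lemma pencil_neg_index_jump: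
  assumes "s < t"
  shows "neg_index (pencil h g s) + dim (rad (pencil h g s)) \<le> neg_index (pencil h g t)"
proof (rule neg_index_strict_mono[OF hermitian_pencil[OF h g]])
  fix v assume v: "v \<in> S"
  then show "Re (pencil h g t v v) \<le> Re (pencil h g s v v)"
    using nonneg[OF v] assms by (simp add: pencil_def mult_right_mono)
next
  fix v assume v: "v \<in> rad (pencil h g s)" "v \<noteq> 0"
  then have S: "v \<in> S" and "pencil h g s v v = 0" by (auto simp: rad_def)
  then have "Re (pencil h g t v v) = (s - t) * Re (g v v)"
    by (simp add: pencil_def algebra_simps complex_eq_iff)
  moreover have "Re (g v v) > 0"
    using nonneg[OF S] regular v by force
  ultimately show "Re (pencil h g t v v) < 0"
    using assms by (simp add: mult_less_0_iff)
qed

text \<open>Near t0 neither the negative nor the positive index can drop, so only the radical at t0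
  can be redistributed. The jump inequality decides how: to the right it all turns negative, to the
  left none of it does.\<close>

lemma pencil_neg_index_near:
  "\<forall>\<^sub>F t in at t0. dim (rad (pencil h g t)) = 0 \<and> neg_index (pencil h g t) =
     neg_index (pencil h g t0) + (if t0 < t then dim (rad (pencil h g t0)) else 0)"
proof -
  note herm = hermitian_pencil[OF h g]
  have lim: "((\<lambda>t. pencil h g t x y) \<longlongrightarrow> pencil h g t0 x y) (at t0)" for x y
    unfolding pencil_def by (intro tendsto_intros)
  have "\<forall>\<^sub>F t in at t0. neg_index (pencil h g t0) \<le> neg_index (pencil h g t)"
    by (rule neg_index_lower_semicontinuous[OF herm herm lim])
  moreover have "\<forall>\<^sub>F t in at t0. neg_index (\<lambda>x y. - pencil h g t0 x y) \<le> neg_index (\<lambda>x y. - pencil h g t x y)"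
    by (intro neg_index_lower_semicontinuous hermitian_uminus herm tendsto_minus lim)
  moreover have "\<forall>\<^sub>F t in at t0. t \<noteq> t0"
    by (simp add: eventually_at_filter)
  ultimately show ?thesis
  proof eventually_elim
    case (elim t)
    then show ?case
      using inertia_sum[OF herm, of t0] inertia_sum[OF herm, of t]
        pencil_neg_index_jump[of t t0] pencil_neg_index_jump[of t0 t]
      by (cases "t0 < t") auto
  qed
qed

lemma pencil_sum_rad_le:
  assumes "finite Z" "\<And>z. z \<in> Z \<Longrightarrow> z < t"
  shows "(\<Sum>z\<in>Z. dim (rad (pencil h g z))) \<le> neg_index (pencil h g t)"
  using assms
proof (induction Z arbitrary: t rule: finite_linorder_max_induct)
  case (insert z Z)
  have "(\<Sum>z\<in>Z. dim (rad (pencil h g z))) \<le> neg_index (pencil h g z)"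
    using insert by blast
  then show ?case
    using insert.hyps pencil_neg_index_jump[of z t] insert.prems by (force simp: sum.insert_if)
qed simp

lemma pencil_finite: "finite {t. dim (rad (pencil h g t)) \<noteq> 0}"
proof (rule ccontr)
  assume "infinite {t. dim (rad (pencil h g t)) \<noteq> 0}"
  \<comment> \<open>More than \<open>dim S\<close> points with a nontrivial radical would push the
    index beyond \<open>dim S\<close>.\<close>
  then obtain Z where Z: "finite Z" "card Z = Suc (dim S)" "Z \<subseteq> {t. dim (rad (pencil h g t)) \<noteq> 0}"
    using infinite_arbitrarily_large by blast
  have "card Z \<le> (\<Sum>z\<in>Z. dim (rad (pencil h g z)))"
    unfolding card_eq_sum using Z(3) by (intro sum_mono) auto
  also have "\<dots> \<le> neg_index (pencil h g (Max Z + 1))"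
    by (rule pencil_sum_rad_le[OF Z(1)]) (metis Max_ge Z(1) less_add_one le_less_trans)
  also have "\<dots> \<le> dim S" by (rule neg_index_le_dim)
  finally show False using Z(2) by simp
qed

text \<open>Subtracting the accumulated radical dimensions from the index cancels every jump. The
  difference is locally constant on the line, hence constant, and \<open>low\<close> gives its value
  far to the left.\<close>

lemma pencil_neg_index_count:
  assumes low: "\<And>t. t \<le> L \<Longrightarrow> neg_index (pencil h g t) = k"
  shows "neg_index (pencil h g t) = k + (\<Sum>z | dim (rad (pencil h g z)) \<noteq> 0 \<and> z < t. dim (rad (pencil h g z)))"
proof -
  define E where "E = {t. dim (rad (pencil h g t)) \<noteq> 0}"
  \<comment> \<open>Integers, because the subtraction must not be truncated.\<close>
  define D where "D t = int (neg_index (pencil h g t)) - (\<Sum>z\<in>E \<inter> {..<t}. int (dim (rad (pencil h g z))))" for t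
  have fin: "finite E" unfolding E_def by (rule pencil_finite)
  have "D constant_on UNIV"
  proof (rule locally_constant_imp_constant)
    fix a :: real
    obtain e where e: "e > 0" and near: "\<And>t. dist t a < e \<Longrightarrow> t \<noteq> a \<Longrightarrow>
        dim (rad (pencil h g t)) = 0 \<and> neg_index (pencil h g t) =
        neg_index (pencil h g a) + (if a < t then dim (rad (pencil h g a)) else 0)"
      using pencil_neg_index_near[of a] unfolding eventually_at by blast
    have "D t = D a" if t: "dist t a < e" for t
    proof -
      have noE: "z = a" if "z \<in> E" "dist z a < e" for z
        using near[OF that(2)] that(1) by (auto simp: E_def)
      consider "t < a" | "t = a" | "a < t" by linarith
      then show ?thesis
      proof cases
        case 1
        have "E \<inter> {..<t} = E \<inter> {..<a}"
          using 1 noE t by (fastforce simp: dist_real_def)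
        then show ?thesis using near[OF t] 1 by (simp add: D_def)
      next
        case 3
        have *: "E \<inter> {..<t} = (E \<inter> {..<a}) \<union> (E \<inter> {a})"
          using 3 noE t by (fastforce simp: dist_real_def)
        have "(\<Sum>z\<in>E \<inter> {..<t}. int (dim (rad (pencil h g z)))) =
            (\<Sum>z\<in>E \<inter> {..<a}. int (dim (rad (pencil h g z)))) + int (dim (rad (pencil h g a)))"
        proof -
          have "(\<Sum>z\<in>E \<inter> {a}. int (dim (rad (pencil h g z)))) = int (dim (rad (pencil h g a)))"
            by (cases "a \<in> E") (simp_all add: E_def)
          then show ?thesis
            unfolding * using fin by (subst sum.union_disjoint) (auto simp del: of_nat_sum)
        qed
        then show ?thesis using near[OF t] 3 by (simp add: D_def)
      qed simp
    qed
    then have "\<forall>x\<in>ball a e. D x = D a" by (metis dist_commute mem_ball)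
    moreover have "openin (top_of_set UNIV) (ball a e)" "a \<in> ball a e"
      using e by simp_all
    ultimately show "\<exists>T. openin (top_of_set UNIV) T \<and> a \<in> T \<and> (\<forall>x\<in>T. D x = D a)"
      by blast
  qed (rule connected_UNIV)
  then have const: "D x = D y" for x y unfolding constant_on_def by (metis UNIV_I)
  \<comment> \<open>At a point not above L and not above any jump the sum is empty and
    \<open>low\<close> applies.\<close>
  define b where "b = Min (insert L E)"
  have "E \<inter> {..<b} = {}" using fin by (auto simp: b_def)
  moreover have "b \<le> L" using fin by (simp add: b_def)
  ultimately have "D b = int k" using low by (simp add: D_def)
  then have "D t = int k" using const by metis
  moreover have "E \<inter> {..<t} = {z. dim (rad (pencil h g z)) \<noteq> 0 \<and> z < t}" by (auto simp: E_def)
  ultimately have "int (neg_index (pencil h g t)) =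
      int (k + (\<Sum>z | dim (rad (pencil h g z)) \<noteq> 0 \<and> z < t. dim (rad (pencil h g z))))"
    by (simp add: D_def)
  then show ?thesis by (simp only: of_nat_eq_iff)
qed

end

end

section \<open>Auxiliary facts on sequences and on Hermitian two-by-two matrices\<close>

context complex_vector_space begin

text \<open>Applying \<open>l j\<close> to a vanishing combination isolates its j-th
  coefficient.\<close>

lemma dual_family:
  assumes "finite I"
    and lin: "\<And>j x y. j \<in> I \<Longrightarrow> l j (x + y) = l j x + l j y"
      "\<And>j c x. j \<in> I \<Longrightarrow> l j (c \<odot> x) = c * (l j x :: complex)"
    and dual: "\<And>i j. i \<in> I \<Longrightarrow> j \<in> I \<Longrightarrow> l j (v i) = (if i = j then 1 else 0)"
  shows "dim (span (v ` I)) = card I"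
proof -
  have inj: "inj_on v I"
    by (rule inj_onI) (metis dual zero_neq_one)
  have "independent (v ` I)"
  proof (rule independent_if_scalars_zero)
    fix c x assume 0: "(\<Sum>x\<in>v ` I. c x \<odot> x) = 0" and "x \<in> v ` I"
    then obtain j where j: "j \<in> I" "x = v j" by blast
    have l0: "l j 0 = 0" using lin(2)[OF j(1), of 0 0] by simp
    have sum: "l j (\<Sum>i\<in>A. c (v i) \<odot> v i) = (\<Sum>i\<in>A. c (v i) * l j (v i))" for A
      by (induction A rule: infinite_finite_induct) (simp_all add: l0 lin[OF j(1)])
    have "(\<Sum>i\<in>I. c (v i) \<odot> v i) = 0"
      using 0 by (simp add: sum.reindex[OF inj])
    then have "(\<Sum>i\<in>I. c (v i) * l j (v i)) = 0"
      using sum[of I] l0 by simp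
    moreover have "(\<Sum>i\<in>I. c (v i) * l j (v i)) = (\<Sum>i\<in>I. if i = j then c (v i) else 0)"
      by (rule sum.cong) (simp_all add: dual j)
    ultimately show "c x = 0"
      using \<open>finite I\<close> j by simp
  qed (use \<open>finite I\<close> in simp)
  then show ?thesis
    using dim_span_eq_card_independent card_image[OF inj] by metis
qed

end

section \<open>The space of sequences and summation by parts\<close>

definition seqs :: "nat \<Rightarrow> (nat \<Rightarrow> complex) set" where
  "seqs N = {y. \<forall>n>N+1. y n = 0}"

lemma seqs_eq_span: "seqs N = seq.span ((\<lambda>i n. if n = i then 1 else 0) ` {..N+1})"
proof (rule antisym)
  show "seq.span ((\<lambda>i n. if n = i then 1 else 0) ` {..N+1}) \<subseteq> seqs N"
    by (rule seq.span_minimal) (auto simp: seqs_def seq.subspace_def)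
  show "seqs N \<subseteq> seq.span ((\<lambda>i n. if n = i then 1 else 0) ` {..N+1})"
  proof
    fix y assume y: "y \<in> seqs N"
    have eq: "(\<Sum>i\<in>{..N+1}. (\<lambda>n. y i * (if n = i then 1 else 0))) = y"
    proof
      fix n
      have "(\<Sum>i\<in>{..N+1}. y i * (if n = i then 1 else 0)) = (\<Sum>i\<in>{..N+1}. if n = i then y i else 0)"
        by (rule sum.cong) auto
      also have "\<dots> = y n" using y by (simp add: seqs_def)
      finally have "(\<Sum>i\<in>{..N+1}. y i * (if n = i then 1 else 0)) = y n" .
      moreover have "(\<Sum>i\<in>A. (\<lambda>n. y i * (if n = i then 1 else 0))) n = (\<Sum>i\<in>A. y i * (if n = i then 1 else 0))" for A
        by (induction A rule: infinite_finite_induct) simp_all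
      ultimately show "(\<Sum>i\<in>{..N+1}. (\<lambda>n. y i * (if n = i then 1 else 0))) n = y n" by simp
    qed
    have "(\<Sum>i\<in>{..N+1}. (\<lambda>n. y i * (if n = i then 1 else 0)))
        \<in> seq.span ((\<lambda>i n. if n = i then 1 else 0) ` {..N+1})"
      by (rule seq.span_sum, rule seq.span_scale, rule seq.span_base, rule imageI)
    then show "y \<in> seq.span ((\<lambda>i n. if n = i then 1 else 0) ` {..N+1})"
      by (simp only: eq)
  qed
qed

lemma complex_vector_space_seqs: "complex_vector_space (\<lambda>(c::complex) y n. c * y n) (seqs N)"
proof (unfold_locales)
  show "seq.subspace (seqs N)" by (auto simp: seqs_def seq.subspace_def)
  show "\<exists>B. finite B \<and> seqs N \<subseteq> seq.span B"
    using seqs_eq_span[of N] by blast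
qed

text \<open>Used with F m = f m (y (m + 1) - y m) and v the conjugate of the test sequence. The end
  terms at 0 and N are what the boundary conditions complete to a Hermitian form.\<close>

lemma sum_by_parts:
  fixes F :: "nat \<Rightarrow> complex"
  assumes "N \<ge> 1"
  shows "(\<Sum>n=1..N. v n * - (F n - F (n - 1))) =
    (\<Sum>n=1..<N. (v (n + 1) - v n) * F n) + v 1 * F 0 - v N * F N"
  using assms
proof (induction N rule: nat_induct_at_least)
  case base
  show ?case by (simp add: algebra_simps)
next
  case (Suc n)
  then show ?case by (simp add: algebra_simps)
qed

lemma dim_seqs: "seq.dim (seqs N) = N + 2"
proof -
  interpret V: complex_vector_space "\<lambda>(c::complex) y n. c * y n" "seqs N"
    by (rule complex_vector_space_seqs)
  have "seq.dim (seq.span ((\<lambda>i n. if n = i then 1 else 0) ` {..N+1})) = card {..N+1}"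
    by (rule V.dual_family[where l = "\<lambda>j y. y j"]) auto
  then show ?thesis by (simp only: seqs_eq_span[symmetric]) simp
qed

section \<open>Explicit spectral decomposition of a Hermitian two-by-two matrix\<close>

lemma hermitian_2x2_diag:
  fixes \<alpha> b :: real and z :: complex
  defines "\<delta> \<equiv> sqrt ((\<alpha> - b)\<^sup>2 + 4 * (cmod z)\<^sup>2)"
  obtains r1 r2 :: complex where "(cmod r1)\<^sup>2 + (cmod r2)\<^sup>2 = 1"
    "\<And>(c1::complex) (c2::complex). \<alpha> * (cmod c1)\<^sup>2 + 2 * Re (cnj z * cnj c1 * c2) + b * (cmod c2)\<^sup>2 =
       (\<alpha> + b - \<delta>) / 2 * (cmod (cnj r1 * c1 + cnj r2 * c2))\<^sup>2 + (\<alpha> + b + \<delta>) / 2 * (cmod (- r2 * c1 + r1 * c2))\<^sup>2"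
proof -
  define k0 where "k0 = (\<alpha> + b - \<delta>) / 2"
  define k1 where "k1 = (\<alpha> + b + \<delta>) / 2"
  \<comment> \<open>(r1, r2) is a unit eigenvector for the smaller eigenvalue k0, and (- cnj r2, cnj
    r1) is one for k1. The equations compare the entries of the spectral decomposition with those of
    the matrix.\<close>
  have "\<exists>(r1::complex) (r2::complex). (cmod r1)\<^sup>2 + (cmod r2)\<^sup>2 = 1 \<and> k0 * (cmod r1)\<^sup>2 + k1 * (cmod r2)\<^sup>2 = \<alpha> \<and>
      k0 * (cmod r2)\<^sup>2 + k1 * (cmod r1)\<^sup>2 = b \<and> of_real (k0 - k1) * r1 * cnj r2 = cnj z"
  proof (cases "z = 0")
    case True
    then have "\<delta> = \<bar>\<alpha> - b\<bar>" by (simp add: \<delta>_def)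
    then have "(\<alpha> \<le> b \<and> k0 = \<alpha> \<and> k1 = b) \<or> (k0 = b \<and> k1 = \<alpha>)"
      by (auto simp: k0_def k1_def abs_if field_simps)
    then show ?thesis
    proof
      assume "\<alpha> \<le> b \<and> k0 = \<alpha> \<and> k1 = b"
      then show ?thesis using True by (intro exI[of _ 1] exI[of _ 0]) simp
    next
      assume "k0 = b \<and> k1 = \<alpha>"
      then show ?thesis using True by (intro exI[of _ 0] exI[of _ 1]) simp
    qed
  next
    case False
    \<comment> \<open>m is \<alpha> - k0, so (cnj z, -m) is an eigenvector for k0. Its squared
      length is m * \<delta>, and s normalises it. It could be zero if z were zero, hence the case
      split.\<close>
    define m where "m = (\<alpha> - b + \<delta>) / 2"
    define Z where "Z = (cmod z)\<^sup>2"
    have Z: "Z > 0" using False by (simp add: Z_def)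
    have d2: "\<delta>\<^sup>2 = (\<alpha> - b)\<^sup>2 + 4 * Z"
      unfolding \<delta>_def Z_def by (simp add: add_nonneg_nonneg)
    have rho: "Z + m\<^sup>2 = m * \<delta>"
      using d2 by (simp add: m_def power2_eq_square field_simps)
    define s where "s = sqrt (m * \<delta>)"
    have s2: "s\<^sup>2 = m * \<delta>" and s0: "s > 0"
      using Z rho by (simp_all add: s_def add_pos_nonneg flip: rho)
    have md: "m * \<delta> \<noteq> 0" using s2 s0 by auto
    define r1 where "r1 = cnj z / of_real s"
    define r2 where "r2 = complex_of_real (- m / s)"
    have n1: "(cmod r1)\<^sup>2 = Z / (m * \<delta>)" and n2: "(cmod r2)\<^sup>2 = m\<^sup>2 / (m * \<delta>)"
      using s0 by (simp_all add: r1_def r2_def norm_divide power_divide Z_def flip: s2)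
    have k: "k0 = \<alpha> - m" "k1 = \<alpha> - m + \<delta>" by (simp_all add: k0_def k1_def m_def field_simps)
    have "Z / (m * \<delta>) + m\<^sup>2 / (m * \<delta>) = 1"
      using rho md by (simp flip: add_divide_distrib)
    moreover have "k0 * (Z / (m * \<delta>)) + k1 * (m\<^sup>2 / (m * \<delta>)) = \<alpha>"
    proof -
      have "k0 * Z + k1 * m\<^sup>2 = \<alpha> * (Z + m\<^sup>2) + m * (m * \<delta> - (Z + m\<^sup>2))"
        by (simp add: k algebra_simps power2_eq_square)
      then have "k0 * Z + k1 * m\<^sup>2 = \<alpha> * (m * \<delta>)" by (simp add: rho)
      then show ?thesis using md by (simp flip: add_divide_distrib)
    qed
    moreover have "k0 * (m\<^sup>2 / (m * \<delta>)) + k1 * (Z / (m * \<delta>)) = b"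
    proof -
      have b: "b = k0 + k1 - \<alpha>" by (simp add: k0_def k1_def field_simps)
      have "k0 * m\<^sup>2 + k1 * Z = (k0 + k1) * (Z + m\<^sup>2) - (\<alpha> * (Z + m\<^sup>2) + m * (m * \<delta> - (Z + m\<^sup>2)))"
        by (simp add: k algebra_simps power2_eq_square)
      then have "k0 * m\<^sup>2 + k1 * Z = b * (m * \<delta>)" by (simp add: rho b algebra_simps)
      then show ?thesis using md by (simp flip: add_divide_distrib)
    qed
    moreover have "of_real (k0 - k1) * r1 * cnj r2 = cnj z"
    proof -
      have "of_real (k0 - k1) * r1 * cnj r2 = of_real (m * \<delta> / (s * s)) * cnj z"
        by (simp add: k r1_def r2_def)
      also have "m * \<delta> / (s * s) = 1"
        unfolding s2[symmetric] power2_eq_square using s0 by simp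
      finally show ?thesis by simp
    qed
    ultimately show ?thesis
      unfolding n1[symmetric] n2[symmetric] by blast
  qed
  then obtain r1 r2 :: complex where r: "(cmod r1)\<^sup>2 + (cmod r2)\<^sup>2 = 1"
      "k0 * (cmod r1)\<^sup>2 + k1 * (cmod r2)\<^sup>2 = \<alpha>"
      "k0 * (cmod r2)\<^sup>2 + k1 * (cmod r1)\<^sup>2 = b" "of_real (k0 - k1) * r1 * cnj r2 = cnj z"
    by blast
  show ?thesis
  proof (rule that[OF r(1)])
    fix c1 c2 :: complex
    have 1: "(cmod (cnj r1 * c1 + cnj r2 * c2))\<^sup>2 = (cmod r1)\<^sup>2 * (cmod c1)\<^sup>2 + (cmod r2)\<^sup>2 * (cmod c2)\<^sup>2
        + 2 * Re (r1 * cnj r2 * (cnj c1 * c2))"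
      unfolding cmod_power2 by (simp add: algebra_simps power2_eq_square)
    have 2: "(cmod (- r2 * c1 + r1 * c2))\<^sup>2 = (cmod r2)\<^sup>2 * (cmod c1)\<^sup>2 + (cmod r1)\<^sup>2 * (cmod c2)\<^sup>2
        - 2 * Re (r1 * cnj r2 * (cnj c1 * c2))"
      unfolding cmod_power2 by (simp add: algebra_simps power2_eq_square)
    have "Re (cnj z * cnj c1 * c2) = (k0 - k1) * Re (r1 * cnj r2 * (cnj c1 * c2))"
      unfolding r(4)[symmetric] by (simp add: algebra_simps)
    then show "\<alpha> * (cmod c1)\<^sup>2 + 2 * Re (cnj z * cnj c1 * c2) + b * (cmod c2)\<^sup>2 =
       (\<alpha> + b - \<delta>) / 2 * (cmod (cnj r1 * c1 + cnj r2 * c2))\<^sup>2 + (\<alpha> + b + \<delta>) / 2 * (cmod (- r2 * c1 + r1 * c2))\<^sup>2"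
      unfolding k0_def[symmetric] k1_def[symmetric] 1 2
      by (subst r(2)[symmetric], subst r(3)[symmetric]) (simp add: algebra_simps)
  qed
qed

section \<open>The Hermitian form of a Sturm-Liouville problem\<close>

lemma vector_4 [simp]:
  "(vector [a, b, c, d] :: 'a::zero^4) $ 1 = a"
  "(vector [a, b, c, d] :: 'a::zero^4) $ 2 = b"
  "(vector [a, b, c, d] :: 'a::zero^4) $ 3 = c"
  "(vector [a, b, c, d] :: 'a::zero^4) $ 4 = d"
  by (simp_all add: vector_def)

lemma cnj_mult_self: "cnj x * x = of_real ((cmod x)\<^sup>2)"
  by (simp add: mult.commute[of "cnj x"] flip: complex_norm_square)

lemma lblock_mult: "lblock (T ** X) = T ** lblock X"
  and rblock_mult: "rblock (T ** X) = T ** rblock X"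
  by (simp_all add: lblock_def rblock_def matrix_matrix_mult_def vec_eq_iff)

lemma GL_class_self: "X \<in> GL_class X"
proof -
  have "invertible (mat 1 :: complex^2^2)" by (auto simp: invertible_def)
  moreover have "X = mat 1 ** X" by simp
  ultimately show ?thesis unfolding GL_class_def by blast
qed

text \<open>Replacing X by \<open>T ** X\<close> multiplies the left-hand side by T, so one
  representative decides for the class.\<close>

lemma satisfies_bc_GL_class:
  "satisfies_bc N f (GL_class X) y \<longleftrightarrow>
     lblock X *v vector [y 0, of_real (f 0) * fdiff y 0] + rblock X *v vector [y N, of_real (f N) * fdiff y N] = 0"
proof
  assume "satisfies_bc N f (GL_class X) y"
  then show "lblock X *v vector [y 0, of_real (f 0) * fdiff y 0] + rblock X *v vector [y N, of_real (f N) * fdiff y N] = 0"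
    unfolding satisfies_bc_def using GL_class_self by blast
next
  let ?l = "vector [y 0, of_real (f 0) * fdiff y 0] :: complex^2"
  let ?r = "vector [y N, of_real (f N) * fdiff y N] :: complex^2"
  assume 0: "lblock X *v ?l + rblock X *v ?r = 0"
  have "lblock (T ** X) *v ?l + rblock (T ** X) *v ?r = T *v (lblock X *v ?l + rblock X *v ?r)" for T
    by (simp add: lblock_mult rblock_mult matrix_vector_right_distrib flip: matrix_vector_mul_assoc)
  then show "satisfies_bc N f (GL_class X) y"
    unfolding satisfies_bc_def GL_class_def by (auto simp: 0)
qed

locale sl_problem =
  fixes N :: nat and f q w :: "nat \<Rightarrow> real"
  assumes N: "N \<ge> 2" and omega: "in_Omega N f q w"
begin

sublocale V: complex_vector_space "\<lambda>(c::complex) y n. c * y n" "seqs N"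
  by (rule complex_vector_space_seqs)

lemma f_nonzero: "n \<le> N \<Longrightarrow> f n \<noteq> 0"
  using omega by (simp add: in_Omega_def)

lemma w_pos: "1 \<le> n \<Longrightarrow> n \<le> N \<Longrightarrow> w n > 0"
  using omega by (simp add: in_Omega_def)

section \<open>The quadratic forms and the weak formulation\<close>

definition flux :: "(nat \<Rightarrow> complex) \<Rightarrow> complex" where
  "flux y = of_real (f N) * fdiff y N"

definition mass :: "(nat \<Rightarrow> complex) \<Rightarrow> (nat \<Rightarrow> complex) \<Rightarrow> complex" where
  "mass u y = (\<Sum>n=1..N. of_real (w n) * (cnj (u n) * y n))"

text \<open>The contribution f 0 |y 1 - y 0|^2 of the leftmost difference is split three ways: |y
  1|^2 stays here, the cross terms go to \<open>coupling\<close>, and |y 0|^2 turns a into a + f 0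
  in \<open>boundary_form\<close>. Thus this form involves y 1, ..., y N only and
  \<open>boundary_form\<close> only y 0 and the flux.\<close>

definition interior_form :: "(nat \<Rightarrow> complex) \<Rightarrow> (nat \<Rightarrow> complex) \<Rightarrow> complex" where
  "interior_form u y = (\<Sum>n=1..<N. of_real (f n) * (cnj (fdiff u n) * fdiff y n)) +
     (\<Sum>n=1..N. of_real (q n) * (cnj (u n) * y n)) + of_real (f 0) * (cnj (u 1) * y 1)"

definition coupling :: "(nat \<Rightarrow> complex) \<Rightarrow> (nat \<Rightarrow> complex) \<Rightarrow> complex" where
  "coupling u y = of_real (f 0) * (cnj (u 1) * y 0 + cnj (u 0) * y 1) + (cnj (u N) * flux y + cnj (flux u) * y N)"

definition boundary_form :: "real \<Rightarrow> complex \<Rightarrow> real \<Rightarrow> (nat \<Rightarrow> complex) \<Rightarrow> (nat \<Rightarrow> complex) \<Rightarrow> complex" where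
  "boundary_form a z b u y = of_real (a + f 0) * (cnj (u 0) * y 0) +
     (cnj z * (cnj (u 0) * flux y) + z * (cnj (flux u) * y 0)) + of_real b * (cnj (flux u) * flux y)"

definition energy :: "real \<Rightarrow> complex \<Rightarrow> real \<Rightarrow> (nat \<Rightarrow> complex) \<Rightarrow> (nat \<Rightarrow> complex) \<Rightarrow> complex" where
  "energy a z b u y = interior_form u y - coupling u y + boundary_form a z b u y"

lemma flux_add: "flux (x + y) = flux x + flux y"
  and flux_scale: "flux (\<lambda>n. c * y n) = c * flux y"
  by (simp_all add: flux_def fdiff_def algebra_simps)

lemma fdiff_add: "fdiff (x + y) n = fdiff x n + fdiff y n"
  and fdiff_scale: "fdiff (\<lambda>n. c * y n) m = c * fdiff y m"
  by (simp_all add: fdiff_def algebra_simps)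

lemma hermitian_mass: "V.hermitian mass"
  unfolding V.hermitian_def mass_def
  by (simp add: algebra_simps sum.distrib sum_distrib_left)

lemma hermitian_interior: "V.hermitian interior_form"
  unfolding V.hermitian_def interior_form_def
  by (simp add: algebra_simps sum.distrib sum_distrib_left fdiff_add fdiff_scale)

lemma hermitian_coupling: "V.hermitian coupling"
  unfolding V.hermitian_def coupling_def
  by (simp add: algebra_simps flux_add flux_scale)

lemma hermitian_boundary: "V.hermitian (boundary_form a z b)"
  unfolding V.hermitian_def boundary_form_def
  by (simp add: algebra_simps flux_add flux_scale)

lemma hermitian_energy: "V.hermitian (energy a z b)"
  unfolding V.hermitian_def energy_def
  by (simp add: V.hermitianD[OF hermitian_interior] V.hermitianD[OF hermitian_coupling]
      V.hermitianD[OF hermitian_boundary] algebra_simps)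

definition residual :: "complex \<Rightarrow> (nat \<Rightarrow> complex) \<Rightarrow> nat \<Rightarrow> complex" where
  "residual lam y n = - bdiff (\<lambda>m. of_real (f m) * fdiff y m) n + of_real (q n) * y n - lam * of_real (w n) * y n"

definition bc1 :: "real \<Rightarrow> complex \<Rightarrow> (nat \<Rightarrow> complex) \<Rightarrow> complex" where
  "bc1 a z y = of_real a * y 0 - of_real (f 0) * fdiff y 0 + cnj z * flux y"

definition bc2 :: "complex \<Rightarrow> real \<Rightarrow> (nat \<Rightarrow> complex) \<Rightarrow> complex" where
  "bc2 z b y = z * y 0 - y N + of_real b * flux y"

text \<open>Summation by parts leaves end terms in F 0 and F N. Pairing the boundary rows with
  \<open>u 0\<close> and \<open>flux u\<close> is exactly what makes them symmetric in u and
  y.\<close>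

lemma energy_residual:
  "energy a z b u y - lam * mass u y =
     (\<Sum>n=1..N. cnj (u n) * residual lam y n) + cnj (u 0) * bc1 a z y + cnj (flux u) * bc2 z b y"
proof -
  define F where "F m = of_real (f m) * fdiff y m" for m
  have "(\<Sum>n=1..N. cnj (u n) * residual lam y n) = (\<Sum>n=1..N. cnj (u n) * - (F n - F (n - 1))) +
      (\<Sum>n=1..N. of_real (q n) * (cnj (u n) * y n)) - lam * mass u y"
    by (simp add: residual_def bdiff_def F_def mass_def sum_distrib_left algebra_simps sum.distrib sum_subtractf)
  also have "(\<Sum>n=1..N. cnj (u n) * - (F n - F (n - 1))) =
      (\<Sum>n=1..<N. (cnj (u (n + 1)) - cnj (u n)) * F n) + cnj (u 1) * F 0 - cnj (u N) * F N"
    by (rule sum_by_parts) (use N in simp)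
  also have "(\<Sum>n=1..<N. (cnj (u (n + 1)) - cnj (u n)) * F n) =
      (\<Sum>n=1..<N. of_real (f n) * (cnj (fdiff u n) * fdiff y n))"
    by (simp add: F_def fdiff_def algebra_simps)
  finally show ?thesis
    by (simp add: energy_def interior_form_def coupling_def boundary_form_def bc1_def bc2_def
        F_def flux_def fdiff_def algebra_simps)
qed

lemma satisfies_bc_pt23: "satisfies_bc N f (pt23 a z b) y \<longleftrightarrow> bc1 a z y = 0 \<and> bc2 z b y = 0"
  unfolding pt23_def satisfies_bc_GL_class
  by (simp add: vec_eq_iff forall_2 matrix_vector_mult_def sum_2 lblock_def rblock_def
      bc1_def bc2_def flux_def algebra_simps)

lemma solution_space_eq:
  "solution_space N f q w (pt23 a z b) lam =
     {y \<in> seqs N. (\<forall>n\<in>{1..N}. residual lam y n = 0) \<and> bc1 a z y = 0 \<and> bc2 z b y = 0}"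
  unfolding solution_space_def solves_equation_def satisfies_bc_pt23 seqs_def residual_def
  by (auto simp: algebra_simps)

text \<open>Unit sequences recover the equations one at a time: the one at 0 gives
  \<open>bc1\<close>, the one at N + 1 has only a flux and gives \<open>bc2\<close>, and those in
  between give the difference equation.\<close>

lemma solution_space_weak:
  "solution_space N f q w (pt23 a z b) lam =
     {y \<in> seqs N. \<forall>u\<in>seqs N. energy a z b u y - lam * mass u y = 0}"
proof (intro set_eqI iffI)
  fix y assume "y \<in> solution_space N f q w (pt23 a z b) lam"
  then show "y \<in> {y \<in> seqs N. \<forall>u\<in>seqs N. energy a z b u y - lam * mass u y = 0}"
    unfolding solution_space_eq energy_residual by simp
next
  fix y assume "y \<in> {y \<in> seqs N. \<forall>u\<in>seqs N. energy a z b u y - lam * mass u y = 0}"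
  then have y: "y \<in> seqs N" by blast
  have 0: "(\<Sum>n=1..N. cnj (u n) * residual lam y n) + cnj (u 0) * bc1 a z y +
      cnj (flux u) * bc2 z b y = 0" if "u \<in> seqs N" for u
    using that \<open>y \<in> {y \<in> seqs N. _ y}\<close> unfolding energy_residual by blast
  have b1: "bc1 a z y = 0"
  proof -
    have "(\<lambda>n. if n = 0 then 1 else 0) \<in> seqs N" by (simp add: seqs_def)
    from 0[OF this] show ?thesis using N by (simp add: flux_def fdiff_def)
  qed
  have b2: "bc2 z b y = 0"
  proof -
    have "(\<lambda>n. if n = N + 1 then 1 else 0) \<in> seqs N" by (simp add: seqs_def)
    from 0[OF this] show ?thesis using f_nonzero[of N] by (simp add: flux_def fdiff_def)
  qed
  have "residual lam y m = 0" if m: "m \<in> {1..N}" for m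
  proof -
    \<comment> \<open>For m = N this unit sequence has a nonzero flux, so \<open>bc2\<close> must
      already be known to vanish.\<close>
    have "(\<lambda>n. if n = m then 1 else 0) \<in> seqs N" using m by (auto simp: seqs_def)
    from 0[OF this] have "(\<Sum>n=1..N. cnj (if n = m then 1 else 0) * residual lam y n) = 0"
      using m b2 by simp
    also have "(\<Sum>n=1..N. cnj (if n = m then 1 else 0) * residual lam y n) =
        (\<Sum>n=1..N. if n = m then residual lam y n else 0)"
      by (rule sum.cong) auto
    finally show ?thesis using m by simp
  qed
  then show "y \<in> solution_space N f q w (pt23 a z b) lam"
    unfolding solution_space_eq using y b1 b2 by blast
qed

lemma mass_diag: "Re (mass y y) = (\<Sum>n=1..N. w n * (cmod (y n))\<^sup>2)"
  unfolding mass_def cnj_mult_self by simp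

lemma mass_nonneg: "Re (mass y y) \<ge> 0"
  unfolding mass_diag by (intro sum_nonneg mult_nonneg_nonneg less_imp_le[OF w_pos]) auto

lemma mass_eq_0_iff: "Re (mass y y) = 0 \<longleftrightarrow> (\<forall>n\<in>{1..N}. y n = 0)"
proof -
  have nn: "\<forall>n\<in>{1..N}. 0 \<le> w n * (cmod (y n))\<^sup>2"
    by (intro ballI mult_nonneg_nonneg less_imp_le[OF w_pos]) auto
  have "Re (mass y y) = 0 \<longleftrightarrow> (\<forall>n\<in>{1..N}. w n * (cmod (y n))\<^sup>2 = 0)"
    unfolding mass_diag using nn by (subst sum_nonneg_eq_0_iff) auto
  then show ?thesis using w_pos by force
qed

text \<open>If y vanishes at 1, ..., N, the equations at 1 and at N leave only multiples of y 0 and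
  y (N + 1) by f 0 and f N. This supplies the regularity hypothesis of the pencil lemmas,
  \<open>mass\<close> being only semidefinite.\<close>

lemma solution_mass_0:
  assumes "y \<in> solution_space N f q w (pt23 a z b) lam" "Re (mass y y) = 0"
  shows "y = 0"
proof -
  have y: "n \<in> {1..N} \<Longrightarrow> y n = 0" for n using assms(2) mass_eq_0_iff by blast
  have S: "y \<in> seqs N" and r: "residual lam y 1 = 0" "residual lam y N = 0"
    using assms(1) N unfolding solution_space_eq by auto
  have "y 0 = 0"
    using r(1) y[of 1] y[of 2] f_nonzero[of 0] N
    by (simp add: residual_def bdiff_def fdiff_def numeral_2_eq_2)
  moreover have "y (N + 1) = 0"
    using r(2) y[of "N - 1"] y[of N] f_nonzero[of N] N
    by (simp add: residual_def bdiff_def fdiff_def)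
  ultimately have "y n = 0" for n
    using y[of n] S by (cases "n = 0"; cases "n \<le> N"; cases "n = N + 1") (auto simp: seqs_def)
  then show ?thesis by (simp add: fun_eq_iff)
qed

lemma rad_pencil_eq: "V.rad (V.pencil (energy a z b) mass t) = solution_space N f q w (pt23 a z b) (of_real t)"
  unfolding solution_space_weak V.rad_def V.pencil_def by simp

lemma pencil_regular: "v \<in> V.rad (V.pencil (energy a z b) mass t) \<Longrightarrow> Re (mass v v) = 0 \<Longrightarrow> v = 0"
  unfolding rad_pencil_eq by (rule solution_mass_0)

lemma eigenvalues_real: "eigenvalues N f q w (pt23 a z b) \<subseteq> \<real>"
proof
  fix lam assume "lam \<in> eigenvalues N f q w (pt23 a z b)"
  then obtain y where y: "y \<in> solution_space N f q w (pt23 a z b) lam" "y \<noteq> 0"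
    by (auto simp: eigenvalues_def)
  then have "energy a z b y y = lam * mass y y"
    unfolding solution_space_weak by auto
  then have "complex_of_real (Re (energy a z b y y)) = lam * of_real (Re (mass y y))"
    using V.hermitian_diag_real hermitian_energy hermitian_mass by metis
  moreover have "Re (mass y y) \<noteq> 0" using solution_mass_0 y by blast
  ultimately have "lam = of_real (Re (energy a z b y y) / Re (mass y y))"
    by (simp add: field_simps)
  then show "lam \<in> \<real>" by (metis Reals_of_real)
qed


section \<open>Estimates against the mass and trial sequences\<close>

definition mass_bounded :: "((nat \<Rightarrow> complex) \<Rightarrow> real) \<Rightarrow> bool" where
  "mass_bounded Q \<longleftrightarrow> (\<exists>C. \<forall>y. \<bar>Q y\<bar> \<le> C * Re (mass y y))"

lemma mass_bounded_add: "mass_bounded P \<Longrightarrow> mass_bounded Q \<Longrightarrow> mass_bounded (\<lambda>y. P y + Q y)"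
proof -
  assume "mass_bounded P" "mass_bounded Q"
  then obtain C D where C: "\<And>y. \<bar>P y\<bar> \<le> C * Re (mass y y)" and D: "\<And>y. \<bar>Q y\<bar> \<le> D * Re (mass y y)"
    unfolding mass_bounded_def by blast
  have "\<bar>P y + Q y\<bar> \<le> (C + D) * Re (mass y y)" for y
    using abs_triangle_ineq[of "P y" "Q y"] C[of y] D[of y] unfolding distrib_right by linarith
  then show ?thesis unfolding mass_bounded_def by blast
qed

lemma mass_bounded_scale: "mass_bounded Q \<Longrightarrow> mass_bounded (\<lambda>y. c * Q y)"
proof -
  assume "mass_bounded Q"
  then obtain D where D: "\<And>y. \<bar>Q y\<bar> \<le> D * Re (mass y y)"
    unfolding mass_bounded_def by blast
  have "\<bar>c * Q y\<bar> \<le> (\<bar>c\<bar> * D) * Re (mass y y)" for y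
    using mult_left_mono[OF D[of y], of "\<bar>c\<bar>"] by (simp add: abs_mult mult.assoc)
  then show ?thesis unfolding mass_bounded_def by blast
qed

lemma mass_bounded_zero: "mass_bounded (\<lambda>y. 0)"
  unfolding mass_bounded_def by (rule exI[of _ 0]) simp

lemma mass_bounded_sum: "(\<And>i. i \<in> A \<Longrightarrow> mass_bounded (Q i)) \<Longrightarrow> mass_bounded (\<lambda>y. \<Sum>i\<in>A. Q i y)"
proof (induction A rule: infinite_finite_induct)
  case (insert i A)
  then show ?case by (simp add: mass_bounded_add)
qed (simp_all add: mass_bounded_zero)

lemma mass_bounded_le: "mass_bounded Q \<Longrightarrow> (\<And>y. \<bar>P y\<bar> \<le> \<bar>Q y\<bar>) \<Longrightarrow> mass_bounded P"
  unfolding mass_bounded_def by (elim exE, rule exI) (blast intro: order_trans)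

lemma mass_bounded_coord:
  assumes "1 \<le> n" "n \<le> N"
  shows "mass_bounded (\<lambda>y. (cmod (y n))\<^sup>2)"
  unfolding mass_bounded_def
proof (intro exI allI)
  fix y
  have "w n * (cmod (y n))\<^sup>2 \<le> Re (mass y y)"
    unfolding mass_diag using assms
    by (intro member_le_sum mult_nonneg_nonneg less_imp_le[OF w_pos]) auto
  then show "\<bar>(cmod (y n))\<^sup>2\<bar> \<le> (1 / w n) * Re (mass y y)"
    using w_pos[OF assms] by (simp add: field_simps)
qed

lemma mass_bounded_interior: "mass_bounded (\<lambda>y. Re (interior_form y y))"
proof -
  have diff: "mass_bounded (\<lambda>y. (cmod (fdiff y n))\<^sup>2)" if "n \<in> {1..<N}" for n
  proof (rule mass_bounded_le)
    show "mass_bounded (\<lambda>y. 2 * (cmod (y (n + 1)))\<^sup>2 + 2 * (cmod (y n))\<^sup>2)"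
      using that by (intro mass_bounded_add mass_bounded_scale mass_bounded_coord) auto
    fix y
    have "(cmod (fdiff y n))\<^sup>2 \<le> (cmod (y (n + 1)) + cmod (y n))\<^sup>2"
      unfolding fdiff_def by (intro power_mono norm_triangle_ineq4) auto
    also have "\<dots> \<le> 2 * (cmod (y (n + 1)))\<^sup>2 + 2 * (cmod (y n))\<^sup>2"
      using sum_squares_bound[of "cmod (y (n + 1))" "cmod (y n)"] by (simp add: power2_sum)
    finally show "\<bar>(cmod (fdiff y n))\<^sup>2\<bar> \<le> \<bar>2 * (cmod (y (n + 1)))\<^sup>2 + 2 * (cmod (y n))\<^sup>2\<bar>" by simp
  qed
  have "mass_bounded (\<lambda>y. (\<Sum>n=1..<N. f n * (cmod (fdiff y n))\<^sup>2) +
     (\<Sum>n=1..N. q n * (cmod (y n))\<^sup>2) + f 0 * (cmod (y 1))\<^sup>2)"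
    using N by (intro mass_bounded_add mass_bounded_sum mass_bounded_scale diff mass_bounded_coord) auto
  then show ?thesis
    unfolding interior_form_def cnj_mult_self by simp
qed

text \<open>The weighted arithmetic-geometric mean inequality; the weight d shifts the cost from y
  to x.\<close>

lemma Re_mult_le: "\<bar>2 * Re (cnj x * y)\<bar> \<le> (1 / d) * (cmod x)\<^sup>2 + d * (cmod y)\<^sup>2" if "d > 0"
proof -
  have "\<bar>2 * Re (cnj x * y)\<bar> \<le> 2 * (cmod x * cmod y)"
    using abs_Re_le_cmod[of "cnj x * y"] by (simp add: norm_mult)
  also have "0 \<le> (cmod x - d * cmod y)\<^sup>2 / d" using that by simp
  then have "2 * (cmod x * cmod y) \<le> (1 / d) * (cmod x)\<^sup>2 + d * (cmod y)\<^sup>2"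
    using that by (simp add: power2_eq_square field_simps)
  finally show ?thesis .
qed

lemma coupling_diag:
  fixes y :: "nat \<Rightarrow> complex"
  shows "Re (coupling y y) = 2 * Re (cnj (f 0 * y 1) * y 0) + 2 * Re (cnj (y N) * flux y)"
  by (simp add: coupling_def algebra_simps)

text \<open>Each coupling term pairs an interior value with a boundary value. The boundary share can
  be made as small as desired, and the interior share is paid for by the mass.\<close>

lemma coupling_bound:
  assumes "d > 0"
  shows "\<exists>C. \<forall>y::nat \<Rightarrow> complex. \<bar>Re (coupling y y)\<bar> \<le> C * Re (mass y y) + d * ((cmod (y 0))\<^sup>2 + (cmod (flux y))\<^sup>2)"
proof -
  have "mass_bounded (\<lambda>y. ((f 0)\<^sup>2 / d) * (cmod (y 1))\<^sup>2 + (1 / d) * (cmod (y N))\<^sup>2)"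
    using N by (intro mass_bounded_add mass_bounded_scale mass_bounded_coord) auto
  then obtain C where C: "\<And>y::nat \<Rightarrow> complex. \<bar>((f 0)\<^sup>2 / d) * (cmod (y 1))\<^sup>2 + (1 / d) * (cmod (y N))\<^sup>2\<bar> \<le> C * Re (mass y y)"
    unfolding mass_bounded_def by blast
  show ?thesis
  proof (intro exI[of _ C] allI)
    fix y :: "nat \<Rightarrow> complex"
    have "\<bar>Re (coupling y y)\<bar> \<le> \<bar>2 * Re (cnj (f 0 * y 1) * y 0)\<bar> + \<bar>2 * Re (cnj (y N) * flux y)\<bar>"
      unfolding coupling_diag by (rule abs_triangle_ineq)
    also have "\<dots> \<le> ((1 / d) * (cmod (f 0 * y 1))\<^sup>2 + d * (cmod (y 0))\<^sup>2) + ((1 / d) * (cmod (y N))\<^sup>2 + d * (cmod (flux y))\<^sup>2)"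
      by (intro add_mono Re_mult_le assms)
    also have "\<dots> = (((f 0)\<^sup>2 / d) * (cmod (y 1))\<^sup>2 + (1 / d) * (cmod (y N))\<^sup>2) + d * ((cmod (y 0))\<^sup>2 + (cmod (flux y))\<^sup>2)"
      by (simp add: norm_mult power_mult_distrib algebra_simps)
    also have "\<dots> \<le> C * Re (mass y y) + d * ((cmod (y 0))\<^sup>2 + (cmod (flux y))\<^sup>2)"
      using C[of y] by simp
    finally show "\<bar>Re (coupling y y)\<bar> \<le> C * Re (mass y y) + d * ((cmod (y 0))\<^sup>2 + (cmod (flux y))\<^sup>2)" .
  qed
qed

lemma boundary_diag:
  "Re (boundary_form a z b y y) = (a + f 0) * (cmod (y 0))\<^sup>2 + 2 * Re (cnj z * cnj (y 0) * flux y) + b * (cmod (flux y))\<^sup>2"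
  unfolding cmod_power2 by (simp add: boundary_form_def power2_eq_square algebra_simps)


text \<open>The eigenvalues, in increasing order, of the matrix with rows \<open>(a + f 0, cnj z)\<close> and \<open>(z, b)\<close>.\<close>

definition kappa :: "real \<Rightarrow> complex \<Rightarrow> real \<Rightarrow> nat \<Rightarrow> real" where
  "kappa a z b i = ((a + f 0) + b + (if i = 0 then -1 else 1) * sqrt (((a + f 0) - b)\<^sup>2 + 4 * (cmod z)\<^sup>2)) / 2"

text \<open>\<open>l 0\<close> and \<open>l 1\<close> are the coordinates of (y 0, flux y) in an
  orthonormal eigenbasis of the boundary matrix, and (c1 i, c2 i) are the eigenvectors. Functionals
  on sequences suit the codimension bound, eigenvectors the trial subspaces.\<close>

lemma boundary_eigenbasis:
  obtains l :: "nat \<Rightarrow> (nat \<Rightarrow> complex) \<Rightarrow> complex" and c1 c2 :: "nat \<Rightarrow> complex" where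
    "\<And>i x y. l i (x + y) = l i x + l i y" "\<And>i c y. l i (\<lambda>n. c * y n) = c * l i y"
    "\<And>y. (cmod (l 0 y))\<^sup>2 + (cmod (l 1 y))\<^sup>2 = (cmod (y 0))\<^sup>2 + (cmod (flux y))\<^sup>2"
    "\<And>y. Re (boundary_form a z b y y) = kappa a z b 0 * (cmod (l 0 y))\<^sup>2 + kappa a z b 1 * (cmod (l 1 y))\<^sup>2"
    "\<And>i j y. i < 2 \<Longrightarrow> j < 2 \<Longrightarrow> y 0 = c1 i \<Longrightarrow> flux y = c2 i \<Longrightarrow> l j y = (if i = j then 1 else 0)"
proof -
  obtain r1 r2 :: complex where r: "(cmod r1)\<^sup>2 + (cmod r2)\<^sup>2 = 1"
    and diag: "\<And>(c1::complex) (c2::complex). (a + f 0) * (cmod c1)\<^sup>2 + 2 * Re (cnj z * cnj c1 * c2) + b * (cmod c2)\<^sup>2 =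
       ((a + f 0) + b - sqrt (((a + f 0) - b)\<^sup>2 + 4 * (cmod z)\<^sup>2)) / 2 * (cmod (cnj r1 * c1 + cnj r2 * c2))\<^sup>2 +
       ((a + f 0) + b + sqrt (((a + f 0) - b)\<^sup>2 + 4 * (cmod z)\<^sup>2)) / 2 * (cmod (- r2 * c1 + r1 * c2))\<^sup>2"
    by (rule hermitian_2x2_diag[where \<alpha> = "a + f 0" and b = b and z = z]) blast
  define l where "l i y = (if i = 0 then cnj r1 * y 0 + cnj r2 * flux y else - r2 * y 0 + r1 * flux y)" for i :: nat and y
  define c1 where "c1 i = (if i = 0 then r1 else - cnj r2)" for i :: nat
  define c2 where "c2 i = (if i = 0 then r2 else cnj r1)" for i :: nat
  have r': "cnj r1 * r1 + cnj r2 * r2 = 1" "r2 * cnj r2 + r1 * cnj r1 = 1"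
    using r unfolding mult.commute[of _ "cnj _"] cnj_mult_self of_real_add[symmetric]
    by (simp_all only: add.commute of_real_1)
  show ?thesis
  proof (rule that[of l c1 c2])
    fix y
    show "(cmod (l 0 y))\<^sup>2 + (cmod (l 1 y))\<^sup>2 = (cmod (y 0))\<^sup>2 + (cmod (flux y))\<^sup>2"
    proof -
      have "(cmod (l 0 y))\<^sup>2 + (cmod (l 1 y))\<^sup>2 = ((cmod r1)\<^sup>2 + (cmod r2)\<^sup>2) * ((cmod (y 0))\<^sup>2 + (cmod (flux y))\<^sup>2)"
        unfolding cmod_power2 by (simp add: l_def algebra_simps power2_eq_square)
      then show ?thesis by (simp add: r)
    qed
    show "Re (boundary_form a z b y y) = kappa a z b 0 * (cmod (l 0 y))\<^sup>2 + kappa a z b 1 * (cmod (l 1 y))\<^sup>2"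
      unfolding boundary_diag using diag[of "y 0" "flux y"] by (simp add: kappa_def l_def)
  next
    fix i j :: nat and y
    assume "i < 2" "j < 2" "y 0 = c1 i" "flux y = c2 i"
    then show "l j y = (if i = j then 1 else 0)"
      using r' by (auto simp: l_def c1_def c2_def less_2_cases_iff)
  qed (simp_all add: l_def flux_add flux_scale algebra_simps)
qed

text \<open>
  Trial sequences with boundary data \<open>(y 0, flux y) = (c1, c2)\<close>: their coupling term is of first order in \<open>e\<close>
  and the interior terms are of second order, so the coupling wins for small \<open>e\<close>, whatever the parameter \<open>t\<close>.
\<close>

definition pull :: "real \<Rightarrow> complex \<Rightarrow> complex \<Rightarrow> nat \<Rightarrow> complex" where
  "pull e c1 c2 n = (if n = 0 then c1 else if n = 1 then of_real (e / f 0) * c1 else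
     if n = N then of_real e * c2 else if n = N + 1 then of_real e * c2 + c2 / of_real (f N) else 0)"

text \<open>The value at 1 is scaled so that f 0 * y 1 = e c1, the value at N is e c2, and the value
  at N + 1 restores the flux c2. Both halves of the coupling then carry the same sign, that of
  e.\<close>

lemma pull:
  "pull e c1 c2 \<in> seqs N" "pull e c1 c2 0 = c1" "flux (pull e c1 c2) = c2"
  "Re (coupling (pull e c1 c2) (pull e c1 c2)) = 2 * e * ((cmod c1)\<^sup>2 + (cmod c2)\<^sup>2)"
proof -
  show "pull e c1 c2 \<in> seqs N" "pull e c1 c2 0 = c1" using N by (auto simp: pull_def seqs_def)
  show fl: "flux (pull e c1 c2) = c2"
    using N f_nonzero[of N] by (simp add: flux_def fdiff_def pull_def)
  have sq: "2 * Re (cnj (of_real e * c) * c) = 2 * e * (cmod c)\<^sup>2" for c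
    by (simp add: mult.assoc cnj_mult_self)
  have eqs: "of_real (f 0) * pull e c1 c2 1 = of_real e * c1" "pull e c1 c2 N = of_real e * c2" "pull e c1 c2 0 = c1"
    using N f_nonzero[of 0] by (auto simp: pull_def)
  show "Re (coupling (pull e c1 c2) (pull e c1 c2)) = 2 * e * ((cmod c1)\<^sup>2 + (cmod c2)\<^sup>2)"
    unfolding coupling_diag fl eqs sq by (simp add: algebra_simps)
qed

lemma pull_linear:
  "pull e c1 c2 + pull e d1 d2 = pull e (c1 + d1) (c2 + d2)"
  "(\<lambda>n. c * pull e c1 c2 n) = pull e (c * c1) (c * c2)"
  by (auto simp: pull_def fun_eq_iff algebra_simps add_divide_distrib)

text \<open>All values at 1, ..., N carry a factor e, so the mass is of second order; the constant G
  does not depend on e or on the boundary data.\<close>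

lemma pull_mass_bound:
  obtains G where "\<And>e c1 c2. Re (mass (pull e c1 c2) (pull e c1 c2)) \<le> G * e\<^sup>2 * ((cmod c1)\<^sup>2 + (cmod c2)\<^sup>2)"
proof (rule that)
  fix e c1 c2
  let ?c = "(cmod c1)\<^sup>2 + (cmod c2)\<^sup>2"
  let ?K = "(1 / f 0)\<^sup>2 + 1"
  have "(cmod (pull e c1 c2 n))\<^sup>2 \<le> ?K * e\<^sup>2 * ?c" if "n \<in> {1..N}" for n
  proof -
    have "(cmod (pull e c1 c2 n))\<^sup>2 \<in> {(1 / f 0)\<^sup>2 * e\<^sup>2 * (cmod c1)\<^sup>2, 1 * e\<^sup>2 * (cmod c2)\<^sup>2, 0}"
      using that by (auto simp: pull_def norm_mult power_mult_distrib norm_divide power_divide)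
    moreover have "(1 / f 0)\<^sup>2 * e\<^sup>2 * (cmod c1)\<^sup>2 \<le> ?K * e\<^sup>2 * ?c"
      by (intro mult_mono) auto
    moreover have "1 * e\<^sup>2 * (cmod c2)\<^sup>2 \<le> ?K * e\<^sup>2 * ?c"
      by (intro mult_mono) auto
    moreover have "0 \<le> ?K * e\<^sup>2 * ?c" by (intro mult_nonneg_nonneg add_nonneg_nonneg) auto
    ultimately show ?thesis by auto
  qed
  then have "Re (mass (pull e c1 c2) (pull e c1 c2)) \<le> (\<Sum>n=1..N. w n * (?K * e\<^sup>2 * ?c))"
    unfolding mass_diag by (intro sum_mono mult_left_mono less_imp_le[OF w_pos]) auto
  then show "Re (mass (pull e c1 c2) (pull e c1 c2)) \<le> ((\<Sum>n=1..N. w n) * ?K) * e\<^sup>2 * ?c"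
    by (simp only: sum_distrib_right mult.assoc)
qed


lemma mass_boundary_eq_0:
  assumes "y \<in> seqs N" "Re (mass y y) = 0" "y 0 = 0" "flux y = 0"
  shows "y = 0"
proof -
  have y: "n \<in> {1..N} \<Longrightarrow> y n = 0" for n using assms(2) mass_eq_0_iff by blast
  have "y (N + 1) = 0"
    using assms(4) y[of N] f_nonzero[of N] N by (simp add: flux_def fdiff_def)
  then have "y n = 0" for n
    using y[of n] assms(1,3) by (cases "n = 0"; cases "n \<le> N"; cases "n = N + 1") (auto simp: seqs_def)
  then show ?thesis by (simp add: fun_eq_iff)
qed

text \<open>For s = 1 this is the pencil; for s = -1 it is the negative of the pencil at -t. Bounds
  for t near -infinity therefore cover both ends.\<close>

abbreviation signed_pencil :: "real \<Rightarrow> real \<Rightarrow> complex \<Rightarrow> real \<Rightarrow> real \<Rightarrow> (nat \<Rightarrow> complex) \<Rightarrow> (nat \<Rightarrow> complex) \<Rightarrow> complex" where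
  "signed_pencil s a z b t \<equiv> V.pencil (\<lambda>u y. of_real s * energy a z b u y) mass t"

lemma hermitian_signed: "V.hermitian (\<lambda>u y. of_real s * energy a z b u y)"
  unfolding V.hermitian_def
  by (simp add: V.hermitianD[OF hermitian_energy] algebra_simps)

lemma signed_pencil_diag:
  "Re (signed_pencil s a z b t y y) =
     s * Re (interior_form y y) - s * Re (coupling y y) + s * Re (boundary_form a z b y y) - t * Re (mass y y)"
  by (simp add: V.pencil_def energy_def algebra_simps)

text \<open>Where the eigencoordinates with nonpositive signed eigenvalue vanish, the boundary part
  is at least m times the boundary norm. Half of this pays for the boundary share of the coupling,
  and a very negative t pays for everything else, so the form is positive there.\<close>

lemma signed_pencil_upper:
  assumes s: "\<bar>s\<bar> = 1"
  obtains L where "\<And>t. t \<le> L \<Longrightarrow> V.neg_index (signed_pencil s a z b t) +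
    seq.dim (V.rad (signed_pencil s a z b t)) \<le> card {i. i < 2 \<and> s * kappa a z b i \<le> 0}"
proof -
  define I where "I = {i::nat. i < 2 \<and> s * kappa a z b i \<le> 0}"
  have finI: "finite I" by (simp add: I_def)
  obtain l :: "nat \<Rightarrow> (nat \<Rightarrow> complex) \<Rightarrow> complex" and c1 c2 :: "nat \<Rightarrow> complex" where l: "\<And>i x y. l i (x + y) = l i x + l i y" "\<And>i c y. l i (\<lambda>n. c * y n) = c * l i y"
    and lc: "\<And>y. (cmod (l 0 y))\<^sup>2 + (cmod (l 1 y))\<^sup>2 = (cmod (y 0))\<^sup>2 + (cmod (flux y))\<^sup>2"
    and bd: "\<And>y. Re (boundary_form a z b y y) = kappa a z b 0 * (cmod (l 0 y))\<^sup>2 + kappa a z b 1 * (cmod (l 1 y))\<^sup>2"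
    and dual: "\<And>i j y. i < 2 \<Longrightarrow> j < 2 \<Longrightarrow> y 0 = c1 i \<Longrightarrow> flux y = c2 i \<Longrightarrow> l j y = (if i = j then 1 else 0)"
    by (rule boundary_eigenbasis[of a z b]) blast
  \<comment> \<open>The smallest positive signed eigenvalue; the inserted 1 covers the case that
    there is none.\<close>
  define m where "m = Min (insert 1 ((\<lambda>i. s * kappa a z b i) ` ({..<2} - I)))"
  have m0: "m > 0" unfolding m_def by (subst Min_gr_iff) (auto simp: I_def)
  have m: "m \<le> s * kappa a z b i" if "i < 2" "i \<notin> I" for i
    unfolding m_def using that by (intro Min_le) auto
  obtain C1 where C1: "\<And>y. \<bar>Re (interior_form y y)\<bar> \<le> C1 * Re (mass y y)"
    using mass_bounded_interior unfolding mass_bounded_def by blast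
  obtain C2 where C2: "\<And>y. \<bar>Re (coupling y y)\<bar> \<le> C2 * Re (mass y y) + m / 2 * ((cmod (y 0))\<^sup>2 + (cmod (flux y))\<^sup>2)"
    using coupling_bound[of "m / 2"] m0 by auto
  have sge: "s * x \<ge> - \<bar>x\<bar>" "s * x \<le> \<bar>x\<bar>" for x
    using s abs_ge_minus_self[of "s * x"] abs_ge_self[of "s * x"] by (simp_all add: abs_mult)
  show ?thesis
  \<comment> \<open>C1 pays for the interior, C2 for the coupling, and the extra 1 leaves one full
    mass over.\<close>
  proof (rule that[of "- (C1 + C2 + 1)"])
    fix t assume t: "t \<le> - (C1 + C2 + 1)"
    show "V.neg_index (signed_pencil s a z b t) + seq.dim (V.rad (signed_pencil s a z b t)) \<le>
        card {i. i < 2 \<and> s * kappa a z b i \<le> 0}"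
      unfolding I_def[symmetric]
    proof (rule V.neg_index_add_rad_le_codim[where l = l])
      fix v assume v: "v \<in> seqs N" "v \<noteq> 0" and l0: "\<forall>i\<in>I. l i v = 0"
      let ?M = "Re (mass v v)" and ?c = "(cmod (v 0))\<^sup>2 + (cmod (flux v))\<^sup>2"
      have "m * (cmod (l i v))\<^sup>2 \<le> s * kappa a z b i * (cmod (l i v))\<^sup>2" if "i < 2" for i
        using m[OF that] l0 by (cases "i \<in> I") (auto intro: mult_right_mono)
      from this[of 0] this[of 1] have "m * ?c \<le> s * Re (boundary_form a z b v v)"
        unfolding bd lc[symmetric] by (simp add: algebra_simps)
      moreover have "s * Re (interior_form v v) \<ge> - (C1 * ?M)"
        using sge(1)[of "Re (interior_form v v)"] C1[of v] by linarith
      moreover have "- (s * Re (coupling v v)) \<ge> - (C2 * ?M + m / 2 * ?c)"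
        using sge(2)[of "Re (coupling v v)"] C2[of v] by linarith
      moreover have "- (t * ?M) \<ge> (C1 + C2 + 1) * ?M"
        using mult_right_mono[OF t mass_nonneg[of v]] by (simp add: algebra_simps)
      ultimately have "Re (signed_pencil s a z b t v v) \<ge> ?M + m / 2 * ?c"
        unfolding signed_pencil_diag by (simp add: algebra_simps)
      moreover have "?M + m / 2 * ?c > 0"
      proof -
        have "?M \<noteq> 0 \<or> ?c \<noteq> 0"
          using mass_boundary_eq_0[OF v(1)] v(2) by (auto simp: sum_power2_eq_zero_iff)
        moreover have "?M \<ge> 0" by (rule mass_nonneg)
        moreover have "?c \<ge> 0" by simp
        ultimately have "?M > 0 \<or> ?c > 0" by linarith
        then show ?thesis
        proof
          assume "?M > 0"
          moreover have "m / 2 * ?c \<ge> 0" using m0 by simp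
          ultimately show ?thesis by linarith
        next
          assume "?c > 0"
          then have "m / 2 * ?c > 0" using m0 by simp
          then show ?thesis using mass_nonneg[of v] by linarith
        qed
      qed
      ultimately show "Re (signed_pencil s a z b t v v) > 0" by linarith
    qed (simp_all add: finI l V.hermitian_pencil hermitian_signed hermitian_mass)
  qed
qed

text \<open>Trial sequences with boundary data in the nonpositive eigenspaces: the boundary part
  does not hurt, and the coupling of order e beats the interior and mass terms of order e^2. Zero
  eigenvalues are included, and t is arbitrary.\<close>

lemma signed_pencil_lower:
  assumes s: "\<bar>s\<bar> = 1"
  shows "card {i. i < 2 \<and> s * kappa a z b i \<le> 0} \<le> V.neg_index (signed_pencil s a z b t)"
proof -
  define I where "I = {i::nat. i < 2 \<and> s * kappa a z b i \<le> 0}"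
  have finI: "finite I" by (simp add: I_def)
  obtain l :: "nat \<Rightarrow> (nat \<Rightarrow> complex) \<Rightarrow> complex" and c1 c2 :: "nat \<Rightarrow> complex" where l: "\<And>i x y. l i (x + y) = l i x + l i y" "\<And>i c y. l i (\<lambda>n. c * y n) = c * l i y"
    and lc: "\<And>y. (cmod (l 0 y))\<^sup>2 + (cmod (l 1 y))\<^sup>2 = (cmod (y 0))\<^sup>2 + (cmod (flux y))\<^sup>2"
    and bd: "\<And>y. Re (boundary_form a z b y y) = kappa a z b 0 * (cmod (l 0 y))\<^sup>2 + kappa a z b 1 * (cmod (l 1 y))\<^sup>2"
    and dual: "\<And>i j y. i < 2 \<Longrightarrow> j < 2 \<Longrightarrow> y 0 = c1 i \<Longrightarrow> flux y = c2 i \<Longrightarrow> l j y = (if i = j then 1 else 0)"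
    by (rule boundary_eigenbasis[of a z b]) blast
  obtain C where C: "\<And>y. \<bar>Re (interior_form y y)\<bar> \<le> C * Re (mass y y)"
    using mass_bounded_interior unfolding mass_bounded_def by blast
  obtain G where G: "\<And>e c1 c2. Re (mass (pull e c1 c2) (pull e c1 c2)) \<le> G * e\<^sup>2 * ((cmod c1)\<^sup>2 + (cmod c2)\<^sup>2)"
    by (rule pull_mass_bound) blast
  define K where "K = (\<bar>C\<bar> + \<bar>t\<bar>) * \<bar>G\<bar>"
  have K: "K \<ge> 0" by (simp add: K_def)
  \<comment> \<open>K collects all constants of the second-order terms, so that K e^2 < e < 2
    e.\<close>
  define e where "e = 1 / (1 + K)"
  have e: "e > 0" "K * e < 1" using K by (simp_all add: e_def field_simps add_pos_nonneg)
  have s2: "s * (s * x) = x" for x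
    using s by (cases "s \<ge> 0") auto
  \<comment> \<open>The tilt s * e makes s times the coupling equal to 2 e times the boundary norm
    for either sign s.\<close>
  define W where "W = {pull (s * e) d1 d2 |d1 d2. \<forall>j<2. j \<notin> I \<longrightarrow> l j (pull (s * e) d1 d2) = 0}"
  have W_S: "W \<subseteq> seqs N" by (auto simp: W_def pull)
  have pull_0: "pull (s * e) 0 0 = 0" by (auto simp: pull_def fun_eq_iff)
  have l_0: "l j 0 = 0" for j using l(2)[of j 0 0] by (simp add: zero_fun_def)
  have "seq.subspace W"
    unfolding seq.subspace_def
  proof (intro conjI ballI allI)
    have "\<forall>j<2. j \<notin> I \<longrightarrow> l j (pull (s * e) 0 0) = 0" using l_0 pull_0 by simp
    then have "pull (s * e) 0 0 \<in> W" unfolding W_def by blast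
    then show "0 \<in> W" by (simp only: pull_0)
  next
    fix x y assume "x \<in> W" "y \<in> W"
    then obtain d1 d2 d1' d2' where
      x: "x = pull (s * e) d1 d2" "\<forall>j<2. j \<notin> I \<longrightarrow> l j x = 0" and
      y: "y = pull (s * e) d1' d2'" "\<forall>j<2. j \<notin> I \<longrightarrow> l j y = 0"
      unfolding W_def by blast
    have "x + y = pull (s * e) (d1 + d1') (d2 + d2')" by (simp add: x(1) y(1) pull_linear)
    moreover have "\<forall>j<2. j \<notin> I \<longrightarrow> l j (x + y) = 0" using x(2) y(2) l(1) by simp
    ultimately show "x + y \<in> W" unfolding W_def mem_Collect_eq by metis
  next
    fix c x assume "x \<in> W"
    then obtain d1 d2 where
      x: "x = pull (s * e) d1 d2" "\<forall>j<2. j \<notin> I \<longrightarrow> l j x = 0"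
      unfolding W_def by blast
    have "(\<lambda>n. c * x n) = pull (s * e) (c * d1) (c * d2)" by (simp add: x(1) pull_linear)
    moreover have "\<forall>j<2. j \<notin> I \<longrightarrow> l j (\<lambda>n. c * x n) = 0" using x(2) l(2) by simp
    ultimately show "(\<lambda>n. c * x n) \<in> W" unfolding W_def mem_Collect_eq by metis
  qed
  note W = this
  have "V.negative_on (signed_pencil s a z b t) W"
    unfolding V.negative_on_def
  proof (intro ballI impI)
    fix v assume "v \<in> W" "v \<noteq> 0"
    then obtain d1 d2 where v: "v = pull (s * e) d1 d2" and lv: "\<forall>j<2. j \<notin> I \<longrightarrow> l j v = 0"
      unfolding W_def by blast
    let ?M = "Re (mass v v)" and ?c = "(cmod d1)\<^sup>2 + (cmod d2)\<^sup>2"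
    have c0: "?c > 0"
    proof -
      have "d1 \<noteq> 0 \<or> d2 \<noteq> 0" using \<open>v \<noteq> 0\<close> v pull_0 by blast
      then show ?thesis by (simp add: sum_power2_gt_zero_iff)
    qed
    have "s * Re (coupling v v) = 2 * e * ?c"
      unfolding v pull(4) using s2[of "2 * e * ?c"] by (simp add: mult_ac)
    moreover have "s * kappa a z b i * (cmod (l i v))\<^sup>2 \<le> 0" if "i < 2" for i
      using lv that by (cases "i \<in> I") (auto simp: I_def mult_le_0_iff)
    from this[of 0] this[of 1] have "s * Re (boundary_form a z b v v) \<le> 0"
      unfolding bd by (simp add: algebra_simps)
    moreover have "s * Re (interior_form v v) - t * ?M \<le> K * e * e * ?c"
    proof -
      have "s * Re (interior_form v v) \<le> \<bar>s * Re (interior_form v v)\<bar>" by (rule abs_ge_self)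
      also have "\<dots> \<le> C * ?M" using s C by (simp add: abs_mult)
      also have "\<dots> \<le> \<bar>C\<bar> * ?M" by (intro mult_right_mono mass_nonneg) auto
      finally have "s * Re (interior_form v v) - t * ?M \<le> \<bar>C\<bar> * ?M - t * ?M" by simp
      also have "\<dots> \<le> \<bar>C\<bar> * ?M + \<bar>t\<bar> * ?M"
        using mult_right_mono[of "- t" "\<bar>t\<bar>" ?M] mass_nonneg[of v] by simp
      also have "\<dots> = (\<bar>C\<bar> + \<bar>t\<bar>) * ?M" by (simp add: algebra_simps)
      also have "?M \<le> G * (s * e)\<^sup>2 * ?c" unfolding v by (rule G)
      also have "G * (s * e)\<^sup>2 * ?c \<le> \<bar>G\<bar> * (s * e)\<^sup>2 * ?c" by (intro mult_right_mono) auto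
      also have "\<dots> = \<bar>G\<bar> * (e * e * ?c)" using s2[of "e * e"] by (auto simp: power2_eq_square mult_ac)
      finally show ?thesis by (simp add: K_def mult.assoc mult_left_mono)
    qed
    moreover have "K * e * e * ?c < 2 * e * ?c"
      using e c0 by (intro mult_strict_right_mono) auto
    ultimately show "Re (signed_pencil s a z b t v v) < 0"
      unfolding signed_pencil_diag by linarith
  qed
  from V.neg_index_ge[OF W W_S this] have "seq.dim W \<le> V.neg_index (signed_pencil s a z b t)" .
  moreover have "card I \<le> seq.dim W"
  proof -
    let ?v = "\<lambda>i. pull (s * e) (c1 i) (c2 i)"
    have dual': "l j (?v i) = (if i = j then 1 else 0)" if "i < 2" "j < 2" for i j
      by (rule dual[OF that]) (simp_all add: pull)
    have "seq.dim (seq.span (?v ` I)) = card I"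
      by (rule V.dual_family[where l = l]) (use finI l dual' in \<open>auto simp: I_def\<close>)
    moreover have "?v ` I \<subseteq> W"
      using dual' by (auto simp: W_def I_def) (metis not_le zero_neq_one)
    then have "seq.span (?v ` I) \<subseteq> W" by (intro seq.span_minimal W)
    ultimately show ?thesis using V.dim_mono[OF _ W W_S] by metis
  qed
  ultimately show ?thesis unfolding I_def by linarith
qed

end

section \<open>Counting eigenvalues\<close>

text \<open>Turns the position of an eigenvalue in the list into a count, the only kind of
  information that the index provides.\<close>

lemma sorted_nth_less_iff:
  fixes xs :: "'a::linorder list"
  assumes "sorted xs" "n < length xs"
  shows "xs ! n < t \<longleftrightarrow> n < length (filter (\<lambda>x. x < t) xs)"
  using assms
proof (induction xs arbitrary: n)
  case (Cons x xs)
  show ?case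
  proof (cases "x < t")
    case True
    then show ?thesis using Cons by (cases n) auto
  next
    case False
    have ge: "\<forall>y\<in>set (x # xs). \<not> y < t" using Cons.prems(1) False by auto
    then have "filter (\<lambda>x. x < t) (x # xs) = []" by (simp only: filter_empty_conv simp_thms)
    moreover have "\<not> (x # xs) ! n < t" using ge Cons.prems(2) nth_mem by blast
    ultimately show ?thesis by simp
  qed
qed simp

lemma sorted_concat_replicate:
  fixes xs :: "'a::linorder list"
  assumes "sorted xs"
  shows "sorted (concat (map (\<lambda>x. replicate (m x) x) xs))"
  using assms by (induction xs) (auto simp: sorted_append)

lemma length_filter_concat_replicate:
  "length (filter P (concat (map (\<lambda>x. replicate (m x) x) xs))) = (\<Sum>x\<leftarrow>xs. if P x then m x else 0)"
  by (induction xs) (auto simp: filter_replicate)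

context sl_problem
begin

section \<open>The index of the problem and its eigenvalue list\<close>

definition ind :: "real \<Rightarrow> complex \<Rightarrow> real \<Rightarrow> real \<Rightarrow> nat" where
  "ind a z b t = V.neg_index (V.pencil (energy a z b) mass t)"

definition mult_at :: "real \<Rightarrow> complex \<Rightarrow> real \<Rightarrow> real \<Rightarrow> nat" where
  "mult_at a z b t = seq.dim (V.rad (V.pencil (energy a z b) mass t))"

text \<open>Positions are counted instead of values, so a double eigenvalue counts twice.\<close>

definition nonpos :: "real \<Rightarrow> complex \<Rightarrow> real \<Rightarrow> nat" where
  "nonpos a z b = card {i. i < 2 \<and> kappa a z b i \<le> 0}"

definition nullity :: "real \<Rightarrow> complex \<Rightarrow> real \<Rightarrow> nat" where
  "nullity a z b = card {i. i < 2 \<and> kappa a z b i = 0}"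

lemma signed_pencil_1: "signed_pencil 1 a z b t = V.pencil (energy a z b) mass t"
  by (simp add: V.pencil_def)

lemma signed_pencil_minus_1: "signed_pencil (-1) a z b t = (\<lambda>u y. - V.pencil (energy a z b) mass (- t) u y)"
  by (simp add: V.pencil_def fun_eq_iff)

lemma ind_sum: "ind a z b t + V.neg_index (\<lambda>u y. - V.pencil (energy a z b) mass t u y) + mult_at a z b t = N + 2"
  using V.inertia_sum[OF V.hermitian_pencil[OF hermitian_energy hermitian_mass]] dim_seqs
  by (simp add: ind_def mult_at_def)

lemma ind_jump: "s < t \<Longrightarrow> ind a z b s + mult_at a z b s \<le> ind a z b t"
  unfolding ind_def mult_at_def
  by (rule V.pencil_neg_index_jump[OF hermitian_energy hermitian_mass mass_nonneg pencil_regular])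

lemma finite_spectrum: "finite {t. mult_at a z b t \<noteq> 0}"
  unfolding mult_at_def
  by (rule V.pencil_finite[OF hermitian_energy hermitian_mass mass_nonneg pencil_regular])

text \<open>Far to the left the upper and lower bounds for the index coincide, which supplies the
  starting value for the count.\<close>

lemma ind_count: "ind a z b t = nonpos a z b + (\<Sum>x | mult_at a z b x \<noteq> 0 \<and> x < t. mult_at a z b x)"
proof -
  obtain L where L: "\<And>t. t \<le> L \<Longrightarrow> V.neg_index (signed_pencil 1 a z b t) +
    seq.dim (V.rad (signed_pencil 1 a z b t)) \<le> card {i. i < 2 \<and> 1 * kappa a z b i \<le> 0}"
    by (rule signed_pencil_upper[of 1 a z b]) auto
  have low: "V.neg_index (V.pencil (energy a z b) mass t) = nonpos a z b" if "t \<le> L" for t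
    using L[OF that] signed_pencil_lower[of 1 a z b t] unfolding signed_pencil_1 nonpos_def by simp
  show ?thesis
    unfolding ind_def mult_at_def
    by (rule V.pencil_neg_index_count[OF hermitian_energy hermitian_mass mass_nonneg pencil_regular low])
qed

text \<open>The two bounds for s = -1 give the positive index as the number of nonnegative
  eigenvalues of the boundary matrix, with trivial radical. Subtracting from the total dimension N +
  2 gives the negative index.\<close>

lemma ind_large: "\<exists>L. \<forall>t\<ge>L. ind a z b t + nullity a z b = N + nonpos a z b"
proof -
  obtain L where L: "\<And>t. t \<le> L \<Longrightarrow> V.neg_index (signed_pencil (-1) a z b t) +
    seq.dim (V.rad (signed_pencil (-1) a z b t)) \<le> card {i. i < 2 \<and> -1 * kappa a z b i \<le> 0}"
    by (rule signed_pencil_upper[of "-1" a z b]) auto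
  have card: "card {i. i < 2 \<and> -1 * kappa a z b i \<le> 0} + nonpos a z b = 2 + nullity a z b"
  proof -
    let ?A = "{i::nat. i < 2 \<and> -1 * kappa a z b i \<le> 0}" and ?B = "{i::nat. i < 2 \<and> kappa a z b i \<le> 0}"
    have "card (?A \<union> ?B) + card (?A \<inter> ?B) = card ?A + card ?B"
      by (rule card_Un_Int[symmetric]) auto
    moreover have "?A \<union> ?B = {..<2}" by auto
    moreover have "?A \<inter> ?B = {i. i < 2 \<and> kappa a z b i = 0}" by auto
    ultimately show ?thesis unfolding nonpos_def nullity_def by simp
  qed
  have "ind a z b t + nullity a z b = N + nonpos a z b" if "- L \<le> t" for t
    using L[of "- t"] signed_pencil_lower[of "-1" a z b "- t"] ind_sum[of a z b t] card that
    unfolding signed_pencil_minus_1 by (simp add: mult_at_def)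
  then show ?thesis by blast
qed

text \<open>Beyond all eigenvalues the count of \<open>ind_count\<close> is complete and
  \<open>ind_large\<close> gives its value.\<close>

lemma sum_mult_at: "(\<Sum>x | mult_at a z b x \<noteq> 0. mult_at a z b x) + nullity a z b = N"
proof -
  obtain L where L: "\<forall>t\<ge>L. ind a z b t + nullity a z b = N + nonpos a z b" using ind_large by blast
  define t where "t = Max (insert L {t. mult_at a z b t \<noteq> 0}) + 1"
  have "x < t" if "mult_at a z b x \<noteq> 0" for x
    unfolding t_def using finite_spectrum[of a z b] that by (intro less_add_one[THEN le_less_trans[rotated]] Max_ge) auto
  then have "{x. mult_at a z b x \<noteq> 0 \<and> x < t} = {x. mult_at a z b x \<noteq> 0}" by blast
  moreover have "L \<le> t"
  proof -
    have "L \<le> Max (insert L {t. mult_at a z b t \<noteq> 0})" using finite_spectrum by (intro Max_ge) auto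
    then show ?thesis by (simp add: t_def)
  qed
  ultimately show ?thesis using L ind_count[of a z b t] by fastforce
qed

lemma multiplicity_of_eq: "multiplicity_of N f q w (pt23 a z b) (of_real t) = mult_at a z b t"
  unfolding multiplicity_of_def mult_at_def rad_pencil_eq ..

lemma eigenvalue_iff: "of_real t \<in> eigenvalues N f q w (pt23 a z b) \<longleftrightarrow> mult_at a z b t \<noteq> 0"
proof -
  have sub: "seq.subspace (V.rad (V.pencil (energy a z b) mass t))"
    by (rule V.subspace_rad[OF V.hermitian_pencil[OF hermitian_energy hermitian_mass]])
  have "mult_at a z b t = 0 \<longleftrightarrow> V.rad (V.pencil (energy a z b) mass t) = {0}"
    unfolding mult_at_def by (rule V.dim_eq_0_iff[OF sub V.rad_subset])
  moreover have "0 \<in> V.rad (V.pencil (energy a z b) mass t)" by (rule seq.subspace_0[OF sub])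
  then have "V.rad (V.pencil (energy a z b) mass t) = {0} \<longleftrightarrow> \<not> (\<exists>y\<in>V.rad (V.pencil (energy a z b) mass t). y \<noteq> 0)"
    by blast
  ultimately show ?thesis
    unfolding eigenvalues_def mem_Collect_eq rad_pencil_eq by simp
qed

lemma eigenvalues_eq: "eigenvalues N f q w (pt23 a z b) = of_real ` {t. mult_at a z b t \<noteq> 0}"
proof (intro set_eqI iffI)
  fix lam assume lam: "lam \<in> eigenvalues N f q w (pt23 a z b)"
  then obtain t where "lam = of_real t" using eigenvalues_real by (meson Reals_cases subset_iff)
  then show "lam \<in> of_real ` {t. mult_at a z b t \<noteq> 0}" using lam eigenvalue_iff by simp
qed (auto simp only: eigenvalue_iff)

lemma exactly_eigenvalues_pt23: "exactly_eigenvalues N f q w (pt23 a z b) (N - nullity a z b)"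
  unfolding exactly_eigenvalues_def
proof (intro conjI eigenvalues_real)
  show "finite (eigenvalues N f q w (pt23 a z b))"
    unfolding eigenvalues_eq using finite_spectrum by blast
  have "(\<Sum>lam\<in>eigenvalues N f q w (pt23 a z b). multiplicity_of N f q w (pt23 a z b) lam) =
      (\<Sum>x | mult_at a z b x \<noteq> 0. mult_at a z b x)"
    unfolding eigenvalues_eq by (subst sum.reindex) (auto simp: inj_on_def multiplicity_of_eq)
  then show "(\<Sum>lam\<in>eigenvalues N f q w (pt23 a z b). multiplicity_of N f q w (pt23 a z b) lam) = N - nullity a z b"
    using sum_mult_at[of a z b] by simp
qed

lemma eigenvalue_list_eq:
  "eigenvalue_list N f q w (pt23 a z b) =
     concat (map (\<lambda>x. replicate (mult_at a z b x) x) (sorted_list_of_set {x. mult_at a z b x \<noteq> 0}))"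
  unfolding eigenvalue_list_def eigenvalue_iff multiplicity_of_eq ..

lemma length_filter_eigenvalue_list:
  "length (filter P (eigenvalue_list N f q w (pt23 a z b))) = (\<Sum>x | mult_at a z b x \<noteq> 0 \<and> P x. mult_at a z b x)"
proof -
  have "length (filter P (eigenvalue_list N f q w (pt23 a z b))) =
      (\<Sum>x\<leftarrow>sorted_list_of_set {x. mult_at a z b x \<noteq> 0}. if P x then mult_at a z b x else 0)"
    unfolding eigenvalue_list_eq by (rule length_filter_concat_replicate)
  also have "\<dots> = (\<Sum>x\<in>{x. mult_at a z b x \<noteq> 0}. if P x then mult_at a z b x else 0)"
    using finite_spectrum[of a z b] by (subst sum_list_distinct_conv_sum_set) auto
  also have "\<dots> = (\<Sum>x | mult_at a z b x \<noteq> 0 \<and> P x. mult_at a z b x)"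
    using finite_spectrum[of a z b] by (subst sum.inter_filter[symmetric]) auto
  finally show ?thesis .
qed

lemma eig_defined_iff: "eig_defined N f q w n (pt23 a z b) \<longleftrightarrow> n + nullity a z b < N"
  using length_filter_eigenvalue_list[of "\<lambda>_. True" a z b] sum_mult_at[of a z b]
  unfolding eig_defined_def by auto

lemma eig_less_iff:
  assumes "n + nullity a z b < N"
  shows "eig N f q w n (pt23 a z b) < t \<longleftrightarrow> n + nonpos a z b < ind a z b t"
proof -
  have "sorted (eigenvalue_list N f q w (pt23 a z b))"
    unfolding eigenvalue_list_eq by (intro sorted_concat_replicate sorted_list_of_set.sorted_sorted_key_list_of_set)
  moreover have "n < length (eigenvalue_list N f q w (pt23 a z b))"
    using assms unfolding eig_defined_iff[symmetric] eig_defined_def .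
  ultimately show ?thesis
    unfolding eig_def ind_count[of a z b t] by (simp add: sorted_nth_less_iff length_filter_eigenvalue_list)
qed

section \<open>Limits and monotonicity of eigenvalues\<close>

lemma ind_eventually_ge:
  assumes "(A \<longlongrightarrow> a) F" "(Z \<longlongrightarrow> z) F" "(B \<longlongrightarrow> b) F"
  shows "\<forall>\<^sub>F x in F. ind a z b t \<le> ind (A x) (Z x) (B x) t"
    and "t < t' \<Longrightarrow> \<forall>\<^sub>F x in F. ind (A x) (Z x) (B x) t \<le> ind a z b t'"
proof -
  note herm = V.hermitian_pencil[OF hermitian_energy hermitian_mass]
  have lim: "((\<lambda>x. V.pencil (energy (A x) (Z x) (B x)) mass t u y) \<longlongrightarrow> V.pencil (energy a z b) mass t u y) F" for u y
    unfolding V.pencil_def energy_def boundary_form_def by (intro tendsto_intros assms)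
  show "\<forall>\<^sub>F x in F. ind a z b t \<le> ind (A x) (Z x) (B x) t"
    unfolding ind_def by (rule V.neg_index_lower_semicontinuous[OF herm herm lim])
  assume t: "t < t'"
  \<comment> \<open>Semicontinuity of the positive index bounds the nearby negative index by
    \<open>ind + mult_at\<close> of the limit at t; the jump inequality replaces this by
    \<open>ind\<close> at the later t'.\<close>
  have "\<forall>\<^sub>F x in F. V.neg_index (\<lambda>u y. - V.pencil (energy a z b) mass t u y) \<le>
      V.neg_index (\<lambda>u y. - V.pencil (energy (A x) (Z x) (B x)) mass t u y)"
    by (intro V.neg_index_lower_semicontinuous V.hermitian_uminus herm tendsto_minus lim)
  then show "\<forall>\<^sub>F x in F. ind (A x) (Z x) (B x) t \<le> ind a z b t'"
  proof eventually_elim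
    case (elim x)
    then show ?case
      using ind_sum[of a z b t] ind_sum[of "A x" "Z x" "B x" t] ind_jump[OF t, of a z b] by linarith
  qed
qed

text \<open>In the criterion \<open>eig_less_iff\<close> only n plus \<open>nonpos\<close> matters.
  If \<open>nonpos\<close> is smaller by s nearby, the n-th eigenvalue there is governed by the
  threshold of the (n - s)-th one at the limit.\<close>

lemma eig_tendsto:
  assumes lim: "(A \<longlongrightarrow> a) F" "(Z \<longlongrightarrow> z) F" "(B \<longlongrightarrow> b) F"
    and np: "\<forall>\<^sub>F x in F. nonpos (A x) (Z x) (B x) + s = nonpos a z b"
    and def: "\<forall>\<^sub>F x in F. n + nullity (A x) (Z x) (B x) < N"
    and n: "s \<le> n" "n - s + nullity a z b < N"
  shows "((\<lambda>x. eig N f q w n (pt23 (A x) (Z x) (B x))) \<longlongrightarrow> eig N f q w (n - s) (pt23 a z b)) F"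
proof (rule order_tendstoI)
  fix t assume t: "t < eig N f q w (n - s) (pt23 a z b)"
  \<comment> \<open>The upper bound for the nearby index is available only with a strictly later
    parameter on the limit side; t1 also makes the conclusion strict.\<close>
  obtain t1 where t1: "t < t1" "t1 < eig N f q w (n - s) (pt23 a z b)" using dense t by blast
  then have le: "ind a z b (eig N f q w (n - s) (pt23 a z b)) \<le> n - s + nonpos a z b"
    using eig_less_iff[OF n(2)] by (meson less_irrefl not_le)
  show "\<forall>\<^sub>F x in F. t < eig N f q w n (pt23 (A x) (Z x) (B x))"
    using ind_eventually_ge(2)[OF lim t1(2)] np def
  proof eventually_elim
    case (elim x)
    then have "\<not> n + nonpos (A x) (Z x) (B x) < ind (A x) (Z x) (B x) t1"
      using le n(1) by linarith
    then have "\<not> eig N f q w n (pt23 (A x) (Z x) (B x)) < t1"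
      using eig_less_iff elim(3) by blast
    then show ?case using t1 by simp
  qed
next
  fix t assume t: "eig N f q w (n - s) (pt23 a z b) < t"
  show "\<forall>\<^sub>F x in F. eig N f q w n (pt23 (A x) (Z x) (B x)) < t"
    using ind_eventually_ge(1)[OF lim, of t] np def
  proof eventually_elim
    case (elim x)
    then show ?case
      using t n(1) unfolding eig_less_iff[OF n(2)] eig_less_iff[OF elim(3)] by linarith
  qed
qed

text \<open>For every t the limit index is at least its \<open>nonpos\<close>, and this persists
  nearby. The threshold n + \<open>nonpos\<close> lies below it, whatever t is.\<close>

lemma eig_at_bot:
  assumes lim: "(A \<longlongrightarrow> a) F" "(Z \<longlongrightarrow> z) F" "(B \<longlongrightarrow> b) F"
    and np: "\<forall>\<^sub>F x in F. nonpos (A x) (Z x) (B x) + n < nonpos a z b"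
    and def: "\<forall>\<^sub>F x in F. n + nullity (A x) (Z x) (B x) < N"
  shows "filterlim (\<lambda>x. eig N f q w n (pt23 (A x) (Z x) (B x))) at_bot F"
  unfolding filterlim_at_bot_dense
proof
  fix t
  show "\<forall>\<^sub>F x in F. eig N f q w n (pt23 (A x) (Z x) (B x)) < t"
    using ind_eventually_ge(1)[OF lim, of t] np def
  proof eventually_elim
    case (elim x)
    then show ?case
      using ind_count[of a z b t] unfolding eig_less_iff[OF elim(3)] by linarith
  qed
qed

text \<open>The limit index never exceeds N + \<open>nonpos\<close> - \<open>nullity\<close>, so the
  threshold nearby is not passed at any fixed t.\<close>

lemma eig_at_top:
  assumes lim: "(A \<longlongrightarrow> a) F" "(Z \<longlongrightarrow> z) F" "(B \<longlongrightarrow> b) F"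
    and np: "\<forall>\<^sub>F x in F. N + nonpos a z b \<le> nonpos (A x) (Z x) (B x) + n + nullity a z b"
    and def: "\<forall>\<^sub>F x in F. n + nullity (A x) (Z x) (B x) < N"
  shows "filterlim (\<lambda>x. eig N f q w n (pt23 (A x) (Z x) (B x))) at_top F"
  unfolding filterlim_at_top
proof
  fix t
  have "(\<Sum>x | mult_at a z b x \<noteq> 0 \<and> x < t + 1. mult_at a z b x) \<le> (\<Sum>x | mult_at a z b x \<noteq> 0. mult_at a z b x)"
    using finite_spectrum[of a z b] by (intro sum_mono2) auto
  then have le: "ind a z b (t + 1) + nullity a z b \<le> N + nonpos a z b"
    using ind_count[of a z b "t + 1"] sum_mult_at[of a z b] by linarith
  have "t < t + 1" by simp
  from ind_eventually_ge(2)[OF lim this] np def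
  show "\<forall>\<^sub>F x in F. t \<le> eig N f q w n (pt23 (A x) (Z x) (B x))"
  proof eventually_elim
    case (elim x)
    then have "\<not> eig N f q w n (pt23 (A x) (Z x) (B x)) < t"
      using le unfolding eig_less_iff[OF elim(3)] by linarith
    then show ?case by simp
  qed
qed

text \<open>A larger boundary form lowers the index at each t, and equal \<open>nonpos\<close> keeps
  the thresholds equal. The contradiction comes from testing at t equal to the first eigenvalue,
  which is not below itself.\<close>

lemma eig_mono_form:
  assumes le: "\<And>y. Re (boundary_form a z b y y) \<le> Re (boundary_form a' z' b' y y)"
    and np: "nonpos a z b = nonpos a' z' b'"
    and def: "n + nullity a z b < N" "n + nullity a' z' b' < N"
  shows "eig N f q w n (pt23 a z b) \<le> eig N f q w n (pt23 a' z' b')"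
proof (rule ccontr)
  assume "\<not> ?thesis"
  then have "n + nonpos a' z' b' < ind a' z' b' (eig N f q w n (pt23 a z b))"
    unfolding eig_less_iff[OF def(2), symmetric] by (simp only: not_le)
  also have "\<dots> \<le> ind a z b (eig N f q w n (pt23 a z b))"
    unfolding ind_def
    by (rule V.neg_index_antimono) (use le in \<open>simp add: V.pencil_def energy_def\<close>)
  finally show False
    using eig_less_iff[OF def(1)] np by (metis less_irrefl)
qed


section \<open>Inertia of the boundary matrix on the pieces of the chart\<close>

lemma card_less_2: "card {i::nat. i < 2 \<and> P i} = (if P 0 then 1 else 0) + (if P 1 then 1 else 0)"
proof -
  have "{i::nat. i < 2 \<and> P i} = (if P 0 then {0} else {}) \<union> (if P 1 then {1} else {})"
    using less_2_cases by (cases "P 0"; cases "P 1") auto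
  then show ?thesis by simp
qed

lemma kappa_le: "kappa a z b 0 \<le> kappa a z b 1"
  by (simp add: kappa_def)

lemma kappa_sum: "kappa a z b 0 + kappa a z b 1 = a + f 0 + b"
  by (simp add: kappa_def field_simps)

text \<open>The determinant; \<open>kappa_sum\<close> is the trace. Their signs fix the signs of
  both eigenvalues on each piece.\<close>

lemma kappa_prod: "kappa a z b 0 * kappa a z b 1 = d23 (f 0) a z b"
proof -
  define \<delta> where "\<delta> = sqrt (((a + f 0) - b)\<^sup>2 + 4 * (cmod z)\<^sup>2)"
  have "\<delta>\<^sup>2 = ((a + f 0) - b)\<^sup>2 + 4 * (cmod z)\<^sup>2"
    unfolding \<delta>_def by (rule real_sqrt_pow2) simp
  moreover have "kappa a z b 0 * kappa a z b 1 = ((a + f 0 + b)\<^sup>2 - \<delta>\<^sup>2) / 4"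
    unfolding kappa_def \<delta>_def[symmetric] by (simp add: power2_eq_square field_simps)
  ultimately show ?thesis by (simp add: d23_def power2_eq_square field_simps)
qed

lemma inertia_neg:
  assumes "d23 (f 0) a z b < 0"
  shows "nonpos a z b = 1" "nullity a z b = 0"
proof -
  have "kappa a z b 0 < 0" "kappa a z b 1 > 0"
    using assms kappa_le[of a z b] unfolding kappa_prod[symmetric] by (auto simp: mult_less_0_iff)
  then show "nonpos a z b = 1" "nullity a z b = 0"
    by (simp_all add: nonpos_def nullity_def card_less_2)
qed

lemma inertia_pos_r:
  assumes "d23 (f 0) a z b > 0" "a + f 0 \<ge> 0" "b \<ge> 0"
  shows "nonpos a z b = 0" "nullity a z b = 0"
proof -
  have "kappa a z b 0 > 0" "kappa a z b 1 > 0"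
    using assms kappa_le[of a z b] kappa_sum[of a z b]
    unfolding kappa_prod[symmetric] by (auto simp: zero_less_mult_iff)
  then show "nonpos a z b = 0" "nullity a z b = 0"
    by (simp_all add: nonpos_def nullity_def card_less_2)
qed

lemma inertia_pos_l:
  assumes "d23 (f 0) a z b > 0" "a + f 0 \<le> 0" "b \<le> 0"
  shows "nonpos a z b = 2" "nullity a z b = 0"
proof -
  have "kappa a z b 0 < 0" "kappa a z b 1 < 0"
    using assms kappa_le[of a z b] kappa_sum[of a z b]
    unfolding kappa_prod[symmetric] by (auto simp: zero_less_mult_iff)
  then show "nonpos a z b = 2" "nullity a z b = 0"
    by (simp_all add: nonpos_def nullity_def card_less_2)
qed

lemma inertia_zero_r:
  assumes "d23 (f 0) a z b = 0" "a + f 0 + b > 0"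
  shows "nonpos a z b = 1" "nullity a z b = 1"
proof -
  have "kappa a z b 0 = 0" "kappa a z b 1 > 0"
    using assms kappa_le[of a z b] kappa_sum[of a z b]
    unfolding kappa_prod[symmetric] by auto
  then show "nonpos a z b = 1" "nullity a z b = 1"
    by (simp_all add: nonpos_def nullity_def card_less_2)
qed

lemma inertia_zero_l:
  assumes "d23 (f 0) a z b = 0" "a + f 0 + b < 0"
  shows "nonpos a z b = 2" "nullity a z b = 1"
proof -
  have "kappa a z b 0 < 0" "kappa a z b 1 = 0"
    using assms kappa_le[of a z b] kappa_sum[of a z b]
    unfolding kappa_prod[symmetric] by auto
  then show "nonpos a z b = 2" "nullity a z b = 1"
    by (simp_all add: nonpos_def nullity_def card_less_2)
qed

lemma inertia_C: "nonpos (- f 0) 0 0 = 2" "nullity (- f 0) 0 0 = 2"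
  by (simp_all add: nonpos_def nullity_def card_less_2 kappa_def)

end

section \<open>Coordinates on the space of boundary conditions\<close>

definition bcmat :: "real \<Rightarrow> complex \<Rightarrow> real \<Rightarrow> complex^4^2" where
  "bcmat a z b = vector [vector [of_real a, -1, 0, cnj z], vector [z, 0, -1, of_real b]]"

lemma pt23_bcmat: "pt23 a z b = GL_class (bcmat a z b)"
  by (simp add: pt23_def bcmat_def)

text \<open>Columns 2 and 3 form minus the identity.\<close>

lemma full_rank_bcmat: "bcmat a z b \<in> full_rank"
proof -
  let ?X = "bcmat a z b"
  have r: "row 1 ?X $ 2 = -1" "row 1 ?X $ 3 = 0" "row 2 ?X $ 2 = 0" "row 2 ?X $ 3 = -1"
    by (simp_all add: row_def bcmat_def)
  have ne: "row 1 ?X \<noteq> row 2 ?X" using r by (metis neg_equal_0_iff_equal zero_neq_one)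
  have "row 1 ?X \<notin> vec.span {row 2 ?X}"
  proof
    assume "row 1 ?X \<in> vec.span {row 2 ?X}"
    then obtain k where "row 1 ?X = k *s row 2 ?X" unfolding vec.span_singleton by blast
    then have "row 1 ?X $ 2 = k * row 2 ?X $ 2" by simp
    then show False by (simp add: r)
  qed
  moreover have "row 2 ?X \<noteq> 0" using r(4) by auto
  ultimately have ind: "vec.independent {row 1 ?X, row 2 ?X}"
    using ne by (simp add: vec.independent_insert)
  have "rows ?X = {row 1 ?X, row 2 ?X}"
    unfolding rows_def UNIV_2 by auto
  then have "vec.dim (rows ?X) = card {row 1 ?X, row 2 ?X}"
    using vec.dim_eq_card_independent[OF ind] by metis
  then show ?thesis
    using ne by (simp add: full_rank_def row_rank_def_gen)
qed

lemma pt23_in_BC: "pt23 a z b \<in> BC"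
proof -
  let ?X = "bcmat a z b"
  have "lblock ?X ** Jmat ** cadjoint (lblock ?X) = rblock ?X ** Jmat ** cadjoint (rblock ?X)"
    by (simp add: vec_eq_iff forall_2 matrix_matrix_mult_def sum_2 lblock_def rblock_def Jmat_def
        cadjoint_def map_matrix_def transpose_def bcmat_def)
  then show ?thesis
    unfolding BC_def pt23_bcmat using full_rank_bcmat by blast
qed

text \<open>Pluecker coordinates: left multiplication by T scales all of them by
  \<open>det T\<close>, so their ratios are functions of the class.\<close>

definition minor2 :: "4 \<Rightarrow> 4 \<Rightarrow> complex^4^2 \<Rightarrow> complex" where
  "minor2 i j X = X $ 1 $ i * X $ 2 $ j - X $ 1 $ j * X $ 2 $ i"

lemma minor2_mult: "minor2 i j (T ** X) = det T * minor2 i j X"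
  by (simp add: minor2_def matrix_matrix_mult_def sum_2 det_2 algebra_simps)

text \<open>Cramer's rule: on the normal form \<open>bcmat a z b\<close> these ratios are the coordinates \<open>(a, z, b)\<close>.\<close>

definition minor_coords :: "complex^4^2 \<Rightarrow> real \<times> complex \<times> real" where
  "minor_coords X = (- Re (minor2 1 3 X / minor2 2 3 X), minor2 1 2 X / minor2 2 3 X, - Re (minor2 2 4 X / minor2 2 3 X))"

lemma minor_coords_mult:
  assumes "invertible T"
  shows "minor_coords (T ** X) = minor_coords X" "minor2 2 3 (T ** X) = 0 \<longleftrightarrow> minor2 2 3 X = 0"
proof -
  have "det T \<noteq> 0" using assms invertible_det_nz by blast
  then show "minor_coords (T ** X) = minor_coords X" "minor2 2 3 (T ** X) = 0 \<longleftrightarrow> minor2 2 3 X = 0"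
    by (simp_all add: minor_coords_def minor2_mult)
qed

lemma minor_coords_bcmat: "minor2 2 3 (bcmat a z b) = 1" "minor_coords (bcmat a z b) = (a, z, b)"
  by (simp_all add: minor_coords_def minor2_def bcmat_def)

text \<open>Any representative gives the same value, since \<open>minor_coords\<close> is invariant
  under invertible left factors.\<close>

definition coords :: "(complex^4^2) set \<Rightarrow> real \<times> complex \<times> real" where
  "coords \<A> = minor_coords (SOME X. X \<in> \<A>)"

lemma coords_pt23: "coords (pt23 a z b) = (a, z, b)"
proof -
  have "(SOME X. X \<in> pt23 a z b) \<in> pt23 a z b"
    unfolding pt23_bcmat by (rule someI[of _ "bcmat a z b"]) (rule GL_class_self)
  then obtain T where "invertible T" "(SOME X. X \<in> pt23 a z b) = T ** bcmat a z b"
    unfolding pt23_bcmat GL_class_def by blast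
  then show ?thesis
    by (simp add: coords_def minor_coords_mult minor_coords_bcmat)
qed

lemma pt23_inject: "pt23 a z b = pt23 a' z' b' \<longleftrightarrow> a = a' \<and> z = z' \<and> b = b'"
  using coords_pt23 by (metis prod.inject)

lemma GL_class_mult_subset:
  assumes "invertible T"
  shows "GL_class (T ** X) \<subseteq> GL_class X"
proof
  fix Y assume "Y \<in> GL_class (T ** X)"
  then obtain R where "invertible R" "Y = R ** (T ** X)" unfolding GL_class_def by blast
  then have "invertible (R ** T)" "Y = (R ** T) ** X"
    using assms by (simp_all add: invertible_mult matrix_mul_assoc)
  then show "Y \<in> GL_class X" unfolding GL_class_def by blast
qed

lemma GL_class_mult:
  assumes "invertible T"
  shows "GL_class (T ** X) = GL_class X"
proof (rule antisym[OF GL_class_mult_subset[OF assms]])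
  obtain R where R: "T ** R = mat 1" "R ** T = mat 1" using assms unfolding invertible_def by blast
  then have "invertible R" unfolding invertible_def by blast
  from GL_class_mult_subset[OF this, of "T ** X"] show "GL_class X \<subseteq> GL_class (T ** X)"
    by (simp add: matrix_mul_assoc R(2))
qed

lemma Cpt_eq_pt23:
  assumes "f0 \<noteq> 0"
  shows "Cpt f0 = pt23 (- f0) 0 0"
proof -
  let ?Y = "vector [vector [1, 1 / of_real f0, 0, 0], vector [0, 0, 1, 0]] :: complex^4^2"
  \<comment> \<open>The row factors -f0 and -1 produce the entries -1 in columns 2 and 3 that the
    normal form requires.\<close>
  let ?T = "vector [vector [- of_real f0, 0], vector [0, -1]] :: complex^2^2"
  have eq: "bcmat (- f0) 0 0 = ?T ** ?Y"
    using assms by (simp add: vec_eq_iff forall_2 forall_4 matrix_matrix_mult_def sum_2 bcmat_def)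
  have "det ?T \<noteq> 0" using assms by (simp add: det_2)
  then have T: "invertible ?T" by (simp add: invertible_det_nz)
  have "Cpt f0 = GL_class ?Y" by (simp add: Cpt_def)
  also have "\<dots> = GL_class (?T ** ?Y)" by (rule GL_class_mult[OF T, symmetric])
  finally show ?thesis unfolding pt23_bcmat eq .
qed

lemma minor2_continuous: "continuous_on UNIV (minor2 i j)"
  unfolding minor2_def by (intro continuous_intros)

text \<open>The set W of matrices is open and invariant under left multiplication by invertible
  matrices, so its classes form an open set of the quotient. They need not be self-adjoint, hence
  the claim concerns points \<open>pt23 a z b\<close> only.\<close>

lemma openin_coords:
  assumes "open V"
  shows "\<exists>U. openin quotient_top U \<and> (\<forall>a z b. pt23 a z b \<in> U \<longleftrightarrow> (a, z, b) \<in> V)"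
proof -
  define W where "W = {X. minor2 2 3 X \<noteq> 0 \<and> minor_coords X \<in> V}"
  have nz: "{X. minor2 2 3 X \<noteq> 0} = minor2 2 3 -` (- {0})" by auto
  have open_nz: "open {X. minor2 2 3 X \<noteq> 0}"
    unfolding nz using minor2_continuous by (intro open_vimage) auto
  have "continuous_on {X. minor2 2 3 X \<noteq> 0} minor_coords"
    unfolding minor_coords_def
    by (intro continuous_intros continuous_on_subset[OF minor2_continuous]) auto
  then have "open ({X. minor2 2 3 X \<noteq> 0} \<inter> minor_coords -` V)"
    using open_nz assms continuous_open_preimage by blast
  then have openW: "open W" by (simp add: W_def Int_def)
  have inv: "T ** X \<in> W \<longleftrightarrow> X \<in> W" if "invertible T" for T X
    using minor_coords_mult[OF that] by (simp add: W_def)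
  \<comment> \<open>Saturation of W: membership of a class does not depend on the
    representative.\<close>
  have mem: "GL_class X \<in> GL_class ` (full_rank \<inter> W) \<longleftrightarrow> X \<in> W" if "X \<in> full_rank" for X
  proof
    assume "GL_class X \<in> GL_class ` (full_rank \<inter> W)"
    then obtain Y where "Y \<in> W" "GL_class X = GL_class Y" by blast
    then have "X \<in> GL_class Y" using GL_class_self[of X] by simp
    then obtain T where "invertible T" "X = T ** Y" unfolding GL_class_def by blast
    then show "X \<in> W" using \<open>Y \<in> W\<close> inv by simp
  qed (use that in blast)
  have "{X \<in> full_rank. GL_class X \<in> GL_class ` (full_rank \<inter> W)} = full_rank \<inter> W"
    using mem by blast
  then have "openin quotient_top (GL_class ` (full_rank \<inter> W))"
    unfolding openin_quotient_top using openW by (auto intro: openin_open_Int)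
  moreover have "pt23 a z b \<in> GL_class ` (full_rank \<inter> W) \<longleftrightarrow> (a, z, b) \<in> V" for a z b
    unfolding pt23_bcmat mem[OF full_rank_bcmat] by (simp add: W_def minor_coords_bcmat)
  ultimately show ?thesis by blast
qed

lemma topspace_BC_top: "O23 \<subseteq> topspace BC_top"
proof -
  have "openin quotient_top (GL_class ` full_rank)"
  proof -
    have "{X \<in> full_rank. GL_class X \<in> GL_class ` full_rank} = full_rank" by blast
    then show ?thesis unfolding openin_quotient_top by simp
  qed
  then have "GL_class ` full_rank \<subseteq> topspace quotient_top" by (rule openin_subset)
  moreover have "BC \<subseteq> GL_class ` full_rank" by (auto simp: BC_def)
  ultimately have "BC \<subseteq> topspace BC_top"
    unfolding BC_top_def topspace_subtopology by blast
  then show ?thesis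
    using pt23_in_BC by (auto simp: O23_def)
qed

lemma coords_tendsto:
  assumes "S \<subseteq> O23"
  shows "(coords \<longlongrightarrow> (a, z, b)) (approach (pt23 a z b) S)"
proof (rule topological_tendstoI)
  fix V assume V: "open V" "(a, z, b) \<in> V"
  obtain U where U: "openin quotient_top U" "\<And>a z b. pt23 a z b \<in> U \<longleftrightarrow> (a, z, b) \<in> V"
    using openin_coords[OF V(1)] by blast
  have "openin BC_top (U \<inter> BC)"
    unfolding BC_top_def openin_subtopology using U(1) by blast
  moreover have "pt23 a z b \<in> U \<inter> BC" using U(2) V(2) pt23_in_BC by blast
  moreover have "coords x \<in> V" if x: "x \<in> U \<inter> BC" "x \<in> S" for x
  proof -
    obtain a z b where "x = pt23 a z b" using x(2) assms unfolding O23_def by blast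
    then show ?thesis using U(2) x(1) coords_pt23 by simp
  qed
  ultimately show "\<forall>\<^sub>F x in approach (pt23 a z b) S. coords x \<in> V"
    unfolding approach_def eventually_atin_within by blast
qed

lemma eventually_approach_mem: "\<forall>\<^sub>F x in approach \<A> S. x \<in> S"
  unfolding approach_def eventually_atin_within by (metis openin_topspace)

lemma bcmat_tendsto:
  assumes "(A \<longlongrightarrow> a) F" "(Z \<longlongrightarrow> z) F" "(B \<longlongrightarrow> b) F"
  shows "((\<lambda>x. bcmat (A x) (Z x) (B x)) \<longlongrightarrow> bcmat a z b) F"
proof (rule vec_tendstoI, rule vec_tendstoI)
  fix i :: 2 and j :: 4
  show "((\<lambda>x. bcmat (A x) (Z x) (B x) $ i $ j) \<longlongrightarrow> bcmat a z b $ i $ j) F"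
    using exhaust_2[of i] exhaust_4[of j] assms tendsto_of_real[OF assms(1)] tendsto_of_real[OF assms(3)]
      tendsto_cnj[OF assms(2)]
    by (auto simp: bcmat_def)
qed

text \<open>A curve in S that tends to the point without hitting it enters every neighbourhood. An
  open set of classes is pulled back to an open set of matrices and tested along the continuous
  normal form. Needed so that limits within S are unique.\<close>

lemma approach_nontrivial:
  assumes lim: "(A \<longlongrightarrow> a) F" "(Z \<longlongrightarrow> z) F" "(B \<longlongrightarrow> b) F" and F: "F \<noteq> bot"
    and S: "\<forall>\<^sub>F x in F. pt23 (A x) (Z x) (B x) \<in> S \<and> pt23 (A x) (Z x) (B x) \<noteq> pt23 a z b"
  shows "approach (pt23 a z b) S \<noteq> bot"
proof
  assume "approach (pt23 a z b) S = bot"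
  then have "\<forall>\<^sub>F x in approach (pt23 a z b) S. False" by simp
  moreover have "pt23 a z b \<in> topspace BC_top" using topspace_BC_top by (auto simp: O23_def)
  ultimately obtain T where T: "openin BC_top T" "pt23 a z b \<in> T" "\<forall>x\<in>T. x \<in> S \<and> x \<noteq> pt23 a z b \<longrightarrow> False"
    unfolding approach_def eventually_atin_within by blast
  obtain U where U: "openin quotient_top U" "T = U \<inter> BC"
    using T(1) unfolding BC_top_def openin_subtopology by blast
  obtain W where W: "open W" "{X \<in> full_rank. GL_class X \<in> U} = full_rank \<inter> W"
    using U(1) unfolding openin_quotient_top openin_open by blast
  have mem: "pt23 a z b \<in> T \<longleftrightarrow> bcmat a z b \<in> W" for a z b
    using W(2) full_rank_bcmat pt23_in_BC unfolding U(2) pt23_bcmat by blast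
  have "\<forall>\<^sub>F x in F. bcmat (A x) (Z x) (B x) \<in> W"
    using topological_tendstoD[OF bcmat_tendsto[OF lim] W(1)] T(2) mem by blast
  with S have "\<forall>\<^sub>F x in F. False"
    by eventually_elim (use T(3) mem in blast)
  then show False using F by (simp add: trivial_limit_def)
qed

section \<open>Limits at the singular cone\<close>

lemma approach_mono:
  assumes "S \<subseteq> T"
  shows "approach \<A> S \<le> approach \<A> T"
  unfolding le_filter_def approach_def eventually_atin_within using assms by blast

text \<open>Continuity refers to the topology of \<open>O23\<close>; its punctured-neighbourhood
  filter is \<open>approach\<close> within \<open>O23\<close>, which a smaller set only
  refines.\<close>

lemma eig_continuous_atD:
  assumes "eig_continuous_at N f q w n \<A>" "S \<subseteq> O23"
  shows "(eig N f q w n \<longlongrightarrow> eig N f q w n \<A>) (approach \<A> S)"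
proof -
  have "topcontinuous_at (subtopology BC_top O23) euclideanreal (eig N f q w n) \<A>"
    using assms(1) by (simp add: eig_continuous_at_def)
  then have "\<A> \<in> topspace (subtopology BC_top O23)"
    and lim: "limitin euclideanreal (eig N f q w n) (eig N f q w n \<A>) (atin (subtopology BC_top O23) \<A>)"
    unfolding topcontinuous_at_atin by blast+
  then have "\<A> \<in> O23" by simp
  have "(eig N f q w n \<longlongrightarrow> eig N f q w n \<A>) (approach \<A> O23)"
    using lim unfolding approach_def atin_subtopology_within[OF \<open>\<A> \<in> O23\<close>] limitin_canonical_iff .
  then show ?thesis using approach_mono[OF assms(2)] tendsto_mono by blast
qed

lemma eig_continuous_onI:
  assumes S: "S \<subseteq> O23" and "\<And>\<A>. \<A> \<in> S \<Longrightarrow> eig_defined N f q w n \<A>"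
    and lim: "\<And>\<A>. \<A> \<in> S \<Longrightarrow> (eig N f q w n \<longlongrightarrow> eig N f q w n \<A>) (approach \<A> S)"
  shows "eig_continuous_on N f q w n S"
  unfolding eig_continuous_on_def continuous_map_atin
  using assms(2) lim by (auto simp: atin_subtopology_within approach_def)

text \<open>On the cone (a + f0) b = |z|^2 is nonnegative, so the diagonal entries never have
  opposite signs. The sign of the trace then separates the two nappes, and trace zero forces the
  whole matrix to vanish, which is the vertex.\<close>

lemma pt23_mem:
  assumes "f0 \<noteq> 0"
  shows "pt23 a z b \<in> B23 f0 \<longleftrightarrow> d23 f0 a z b = 0"
    "pt23 a z b \<in> B23_neg f0 \<longleftrightarrow> d23 f0 a z b < 0"
    "pt23 a z b \<in> B23r_pos f0 \<longleftrightarrow> d23 f0 a z b > 0 \<and> a + f0 \<ge> 0 \<and> b \<ge> 0"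
    "pt23 a z b \<in> B23l_pos f0 \<longleftrightarrow> d23 f0 a z b > 0 \<and> a + f0 \<le> 0 \<and> b \<le> 0"
    "pt23 a z b \<in> B23r f0 \<longleftrightarrow> d23 f0 a z b = 0 \<and> a + f0 + b > 0"
    "pt23 a z b \<in> B23l f0 \<longleftrightarrow> d23 f0 a z b = 0 \<and> a + f0 + b < 0"
    "pt23 a z b = Cpt f0 \<longleftrightarrow> d23 f0 a z b = 0 \<and> a + f0 + b = 0"
proof -
  show "pt23 a z b \<in> B23 f0 \<longleftrightarrow> d23 f0 a z b = 0"
    "pt23 a z b \<in> B23_neg f0 \<longleftrightarrow> d23 f0 a z b < 0"
    "pt23 a z b \<in> B23r_pos f0 \<longleftrightarrow> d23 f0 a z b > 0 \<and> a + f0 \<ge> 0 \<and> b \<ge> 0"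
    "pt23 a z b \<in> B23l_pos f0 \<longleftrightarrow> d23 f0 a z b > 0 \<and> a + f0 \<le> 0 \<and> b \<le> 0"
    by (auto simp: B23_def B23_neg_def B23r_pos_def B23l_pos_def pt23_inject)
  have C: "pt23 a z b = Cpt f0 \<longleftrightarrow> a + f0 = 0 \<and> z = 0 \<and> b = 0"
    unfolding Cpt_eq_pt23[OF assms] pt23_inject by auto
  have prod: "(a + f0) * b \<ge> 0" if "d23 f0 a z b = 0"
    using that by (simp add: d23_def)
  show C': "pt23 a z b = Cpt f0 \<longleftrightarrow> d23 f0 a z b = 0 \<and> a + f0 + b = 0"
  proof
    assume "d23 f0 a z b = 0 \<and> a + f0 + b = 0"
    then have b: "b = - (a + f0)" and d: "d23 f0 a z b = 0" by auto
    have "(a + f0)\<^sup>2 + (cmod z)\<^sup>2 = 0"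
      using d unfolding b d23_def by (simp add: power2_eq_square algebra_simps)
    then have "a + f0 = 0 \<and> z = 0" by (simp add: sum_power2_eq_zero_iff)
    then show "pt23 a z b = Cpt f0" using b C by simp
  qed (simp add: C d23_def)
  have sign: "(a + f0 \<ge> 0 \<and> b \<ge> 0) \<or> (a + f0 \<le> 0 \<and> b \<le> 0)" if "d23 f0 a z b = 0"
    using prod[OF that] by (simp add: zero_le_mult_iff)
  have r: "pt23 a z b \<in> B23r f0 \<longleftrightarrow> d23 f0 a z b = 0 \<and> a + f0 \<ge> 0 \<and> b \<ge> 0 \<and> pt23 a z b \<noteq> Cpt f0"
    and l: "pt23 a z b \<in> B23l f0 \<longleftrightarrow> d23 f0 a z b = 0 \<and> a + f0 \<le> 0 \<and> b \<le> 0 \<and> pt23 a z b \<noteq> Cpt f0"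
    by (auto simp: B23r_def B23l_def pt23_inject)
  show "pt23 a z b \<in> B23r f0 \<longleftrightarrow> d23 f0 a z b = 0 \<and> a + f0 + b > 0"
    unfolding r C' using sign by auto
  show "pt23 a z b \<in> B23l f0 \<longleftrightarrow> d23 f0 a z b = 0 \<and> a + f0 + b < 0"
    unfolding l C' using sign by auto
qed

lemma B23_subsets_O23:
  "B23_neg f0 \<subseteq> O23" "B23r_pos f0 \<subseteq> O23" "B23l_pos f0 \<subseteq> O23" "B23r f0 \<subseteq> O23" "B23l f0 \<subseteq> O23" "B23 f0 \<subseteq> O23"
  by (auto simp: O23_def B23_def B23_neg_def B23r_pos_def B23l_pos_def B23r_def B23l_def)

context sl_problem
begin

lemma f0: "f 0 \<noteq> 0"
  by (simp add: f_nonzero)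

lemmas mem = pt23_mem[OF f0]

lemma Cpt_O23: "Cpt (f 0) \<in> O23"
  unfolding Cpt_eq_pt23[OF f0] O23_def by blast

lemma inertia_on:
  "pt23 a z b \<in> B23_neg (f 0) \<Longrightarrow> nonpos a z b = 1 \<and> nullity a z b = 0"
  "pt23 a z b \<in> B23r_pos (f 0) \<Longrightarrow> nonpos a z b = 0 \<and> nullity a z b = 0"
  "pt23 a z b \<in> B23l_pos (f 0) \<Longrightarrow> nonpos a z b = 2 \<and> nullity a z b = 0"
  "pt23 a z b \<in> B23r (f 0) \<Longrightarrow> nonpos a z b = 1 \<and> nullity a z b = 1"
  "pt23 a z b \<in> B23l (f 0) \<Longrightarrow> nonpos a z b = 2 \<and> nullity a z b = 1"
  "pt23 a z b = Cpt (f 0) \<Longrightarrow> nonpos a z b = 2 \<and> nullity a z b = 2"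
  unfolding mem(2-6) by (simp_all add: inertia_neg inertia_pos_r inertia_pos_l inertia_zero_r inertia_zero_l)
    (auto simp: Cpt_eq_pt23[OF f0] pt23_inject inertia_C)

lemma nullity_B23: "pt23 a z b \<in> B23 (f 0) - {Cpt (f 0)} \<Longrightarrow> nullity a z b = 1"
  using inertia_on[of a z b] mem[of a z b] by (auto simp: linorder_neq_iff)

lemma nullity_O23: "pt23 a z b \<in> O23 - B23 (f 0) \<Longrightarrow> nullity a z b = 0"
proof -
  assume "pt23 a z b \<in> O23 - B23 (f 0)"
  then have "d23 (f 0) a z b \<noteq> 0" using mem(1) by blast
  then consider "d23 (f 0) a z b < 0" | "d23 (f 0) a z b > 0" by linarith
  then show ?thesis
  proof cases
    case 2
    \<comment> \<open>A positive determinant forces diagonal entries of equal strict sign, so the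
      point lies in one of the two definite regions.\<close>
    then have "(a + f 0) * b > 0" unfolding d23_def using zero_le_power2[of "cmod z"] by linarith
    then show ?thesis using 2 inertia_pos_r inertia_pos_l by (auto simp: zero_less_mult_iff)
  qed (rule inertia_neg)
qed


abbreviation "ca x \<equiv> fst (coords x)"
abbreviation "cz x \<equiv> fst (snd (coords x))"
abbreviation "cb x \<equiv> snd (snd (coords x))"

lemma pt23_coords: "x \<in> O23 \<Longrightarrow> pt23 (ca x) (cz x) (cb x) = x"
  by (auto simp: O23_def coords_pt23)

lemma coord_limits:
  assumes "S \<subseteq> O23"
  shows "(ca \<longlongrightarrow> a) (approach (pt23 a z b) S)" "(cz \<longlongrightarrow> z) (approach (pt23 a z b) S)"
    "(cb \<longlongrightarrow> b) (approach (pt23 a z b) S)"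
  using tendsto_fst[OF coords_tendsto[OF assms, of a z b]]
    tendsto_fst[OF tendsto_snd[OF coords_tendsto[OF assms, of a z b]]]
    tendsto_snd[OF tendsto_snd[OF coords_tendsto[OF assms, of a z b]]] by simp_all

text \<open>On S the coordinates invert \<open>pt23\<close>, so limits proved along coordinates are
  limits of the eigenvalue functions themselves.\<close>

lemma filterlim_approach_coords:
  assumes "S \<subseteq> O23"
  shows "filterlim (\<lambda>x. eig N f q w n (pt23 (ca x) (cz x) (cb x))) G (approach \<A> S) \<longleftrightarrow>
    filterlim (eig N f q w n) G (approach \<A> S)"
proof (rule filterlim_cong[OF refl refl])
  show "\<forall>\<^sub>F x in approach \<A> S. eig N f q w n (pt23 (ca x) (cz x) (cb x)) = eig N f q w n x"
    using eventually_approach_mem by eventually_elim (use assms pt23_coords in auto)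
qed

lemma eventually_approach_inertia:
  assumes "S \<subseteq> O23" "\<And>a z b. pt23 a z b \<in> S \<Longrightarrow> P a z b"
  shows "\<forall>\<^sub>F x in approach \<A> S. P (ca x) (cz x) (cb x)"
  using eventually_approach_mem
proof eventually_elim
  case (elim x)
  then have "pt23 (ca x) (cz x) (cb x) \<in> S" using assms(1) pt23_coords by auto
  then show ?case by (rule assms(2))
qed

lemma eig_tendsto_approach:
  assumes S: "S \<subseteq> O23"
    and in_S: "\<And>a' z' b'. pt23 a' z' b' \<in> S \<Longrightarrow> nonpos a' z' b' + s = nonpos a z b \<and> n + nullity a' z' b' < N"
    and n: "s \<le> n" "n - s + nullity a z b < N"
  shows "(eig N f q w n \<longlongrightarrow> eig N f q w (n - s) (pt23 a z b)) (approach (pt23 a z b) S)"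
proof -
  have "((\<lambda>x. eig N f q w n (pt23 (ca x) (cz x) (cb x))) \<longlongrightarrow> eig N f q w (n - s) (pt23 a z b)) (approach (pt23 a z b) S)"
    by (rule eig_tendsto[OF coord_limits[OF S] _ _ n]; rule eventually_approach_inertia[OF S]) (auto dest: in_S)
  then show ?thesis unfolding filterlim_approach_coords[OF S] .
qed

lemma eig_at_bot_approach:
  assumes S: "S \<subseteq> O23"
    and in_S: "\<And>a' z' b'. pt23 a' z' b' \<in> S \<Longrightarrow> nonpos a' z' b' + n < nonpos a z b \<and> n + nullity a' z' b' < N"
  shows "filterlim (eig N f q w n) at_bot (approach (pt23 a z b) S)"
proof -
  have "filterlim (\<lambda>x. eig N f q w n (pt23 (ca x) (cz x) (cb x))) at_bot (approach (pt23 a z b) S)"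
    by (rule eig_at_bot[OF coord_limits[OF S]]; rule eventually_approach_inertia[OF S]) (auto dest: in_S)
  then show ?thesis unfolding filterlim_approach_coords[OF S] .
qed

lemma eig_at_top_approach:
  assumes S: "S \<subseteq> O23"
    and in_S: "\<And>a' z' b'. pt23 a' z' b' \<in> S \<Longrightarrow>
      N + nonpos a z b \<le> nonpos a' z' b' + n + nullity a z b \<and> n + nullity a' z' b' < N"
  shows "filterlim (eig N f q w n) at_top (approach (pt23 a z b) S)"
proof -
  have "filterlim (\<lambda>x. eig N f q w n (pt23 (ca x) (cz x) (cb x))) at_top (approach (pt23 a z b) S)"
    by (rule eig_at_top[OF coord_limits[OF S]]; rule eventually_approach_inertia[OF S]) (auto dest: in_S)
  then show ?thesis unfolding filterlim_approach_coords[OF S] .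
qed

text \<open>Constant \<open>nonpos\<close> means no shift of numbering, even when
  \<open>nullity\<close> varies on S and the number of eigenvalues changes.\<close>

lemma eig_continuous_on_const_inertia:
  assumes S: "S \<subseteq> O23"
    and in_S: "\<And>a z b. pt23 a z b \<in> S \<Longrightarrow> nonpos a z b = k \<and> n + nullity a z b < N"
  shows "eig_continuous_on N f q w n S"
proof (rule eig_continuous_onI[OF S])
  fix \<A> assume A: "\<A> \<in> S"
  then obtain a z b where pt: "\<A> = pt23 a z b" using S by (auto simp: O23_def)
  show "eig_defined N f q w n \<A>"
    using in_S A unfolding pt eig_defined_iff by blast
  have "(eig N f q w n \<longlongrightarrow> eig N f q w (n - 0) (pt23 a z b)) (approach (pt23 a z b) S)"
    by (rule eig_tendsto_approach[OF S]) (use in_S A pt in auto)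
  then show "(eig N f q w n \<longlongrightarrow> eig N f q w n \<A>) (approach \<A> S)"
    by (simp add: pt)
qed

text \<open>Both eigenvalues of the boundary matrix depend continuously on the coordinates and are
  nonzero at the limit, so their signs persist.\<close>

lemma eventually_nonpos_eq:
  assumes lim: "(A \<longlongrightarrow> a) F" "(Z \<longlongrightarrow> z) F" "(B \<longlongrightarrow> b) F" and "nullity a z b = 0"
  shows "\<forall>\<^sub>F x in F. nonpos (A x) (Z x) (B x) = nonpos a z b"
proof -
  have lim_k: "((\<lambda>x. kappa (A x) (Z x) (B x) i) \<longlongrightarrow> kappa a z b i) F" for i
    unfolding kappa_def by (intro tendsto_intros lim) auto
  have "\<forall>\<^sub>F x in F. kappa (A x) (Z x) (B x) i \<le> 0 \<longleftrightarrow> kappa a z b i \<le> 0" if "kappa a z b i \<noteq> 0" for i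
  proof (cases "kappa a z b i < 0")
    case True
    from order_tendstoD(2)[OF lim_k this] show ?thesis
      by eventually_elim (use True in auto)
  next
    case False
    then have "kappa a z b i > 0" using that by simp
    from order_tendstoD(1)[OF lim_k this] show ?thesis
      by eventually_elim (use that False in auto)
  qed
  moreover have "kappa a z b 0 \<noteq> 0" "kappa a z b 1 \<noteq> 0"
    using assms(4) by (auto simp: nullity_def card_less_2 split: if_splits)
  ultimately have "\<forall>\<^sub>F x in F. (kappa (A x) (Z x) (B x) 0 \<le> 0 \<longleftrightarrow> kappa a z b 0 \<le> 0) \<and>
      (kappa (A x) (Z x) (B x) 1 \<le> 0 \<longleftrightarrow> kappa a z b 1 \<le> 0)"
    by (simp add: eventually_conj_iff)
  then show ?thesis
    by eventually_elim (simp add: nonpos_def card_less_2)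
qed

lemma eig_continuous_on_generic:
  assumes "n < N"
  shows "eig_continuous_on N f q w n (O23 - B23 (f 0))"
proof (rule eig_continuous_onI)
  fix \<A> assume A: "\<A> \<in> O23 - B23 (f 0)"
  then obtain a z b where pt: "\<A> = pt23 a z b" by (auto simp: O23_def)
  let ?F = "approach (pt23 a z b) (O23 - B23 (f 0))"
  have null: "nullity a z b = 0" using A nullity_O23 pt by blast
  then show "eig_defined N f q w n \<A>" using assms unfolding pt eig_defined_iff by simp
  have S: "O23 - B23 (f 0) \<subseteq> O23" by blast
  have np: "\<forall>\<^sub>F x in ?F. nonpos (ca x) (cz x) (cb x) + 0 = nonpos a z b"
    using eventually_nonpos_eq[OF coord_limits[OF S] null] by simp
  have def: "\<forall>\<^sub>F x in ?F. n + nullity (ca x) (cz x) (cb x) < N"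
    by (rule eventually_approach_inertia[OF S]) (use nullity_O23 assms in simp)
  have "((\<lambda>x. eig N f q w n (pt23 (ca x) (cz x) (cb x))) \<longlongrightarrow> eig N f q w (n - 0) (pt23 a z b)) ?F"
    by (rule eig_tendsto[OF coord_limits[OF S] np def]) (use assms null in auto)
  then show "(eig N f q w n \<longlongrightarrow> eig N f q w n \<A>) (approach \<A> (O23 - B23 (f 0)))"
    unfolding filterlim_approach_coords[OF S] pt by simp
qed blast

lemma eig_mono_coords:
  assumes "S \<in> {B23_neg (f 0), B23r_pos (f 0), B23l_pos (f 0)}" "n < N"
    and "pt23 a z b \<in> S" "pt23 a' z b' \<in> S" "a \<le> a'" "b \<le> b'"
  shows "eig N f q w n (pt23 a z b) \<le> eig N f q w n (pt23 a' z b')"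
proof (rule eig_mono_form)
  show "Re (boundary_form a z b y y) \<le> Re (boundary_form a' z b' y y)" for y
    unfolding boundary_diag using assms(5,6) by (intro add_mono mult_right_mono order_refl) auto
qed (use assms inertia_on in auto)

section \<open>Discontinuity on the cone\<close>

lemma approach_B23r_pos_nontrivial:
  assumes "d23 (f 0) a z b = 0" "a + f 0 \<ge> 0" "b \<ge> 0"
  shows "approach (pt23 a z b) (B23r_pos (f 0)) \<noteq> bot"
proof (rule approach_nontrivial[where F = "at_right 0" and A = "\<lambda>t. a + t" and Z = "\<lambda>_. z" and B = "\<lambda>t. b + t"])
  \<comment> \<open>Adding t to both diagonal entries raises the determinant by t times the trace
    plus t^2, which is positive even at the vertex.\<close>
  have "pt23 (a + t) z (b + t) \<in> B23r_pos (f 0) \<and> pt23 (a + t) z (b + t) \<noteq> pt23 a z b" if "t > 0" for t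
  proof -
    have "d23 (f 0) (a + t) z (b + t) = d23 (f 0) a z b + (t * (a + f 0 + b) + t * t)"
      by (simp add: d23_def algebra_simps)
    moreover have "t * (a + f 0 + b) + t * t > 0"
      using that assms by (intro add_nonneg_pos mult_nonneg_nonneg) auto
    ultimately show ?thesis using assms that unfolding mem pt23_inject by simp
  qed
  then show "\<forall>\<^sub>F t in at_right 0. pt23 (a + t) z (b + t) \<in> B23r_pos (f 0) \<and> pt23 (a + t) z (b + t) \<noteq> pt23 a z b"
    by (simp add: eventually_at_filter)
qed (auto intro!: tendsto_eq_intros)

text \<open>If b < 0, raising a lowers the determinant; if b = 0 and a + f 0 < 0, raising b does; at
  the vertex z is moved instead and the determinant becomes -t^2.\<close>

lemma approach_B23_neg_nontrivial:
  assumes "d23 (f 0) a z b = 0" "a + f 0 \<le> 0" "b \<le> 0"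
  shows "approach (pt23 a z b) (B23_neg (f 0)) \<noteq> bot"
proof -
  consider "b < 0" | "b = 0" "a + f 0 < 0" | "b = 0" "a + f 0 = 0" using assms by linarith
  then show ?thesis
  proof cases
    case 1
    show ?thesis
    proof (rule approach_nontrivial[where F = "at_right 0" and A = "\<lambda>t. a + t" and Z = "\<lambda>_. z" and B = "\<lambda>_. b"])
      have "pt23 (a + t) z b \<in> B23_neg (f 0) \<and> pt23 (a + t) z b \<noteq> pt23 a z b" if "t > 0" for t
      proof -
        have "d23 (f 0) (a + t) z b = d23 (f 0) a z b + t * b" by (simp add: d23_def algebra_simps)
        then show ?thesis using that 1 assms(1) unfolding mem pt23_inject by (simp add: mult_pos_neg)
      qed
      then show "\<forall>\<^sub>F t in at_right 0. pt23 (a + t) z b \<in> B23_neg (f 0) \<and> pt23 (a + t) z b \<noteq> pt23 a z b"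
        by (simp add: eventually_at_filter)
    qed (auto intro!: tendsto_eq_intros)
  next
    case 2
    show ?thesis
    proof (rule approach_nontrivial[where F = "at_right 0" and A = "\<lambda>_. a" and Z = "\<lambda>_. z" and B = "\<lambda>t. b + t"])
      have "pt23 a z (b + t) \<in> B23_neg (f 0) \<and> pt23 a z (b + t) \<noteq> pt23 a z b" if "t > 0" for t
      proof -
        have "d23 (f 0) a z (b + t) = d23 (f 0) a z b + (a + f 0) * t" by (simp add: d23_def algebra_simps)
        then show ?thesis using that 2 assms(1) unfolding mem pt23_inject by (simp add: mult_neg_pos)
      qed
      then show "\<forall>\<^sub>F t in at_right 0. pt23 a z (b + t) \<in> B23_neg (f 0) \<and> pt23 a z (b + t) \<noteq> pt23 a z b"
        by (simp add: eventually_at_filter)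
    qed (auto intro!: tendsto_eq_intros)
  next
    case 3
    then have z: "z = 0" using assms(1) by (simp add: d23_def)
    show ?thesis
    proof (rule approach_nontrivial[where F = "at_right 0" and A = "\<lambda>_. a" and Z = "\<lambda>t. of_real t" and B = "\<lambda>_. b"])
      have "pt23 a (of_real t) b \<in> B23_neg (f 0) \<and> pt23 a (of_real t) b \<noteq> pt23 a z b" if "t > 0" for t
        using that 3 z unfolding mem pt23_inject by (simp add: d23_def)
      then show "\<forall>\<^sub>F t in at_right 0. pt23 a (of_real t) b \<in> B23_neg (f 0) \<and> pt23 a (of_real t) b \<noteq> pt23 a z b"
        by (simp add: eventually_at_filter)
      show "(complex_of_real \<longlongrightarrow> z) (at_right 0)" unfolding z using tendsto_of_real[OF tendsto_ident_at, of 0 "{0<..}"] by simp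
    qed auto
  qed
qed

lemma not_eig_continuous_at_if_bot:
  assumes "S \<subseteq> O23" "approach \<A> S \<noteq> bot" "filterlim (eig N f q w n) at_bot (approach \<A> S)"
  shows "\<not> eig_continuous_at N f q w n \<A>"
proof
  assume "eig_continuous_at N f q w n \<A>"
  then have "(eig N f q w n \<longlongrightarrow> eig N f q w n \<A>) (approach \<A> S)"
    using eig_continuous_atD assms(1) by blast
  then show False
    using not_tendsto_and_filterlim_at_infinity[OF assms(2)] filterlim_at_bot_imp_at_infinity[OF assms(3)] by blast
qed

text \<open>Along S one nonpositive eigenvalue is lost, so the function with index n tends to the
  value of index n - 1, or to -infinity if n = 0. Continuity is then possible only if the two
  neighbouring values coincide.\<close>

lemma not_eig_continuous_at_shift:
  assumes S: "S \<subseteq> O23" "approach (pt23 a z b) S \<noteq> bot"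
    and in_S: "\<And>a' z' b'. pt23 a' z' b' \<in> S \<Longrightarrow> nonpos a' z' b' + 1 = nonpos a z b \<and> nullity a' z' b' \<le> nullity a z b"
    and n: "\<not> (n \<ge> 1 \<and> eig_defined N f q w n (pt23 a z b) \<and> eig N f q w (n - 1) (pt23 a z b) = eig N f q w n (pt23 a z b))"
  shows "\<not> eig_continuous_at N f q w n (pt23 a z b)"
proof
  assume cont: "eig_continuous_at N f q w n (pt23 a z b)"
  then have "eig_defined N f q w n (pt23 a z b)" by (simp add: eig_continuous_at_def)
  then have def: "n + nullity a z b < N" by (simp only: eig_defined_iff)
  have def': "n + nullity a' z' b' < N" if "pt23 a' z' b' \<in> S" for a' z' b'
    using in_S[OF that] def by linarith
  show False
  proof (cases "n = 0")
    case True
    have "filterlim (eig N f q w n) at_bot (approach (pt23 a z b) S)"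
      by (rule eig_at_bot_approach[OF S(1)]) (use in_S def' True in fastforce)
    then show False using not_eig_continuous_at_if_bot[OF S] cont by blast
  next
    case False
    have "(eig N f q w n \<longlongrightarrow> eig N f q w (n - 1) (pt23 a z b)) (approach (pt23 a z b) S)"
      by (rule eig_tendsto_approach[OF S(1)]) (use in_S def' def False in auto)
    moreover have "(eig N f q w n \<longlongrightarrow> eig N f q w n (pt23 a z b)) (approach (pt23 a z b) S)"
      by (rule eig_continuous_atD[OF cont S(1)])
    ultimately have "eig N f q w (n - 1) (pt23 a z b) = eig N f q w n (pt23 a z b)"
      using tendsto_unique[OF S(2)] by blast
    then show False using n False \<open>eig_defined N f q w n (pt23 a z b)\<close> by simp
  qed
qed

text \<open>\<open>nonpos\<close> drops by one on entering \<open>B23r_pos\<close> from the right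
  nappe, and on entering \<open>B23_neg\<close> from the left nappe or from the vertex.\<close>

lemma not_eig_continuous_at_B23:
  assumes A: "\<A> \<in> B23 (f 0)"
    and n: "\<not> (n \<ge> 1 \<and> eig_defined N f q w n \<A> \<and> eig N f q w (n - 1) \<A> = eig N f q w n \<A>)"
  shows "\<not> eig_continuous_at N f q w n \<A>"
proof -
  obtain a z b where pt: "\<A> = pt23 a z b" using A by (auto simp: B23_def)
  have d: "d23 (f 0) a z b = 0" using A mem(1) pt by blast
  then have "(a + f 0) * b \<ge> 0" by (simp add: d23_def)
  then have sign: "(a + f 0 \<ge> 0 \<and> b \<ge> 0) \<or> (a + f 0 \<le> 0 \<and> b \<le> 0)" by (auto simp: zero_le_mult_iff)
  show ?thesis
  proof (cases "a + f 0 + b > 0")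
    case True
    then have "a + f 0 \<ge> 0" "b \<ge> 0" using sign by auto
    then show ?thesis
      unfolding pt using n[unfolded pt] approach_B23r_pos_nontrivial[OF d] inertia_on(2) inertia_zero_r[OF d True]
      by (intro not_eig_continuous_at_shift[OF B23_subsets_O23(2)]) auto
  next
    case False
    then have le: "a + f 0 \<le> 0" "b \<le> 0" using sign by auto
    have "nonpos a z b = 2"
      using inertia_zero_l[OF d] inertia_on(6)[of a z b] mem(7)[of a z b] d False by (cases "a + f 0 + b < 0") auto
    then show ?thesis
      unfolding pt using n[unfolded pt] approach_B23_neg_nontrivial[OF d le] inertia_on(1)
      by (intro not_eig_continuous_at_shift[OF B23_subsets_O23(1)]) auto
  qed
qed

lemma not_eig_defined_last: "\<A> \<in> B23 (f 0) \<Longrightarrow> \<not> eig_defined N f q w (N - 1) \<A>"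
proof -
  assume A: "\<A> \<in> B23 (f 0)"
  then obtain a z b where pt: "\<A> = pt23 a z b" by (auto simp: B23_def)
  have "nullity a z b \<ge> 1"
    using nullity_B23[of a z b] inertia_on(6)[of a z b] A unfolding pt by fastforce
  then show ?thesis unfolding pt eig_defined_iff by simp
qed

end

theorem theorem4p4:
  fixes N :: nat and f q w :: "nat \<Rightarrow> real"
  assumes N: "N \<ge> 2"
    and omega: "in_Omega N f q w"
  shows "
    \<comment> \<open>numbers of eigenvalues\<close>
    exactly_eigenvalues N f q w (Cpt (f 0)) (N - 2) \<and>
    (\<forall>\<A> \<in> B23 (f 0) - {Cpt (f 0)}. exactly_eigenvalues N f q w \<A> (N - 1)) \<and>
    (\<forall>\<A> \<in> O23 - B23 (f 0). exactly_eigenvalues N f q w \<A> N) \<and>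
    \<comment> \<open>(i)\<close>
    (\<forall>n<N. eig_continuous_on N f q w n (O23 - B23 (f 0))) \<and>
    \<comment> \<open>(ii)\<close>
    (\<forall>n<N. \<forall>S \<in> {B23_neg (f 0), B23r_pos (f 0), B23l_pos (f 0)}. \<forall>a a' z b.
        pt23 a z b \<in> S \<and> pt23 a' z b \<in> S \<and> a \<le> a' \<longrightarrow>
          eig N f q w n (pt23 a z b) \<le> eig N f q w n (pt23 a' z b)) \<and>
    (\<forall>n<N. \<forall>S \<in> {B23_neg (f 0), B23r_pos (f 0), B23l_pos (f 0)}. \<forall>a z b b'.
        pt23 a z b \<in> S \<and> pt23 a z b' \<in> S \<and> b \<le> b' \<longrightarrow>
          eig N f q w n (pt23 a z b) \<le> eig N f q w n (pt23 a z b')) \<and>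
    \<comment> \<open>(iii): at each point of the set the functions are not all continuous; moreover each
        single function with index \<open>n\<close> is discontinuous there, unless its value coincides with
        that of index \<open>n - 1\<close>, in which case the limits below from all sides coincide\<close>
    (\<forall>\<A>\<^sub>0 \<in> B23 (f 0). \<not> (\<forall>n<N. eig_continuous_at N f q w n \<A>\<^sub>0)) \<and>
    (\<forall>\<A>\<^sub>0 \<in> B23 (f 0). \<forall>n<N.
        \<not> (n \<ge> 1 \<and> eig_defined N f q w n \<A>\<^sub>0 \<and> eig N f q w (n - 1) \<A>\<^sub>0 = eig N f q w n \<A>\<^sub>0)
          \<longrightarrow> \<not> eig_continuous_at N f q w n \<A>\<^sub>0) \<and>
    \<comment> \<open>(iiia)\<close>
    (\<forall>\<A>\<^sub>0 \<in> B23r (f 0).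
        (\<forall>n. n + 2 \<le> N \<longrightarrow>
           (eig N f q w n \<longlongrightarrow> eig N f q w n \<A>\<^sub>0) (approach \<A>\<^sub>0 (B23_neg (f 0) \<union> B23r (f 0)))) \<and>
        filterlim (eig N f q w (N - 1)) at_top (approach \<A>\<^sub>0 (B23_neg (f 0))) \<and>
        filterlim (eig N f q w 0) at_bot (approach \<A>\<^sub>0 (B23r_pos (f 0))) \<and>
        (\<forall>n. 1 \<le> n \<and> n + 1 \<le> N \<longrightarrow>
           (eig N f q w n \<longlongrightarrow> eig N f q w (n - 1) \<A>\<^sub>0) (approach \<A>\<^sub>0 (B23r_pos (f 0))))) \<and>
    \<comment> \<open>(iiib)\<close>
    (\<forall>\<A>\<^sub>0 \<in> B23l (f 0).
        filterlim (eig N f q w 0) at_bot (approach \<A>\<^sub>0 (B23_neg (f 0))) \<and>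
        (\<forall>n. 1 \<le> n \<and> n + 1 \<le> N \<longrightarrow>
           (eig N f q w n \<longlongrightarrow> eig N f q w (n - 1) \<A>\<^sub>0) (approach \<A>\<^sub>0 (B23_neg (f 0)))) \<and>
        (\<forall>n. n + 2 \<le> N \<longrightarrow>
           (eig N f q w n \<longlongrightarrow> eig N f q w n \<A>\<^sub>0) (approach \<A>\<^sub>0 (B23l_pos (f 0) \<union> B23l (f 0)))) \<and>
        filterlim (eig N f q w (N - 1)) at_top (approach \<A>\<^sub>0 (B23l_pos (f 0)))) \<and>
    \<comment> \<open>(iiic)\<close>
    (filterlim (eig N f q w 0) at_bot
        (approach (Cpt (f 0)) (B23r_pos (f 0) \<union> B23r (f 0) \<union> B23_neg (f 0)))) \<and>
    (filterlim (eig N f q w 1) at_bot (approach (Cpt (f 0)) (B23r_pos (f 0)))) \<and>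
    (\<forall>n. n + 3 \<le> N \<longrightarrow>
        (eig N f q w n \<longlongrightarrow> eig N f q w n (Cpt (f 0)))
          (approach (Cpt (f 0)) (B23l_pos (f 0) \<union> B23l (f 0)))) \<and>
    (\<forall>n. 1 \<le> n \<and> n + 2 \<le> N \<longrightarrow>
        (eig N f q w n \<longlongrightarrow> eig N f q w (n - 1) (Cpt (f 0)))
          (approach (Cpt (f 0)) (B23r (f 0) \<union> B23_neg (f 0)))) \<and>
    (\<forall>n. 2 \<le> n \<and> n + 1 \<le> N \<longrightarrow>
        (eig N f q w n \<longlongrightarrow> eig N f q w (n - 2) (Cpt (f 0)))
          (approach (Cpt (f 0)) (B23r_pos (f 0)))) \<and>
    (filterlim (eig N f q w (N - 2)) at_top
        (approach (Cpt (f 0)) (B23l_pos (f 0) \<union> B23l (f 0)))) \<and>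
    (filterlim (eig N f q w (N - 1)) at_top
        (approach (Cpt (f 0)) (B23l_pos (f 0) \<union> B23_neg (f 0)))) \<and>
    \<comment> \<open>consequences\<close>
    (\<forall>n. n + 3 \<le> N \<longrightarrow> eig_continuous_on N f q w n (B23_neg (f 0) \<union> B23r (f 0))) \<and>
    (\<forall>n. n + 3 \<le> N \<longrightarrow>
        eig_continuous_on N f q w n (B23l_pos (f 0) \<union> B23l (f 0) \<union> {Cpt (f 0)})) \<and>
    (eig_continuous_on N f q w (N - 2) (B23_neg (f 0) \<union> B23r (f 0))) \<and>
    (eig_continuous_on N f q w (N - 2) (B23l_pos (f 0) \<union> B23l (f 0)))"
proof -
  interpret sl_problem N f q w
    using N omega by unfold_locales
  note sub = B23_subsets_O23
  note C = Cpt_eq_pt23[OF f0]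
  have subs: "B23_neg (f 0) \<union> B23r (f 0) \<subseteq> O23" "B23l_pos (f 0) \<union> B23l (f 0) \<subseteq> O23"
    "B23r_pos (f 0) \<union> B23r (f 0) \<union> B23_neg (f 0) \<subseteq> O23" "B23r (f 0) \<union> B23_neg (f 0) \<subseteq> O23"
    "B23l_pos (f 0) \<union> B23_neg (f 0) \<subseteq> O23" "B23l_pos (f 0) \<union> B23l (f 0) \<union> {Cpt (f 0)} \<subseteq> O23"
    using sub Cpt_O23 by simp_all
  have stay: "(eig N f q w n \<longlongrightarrow> eig N f q w n (pt23 a z b)) (approach (pt23 a z b) S)"
    if "S \<subseteq> O23" "n + nullity a z b < N"
      "\<And>a' z' b'. pt23 a' z' b' \<in> S \<Longrightarrow> nonpos a' z' b' = nonpos a z b \<and> n + nullity a' z' b' < N"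
    for n a z b S
    using eig_tendsto_approach[of S 0 a z b n] that by simp
  show ?thesis
  proof (intro conjI)
    show "exactly_eigenvalues N f q w (Cpt (f 0)) (N - 2)"
      using exactly_eigenvalues_pt23[of "- f 0" 0 0] by (simp add: C inertia_C)
    show "\<forall>\<A> \<in> B23 (f 0) - {Cpt (f 0)}. exactly_eigenvalues N f q w \<A> (N - 1)"
    proof
      fix \<A> assume A: "\<A> \<in> B23 (f 0) - {Cpt (f 0)}"
      then obtain a z b where pt: "\<A> = pt23 a z b" by (auto simp: B23_def)
      show "exactly_eigenvalues N f q w \<A> (N - 1)"
        using exactly_eigenvalues_pt23[of a z b] nullity_B23[of a z b] A unfolding pt by simp
    qed
    show "\<forall>\<A> \<in> O23 - B23 (f 0). exactly_eigenvalues N f q w \<A> N"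
    proof
      fix \<A> assume A: "\<A> \<in> O23 - B23 (f 0)"
      then obtain a z b where pt: "\<A> = pt23 a z b" by (auto simp: O23_def)
      show "exactly_eigenvalues N f q w \<A> N"
        using exactly_eigenvalues_pt23[of a z b] nullity_O23[of a z b] A unfolding pt by simp
    qed
    show "\<forall>n<N. eig_continuous_on N f q w n (O23 - B23 (f 0))"
      using eig_continuous_on_generic by blast
    show "\<forall>n<N. \<forall>S \<in> {B23_neg (f 0), B23r_pos (f 0), B23l_pos (f 0)}. \<forall>a a' z b.
        pt23 a z b \<in> S \<and> pt23 a' z b \<in> S \<and> a \<le> a' \<longrightarrow>
          eig N f q w n (pt23 a z b) \<le> eig N f q w n (pt23 a' z b)"
      using eig_mono_coords by blast
    show "\<forall>n<N. \<forall>S \<in> {B23_neg (f 0), B23r_pos (f 0), B23l_pos (f 0)}. \<forall>a z b b'.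
        pt23 a z b \<in> S \<and> pt23 a z b' \<in> S \<and> b \<le> b' \<longrightarrow>
          eig N f q w n (pt23 a z b) \<le> eig N f q w n (pt23 a z b')"
      using eig_mono_coords by blast
    show "\<forall>\<A>\<^sub>0 \<in> B23 (f 0). \<not> (\<forall>n<N. eig_continuous_at N f q w n \<A>\<^sub>0)"
    proof
      fix \<A> assume "\<A> \<in> B23 (f 0)"
      \<comment> \<open>On the cone at least one eigenvalue is missing, so the last index is never
        defined there.\<close>
      then have "\<not> eig_continuous_at N f q w (N - 1) \<A>"
        using not_eig_defined_last by (simp add: eig_continuous_at_def)
      moreover have "N - 1 < N" using N by simp
      ultimately show "\<not> (\<forall>n<N. eig_continuous_at N f q w n \<A>)" by blast
    qed
    show "\<forall>\<A>\<^sub>0 \<in> B23 (f 0). \<forall>n<N.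
        \<not> (n \<ge> 1 \<and> eig_defined N f q w n \<A>\<^sub>0 \<and> eig N f q w (n - 1) \<A>\<^sub>0 = eig N f q w n \<A>\<^sub>0)
          \<longrightarrow> \<not> eig_continuous_at N f q w n \<A>\<^sub>0"
      using not_eig_continuous_at_B23 by blast
  next
    show "\<forall>\<A>\<^sub>0 \<in> B23r (f 0).
        (\<forall>n. n + 2 \<le> N \<longrightarrow>
           (eig N f q w n \<longlongrightarrow> eig N f q w n \<A>\<^sub>0) (approach \<A>\<^sub>0 (B23_neg (f 0) \<union> B23r (f 0)))) \<and>
        filterlim (eig N f q w (N - 1)) at_top (approach \<A>\<^sub>0 (B23_neg (f 0))) \<and>
        filterlim (eig N f q w 0) at_bot (approach \<A>\<^sub>0 (B23r_pos (f 0))) \<and>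
        (\<forall>n. 1 \<le> n \<and> n + 1 \<le> N \<longrightarrow>
           (eig N f q w n \<longlongrightarrow> eig N f q w (n - 1) \<A>\<^sub>0) (approach \<A>\<^sub>0 (B23r_pos (f 0))))"
    proof
      fix \<A> assume A: "\<A> \<in> B23r (f 0)"
      then obtain a z b where pt: "\<A> = pt23 a z b" by (auto simp: B23r_def)
      \<comment> \<open>\<open>nonpos\<close> is also 1 on \<open>B23_neg\<close> and
        \<open>B23r\<close>, so nothing shifts and the surplus eigenvalue of \<open>B23_neg\<close>
        must go up; on \<open>B23r_pos\<close> it is 0, so the numbering shifts by one and the
        surplus goes down.\<close>
      have A0: "nonpos a z b = 1" "nullity a z b = 1" using inertia_on(4) A pt by auto
      show "(\<forall>n. n + 2 \<le> N \<longrightarrow>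
           (eig N f q w n \<longlongrightarrow> eig N f q w n \<A>) (approach \<A> (B23_neg (f 0) \<union> B23r (f 0)))) \<and>
        filterlim (eig N f q w (N - 1)) at_top (approach \<A> (B23_neg (f 0))) \<and>
        filterlim (eig N f q w 0) at_bot (approach \<A> (B23r_pos (f 0))) \<and>
        (\<forall>n. 1 \<le> n \<and> n + 1 \<le> N \<longrightarrow>
           (eig N f q w n \<longlongrightarrow> eig N f q w (n - 1) \<A>) (approach \<A> (B23r_pos (f 0))))"
        unfolding pt
        by (intro conjI allI impI stay subs eig_at_top_approach eig_at_bot_approach eig_tendsto_approach sub)
          (use N in \<open>auto simp: A0 dest!: inertia_on\<close>)
    qed
    show "\<forall>\<A>\<^sub>0 \<in> B23l (f 0).
        filterlim (eig N f q w 0) at_bot (approach \<A>\<^sub>0 (B23_neg (f 0))) \<and>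
        (\<forall>n. 1 \<le> n \<and> n + 1 \<le> N \<longrightarrow>
           (eig N f q w n \<longlongrightarrow> eig N f q w (n - 1) \<A>\<^sub>0) (approach \<A>\<^sub>0 (B23_neg (f 0)))) \<and>
        (\<forall>n. n + 2 \<le> N \<longrightarrow>
           (eig N f q w n \<longlongrightarrow> eig N f q w n \<A>\<^sub>0) (approach \<A>\<^sub>0 (B23l_pos (f 0) \<union> B23l (f 0)))) \<and>
        filterlim (eig N f q w (N - 1)) at_top (approach \<A>\<^sub>0 (B23l_pos (f 0)))"
    proof
      fix \<A> assume A: "\<A> \<in> B23l (f 0)"
      then obtain a z b where pt: "\<A> = pt23 a z b" by (auto simp: B23l_def)
      \<comment> \<open>Here \<open>B23l_pos\<close> and \<open>B23l\<close> share the value 2,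
        while \<open>B23_neg\<close> has 1 and takes over the shift.\<close>
      have A0: "nonpos a z b = 2" "nullity a z b = 1" using inertia_on(5) A pt by auto
      show "filterlim (eig N f q w 0) at_bot (approach \<A> (B23_neg (f 0))) \<and>
        (\<forall>n. 1 \<le> n \<and> n + 1 \<le> N \<longrightarrow>
           (eig N f q w n \<longlongrightarrow> eig N f q w (n - 1) \<A>) (approach \<A> (B23_neg (f 0)))) \<and>
        (\<forall>n. n + 2 \<le> N \<longrightarrow>
           (eig N f q w n \<longlongrightarrow> eig N f q w n \<A>) (approach \<A> (B23l_pos (f 0) \<union> B23l (f 0)))) \<and>
        filterlim (eig N f q w (N - 1)) at_top (approach \<A> (B23l_pos (f 0)))"
        unfolding pt
        by (intro conjI allI impI stay subs eig_at_top_approach eig_at_bot_approach eig_tendsto_approach sub)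
          (use N in \<open>auto simp: A0 dest!: inertia_on\<close>)
    qed
  next
    \<comment> \<open>At the vertex \<open>nonpos\<close> is 2 and the matrix is zero: the drop is 2
      on \<open>B23r_pos\<close>, 1 on \<open>B23_neg\<close> and \<open>B23r\<close>, and 0 on the
      left pieces. The drop is the number of eigenvalues that go to -infinity.\<close>
    show "filterlim (eig N f q w 0) at_bot
        (approach (Cpt (f 0)) (B23r_pos (f 0) \<union> B23r (f 0) \<union> B23_neg (f 0)))"
      unfolding C by (intro eig_at_bot_approach subs) (use N in \<open>auto simp: inertia_C dest!: inertia_on\<close>)
    show "filterlim (eig N f q w 1) at_bot (approach (Cpt (f 0)) (B23r_pos (f 0)))"
      unfolding C by (intro eig_at_bot_approach sub) (use N in \<open>auto simp: inertia_C dest!: inertia_on\<close>)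
    show "\<forall>n. n + 3 \<le> N \<longrightarrow>
        (eig N f q w n \<longlongrightarrow> eig N f q w n (Cpt (f 0))) (approach (Cpt (f 0)) (B23l_pos (f 0) \<union> B23l (f 0)))"
      unfolding C by (intro allI impI stay subs) (use N in \<open>auto simp: inertia_C dest!: inertia_on\<close>)
    show "\<forall>n. 1 \<le> n \<and> n + 2 \<le> N \<longrightarrow>
        (eig N f q w n \<longlongrightarrow> eig N f q w (n - 1) (Cpt (f 0))) (approach (Cpt (f 0)) (B23r (f 0) \<union> B23_neg (f 0)))"
      unfolding C by (intro allI impI eig_tendsto_approach subs) (use N in \<open>auto simp: inertia_C dest!: inertia_on\<close>)
    show "\<forall>n. 2 \<le> n \<and> n + 1 \<le> N \<longrightarrow>
        (eig N f q w n \<longlongrightarrow> eig N f q w (n - 2) (Cpt (f 0))) (approach (Cpt (f 0)) (B23r_pos (f 0)))"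
      unfolding C by (intro allI impI eig_tendsto_approach sub) (use N in \<open>auto simp: inertia_C dest!: inertia_on\<close>)
    show "filterlim (eig N f q w (N - 2)) at_top (approach (Cpt (f 0)) (B23l_pos (f 0) \<union> B23l (f 0)))"
      unfolding C by (intro eig_at_top_approach subs) (use N in \<open>auto simp: inertia_C dest!: inertia_on\<close>)
    \<comment> \<open>Only N - 2 values survive at the vertex: on \<open>B23_neg\<close> one
      eigenvalue goes down and one up, on \<open>B23l_pos\<close> both missing ones go up.\<close>
    show "filterlim (eig N f q w (N - 1)) at_top (approach (Cpt (f 0)) (B23l_pos (f 0) \<union> B23_neg (f 0)))"
      unfolding C by (intro eig_at_top_approach subs) (use N in \<open>auto simp: inertia_C dest!: inertia_on\<close>)
  next
    show "\<forall>n. n + 3 \<le> N \<longrightarrow> eig_continuous_on N f q w n (B23_neg (f 0) \<union> B23r (f 0))"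
      by (intro allI impI eig_continuous_on_const_inertia[where k = 1] subs) (auto dest!: inertia_on)
    show "\<forall>n. n + 3 \<le> N \<longrightarrow> eig_continuous_on N f q w n (B23l_pos (f 0) \<union> B23l (f 0) \<union> {Cpt (f 0)})"
      by (intro allI impI eig_continuous_on_const_inertia[where k = 2] subs) (auto dest!: inertia_on)
    show "eig_continuous_on N f q w (N - 2) (B23_neg (f 0) \<union> B23r (f 0))"
      by (rule eig_continuous_on_const_inertia[where k = 1]) (use N subs in \<open>auto dest!: inertia_on\<close>)
    show "eig_continuous_on N f q w (N - 2) (B23l_pos (f 0) \<union> B23l (f 0))"
      by (rule eig_continuous_on_const_inertia[where k = 2]) (use N subs in \<open>auto dest!: inertia_on\<close>)
  qed
qed

end
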